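(* Let $(Q_p : p \in [0,1])$ be the monotone coupling of the random complexes $Q_2(n,p)$, let $N_p$ be the number of maximal $1$-faces of $Q_p$, and define $$T_{sc} = \inf\{ p \in [0,1] : \pi_1(Q_p) = 0 \}, \qquad T_{2d} = \inf\{ p \in [0,1] : N_p = 0 \}.$$ Then with high probability $T_{sc} = T_{2d}$, i.e. $\lim_{n\to\infty}\mathbb{P}[T_{sc}=T_{2d}]=1$.
   Context: $Q^n=[0,1]^n$ is the $n$-dimensional cube with its standard cubical (face) structure, with vertex set $\{0,1\}^n$; $Q^n_k$ denotes its $k$-skeleton. The random $2$-dimensional cubical complex $Q_2(n,p)$ has $1$-skeleton equal to $Q^n_1$, and each $2$-dimensional face of $Q^n$ is included independently with probability $p$. The monotone coupling realizes all these complexes on one probability space so that the $2$-faces of $Q_{p_1}$ are a subset of those of $Q_{p_2}$ whenever $p_1 \le p_2$: attach to each $2$-face $f$ of $Q^n$ an independent uniform random variable $U_f$ on $[0,1]$, and let $Q_p$ be $Q^n_1$ together with all $2$-faces $f$ with $U_f \le p$. A maximal $1$-face is a $1$-face (edge) not contained in any $2$-face of the complex. *)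

theory Defs
  imports "HOL-Probability.Probability" "HOL-Algebra.Elementary_Groups"
begin

section \<open>The fundamental group\<close>

definition loops_at :: "'a::topological_space set \<Rightarrow> 'a \<Rightarrow> (real \<Rightarrow> 'a) set" where
  "loops_at S x = {g. path g \<and> path_image g \<subseteq> S \<and> pathstart g = x \<and> pathfinish g = x}"

definition homotopy_class :: "'a::topological_space set \<Rightarrow> (real \<Rightarrow> 'a) \<Rightarrow> (real \<Rightarrow> 'a) set" where
  "homotopy_class S g = {h. homotopic_paths S g h}"

definition fundamental_group :: "'a::topological_space set \<Rightarrow> 'a \<Rightarrow> (real \<Rightarrow> 'a) set monoid" where
  "fundamental_group S x =
     \<lparr>carrier = homotopy_class S ` loops_at S x,
      mult = (\<lambda>A B. \<Union>g\<in>A. \<Union>h\<in>B. homotopy_class S (g +++ h)),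
      one = homotopy_class S (\<lambda>_. x)\<rparr>"

lemma const_in_loops_at: "x \<in> S \<Longrightarrow> (\<lambda>_. x) \<in> loops_at S x"
  by (auto simp: loops_at_def path_def path_image_def pathstart_def pathfinish_def)

lemma join_in_loops_at: "g \<in> loops_at S x \<Longrightarrow> h \<in> loops_at S x \<Longrightarrow> g +++ h \<in> loops_at S x"
  by (auto simp: loops_at_def path_image_join)

lemma homotopy_class_eq_iff:
  assumes "h \<in> loops_at S x"
  shows "homotopy_class S g = homotopy_class S h \<longleftrightarrow> homotopic_paths S g h"
proof -
  have "homotopic_paths S h h"
    using assms by (simp add: loops_at_def)
  thus ?thesis
    unfolding homotopy_class_def set_eq_iff mem_Collect_eq
    by (metis homotopic_paths_sym homotopic_paths_trans)
qed

lemma mult_homotopy_class: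
  assumes "g \<in> loops_at S x" "h \<in> loops_at S x"
  shows "homotopy_class S g \<otimes>\<^bsub>fundamental_group S x\<^esub> homotopy_class S h = homotopy_class S (g +++ h)"
proof -
  have eq: "homotopy_class S (g' +++ h') = homotopy_class S (g +++ h)"
    if "g' \<in> homotopy_class S g" "h' \<in> homotopy_class S h" for g' h'
  proof -
    have "homotopic_paths S (g +++ h) (g' +++ h')"
      using that assms by (intro homotopic_paths_join) (auto simp: homotopy_class_def loops_at_def)
    thus ?thesis
      using homotopy_class_eq_iff[OF join_in_loops_at[OF assms]] homotopic_paths_sym by blast
  qed
  have "g \<in> homotopy_class S g" "h \<in> homotopy_class S h"
    using assms by (auto simp: homotopy_class_def loops_at_def)
  hence "(\<Union>g'\<in>homotopy_class S g. \<Union>h'\<in>homotopy_class S h. homotopy_class S (g' +++ h'))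
         = homotopy_class S (g +++ h)"
    by (intro UN_constant_eq[of g] UN_constant_eq[of h] ballI eq)
  thus ?thesis
    by (simp add: fundamental_group_def)
qed

lemma homotopic_paths_const_right:
  assumes "g \<in> loops_at S x"
  shows "homotopic_paths S (g +++ (\<lambda>_. x)) g"
proof -
  have "continuous_on {0..1} (\<lambda>t::real. if t \<le> 1/2 then 2 *\<^sub>R t else 1)"
    unfolding split_01
    by (rule continuous_on_cases continuous_intros | force simp: pathfinish_def joinpaths_def)+
  hence "homotopic_paths S g (g +++ (\<lambda>_. x))"
    using assms
    by (intro homotopic_paths_reparametrize[where f = "\<lambda>t. if t \<le> 1/2 then 2 *\<^sub>R t else 1"])
       (auto simp: loops_at_def joinpaths_def pathfinish_def)
  thus ?thesis
    by (rule homotopic_paths_sym)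
qed

lemma homotopic_paths_const_left:
  assumes "g \<in> loops_at S x"
  shows "homotopic_paths S ((\<lambda>_. x) +++ g) g"
proof -
  have "continuous_on {0..1} (\<lambda>t::real. if t \<le> 1/2 then 0 else 2 *\<^sub>R t - 1)"
    unfolding split_01
    by (rule continuous_on_cases continuous_intros | force simp: pathfinish_def joinpaths_def)+
  hence "homotopic_paths S g ((\<lambda>_. x) +++ g)"
    using assms
    by (intro homotopic_paths_reparametrize[where f = "\<lambda>t. if t \<le> 1/2 then 0 else 2 *\<^sub>R t - 1"])
       (auto simp: loops_at_def joinpaths_def pathstart_def)
  thus ?thesis
    by (rule homotopic_paths_sym)
qed

lemma reversepath_in_loops_at: "g \<in> loops_at S x \<Longrightarrow> reversepath g \<in> loops_at S x"
  by (auto simp: loops_at_def)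

lemma homotopic_paths_reversepath_join:
  assumes "g \<in> loops_at S x"
  shows "homotopic_paths S (reversepath g +++ g) (\<lambda>_. x)"
proof -
  define r where "r = reversepath g"
  have r: "r \<in> loops_at S x" "reversepath r = g"
    using reversepath_in_loops_at[OF assms] by (auto simp: r_def)
  have c: "continuous_on {0..1} r" and rS: "r ` {0..1} \<subseteq> S" and r0: "r 0 = x" "r 1 = x"
    using r(1) by (auto simp: loops_at_def path_def path_image_def pathstart_def pathfinish_def)
  define k where "k = (\<lambda>y::real \<times> real. fst y * (if snd y \<le> 1/2 then 2 * snd y else 2 - 2 * snd y))"
  have k_eq: "k = (\<lambda>y. fst y * (1 - \<bar>2 * snd y - 1\<bar>))"
    by (auto simp: k_def fun_eq_iff abs_if)
  have kc: "continuous_on ({0..1} \<times> {0..1}) k"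
    unfolding k_eq by (intro continuous_intros)
  have k01: "k ` ({0..1} \<times> {0..1}) \<subseteq> {0..1}"
    by (auto simp: k_eq intro!: mult_nonneg_nonneg mult_le_one)
  have "continuous_on ({0..1} \<times> {0..1}) (r \<circ> k)"
    using continuous_on_subset[OF c k01] kc by (intro continuous_on_compose)
  moreover have "(r \<circ> k) \<in> ({0..1} \<times> {0..1}) \<rightarrow> S"
    using k01 rS by (auto simp: image_subset_iff)
  ultimately have "homotopic_paths S (\<lambda>_. x) (r +++ reversepath r)"
    unfolding homotopic_paths
    by (intro exI[of _ "r \<circ> k"])
       (auto simp: k_def r0 joinpaths_def reversepath_def pathstart_def pathfinish_def algebra_simps)
  thus ?thesis
    by (metis homotopic_paths_sym r(2) r_def)
qed

lemma group_fundamental_group: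
  assumes "x \<in> S"
  shows "group (fundamental_group S x)"
proof (rule groupI)
  let ?G = "fundamental_group S x"
  have car: "carrier ?G = homotopy_class S ` loops_at S x"
    and one: "\<one>\<^bsub>?G\<^esub> = homotopy_class S (\<lambda>_. x)"
    by (simp_all add: fundamental_group_def)
  note const = const_in_loops_at[OF assms]
  show "\<one>\<^bsub>?G\<^esub> \<in> carrier ?G"
    unfolding car one using const by blast
  show "A \<otimes>\<^bsub>?G\<^esub> B \<in> carrier ?G" if "A \<in> carrier ?G" "B \<in> carrier ?G" for A B
    using that unfolding car by (auto simp: mult_homotopy_class join_in_loops_at)
  show "A \<otimes>\<^bsub>?G\<^esub> B \<otimes>\<^bsub>?G\<^esub> C = A \<otimes>\<^bsub>?G\<^esub> (B \<otimes>\<^bsub>?G\<^esub> C)"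
    if "A \<in> carrier ?G" "B \<in> carrier ?G" "C \<in> carrier ?G" for A B C
  proof -
    from that obtain a b c where abc: "a \<in> loops_at S x" "b \<in> loops_at S x" "c \<in> loops_at S x"
      "A = homotopy_class S a" "B = homotopy_class S b" "C = homotopy_class S c"
      unfolding car by auto
    have "homotopic_paths S ((a +++ b) +++ c) (a +++ (b +++ c))"
      using abc by (intro homotopic_paths_sym[OF homotopic_paths_assoc]) (auto simp: loops_at_def)
    thus ?thesis
      using abc by (simp add: mult_homotopy_class join_in_loops_at homotopy_class_eq_iff[where x = x])
  qed
  show "\<one>\<^bsub>?G\<^esub> \<otimes>\<^bsub>?G\<^esub> A = A" if "A \<in> carrier ?G" for A
  proof -
    from that obtain a where a: "a \<in> loops_at S x" "A = homotopy_class S a"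
      unfolding car by auto
    thus ?thesis
      using homotopic_paths_const_left[OF a(1)] const
      by (simp add: one mult_homotopy_class homotopy_class_eq_iff[where x = x])
  qed
  show "\<exists>B\<in>carrier ?G. B \<otimes>\<^bsub>?G\<^esub> A = \<one>\<^bsub>?G\<^esub>" if "A \<in> carrier ?G" for A
  proof -
    from that obtain a where a: "a \<in> loops_at S x" "A = homotopy_class S a"
      unfolding car by auto
    show ?thesis
      using a homotopic_paths_reversepath_join[OF a(1)] const reversepath_in_loops_at[OF a(1)]
      by (intro bexI[of _ "homotopy_class S (reversepath a)"])
         (auto simp: one car mult_homotopy_class homotopy_class_eq_iff[where x = x])
  qed
qed


section \<open>The cube and its random subcomplexes\<close>

text \<open>
  The dimension of the cube varies, so all cubes live in the type \<^typ>\<open>nat \<Rightarrow> real\<close>, whose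
  topology is the product topology.  Points of the \<open>n\<close>-cube are extensional functions on
  \<open>{..<n}\<close>; as all other coordinates are constant, the subspace topology is that of \<open>[0,1]\<^sup>n\<close>.
  A face is a product of \<open>n\<close> factors \<open>{0}\<close>, \<open>{1}\<close>, \<open>[0,1]\<close>, and its dimension is the number of
  factors \<open>[0,1]\<close>.
\<close>

definition cube_faces :: "nat \<Rightarrow> nat \<Rightarrow> (nat \<Rightarrow> real) set set" where
  "cube_faces n k =
     {Pi\<^sub>E {..<n} J | J. (\<forall>i<n. J i \<in> {{0}, {1}, {0..1}}) \<and> card {i. i < n \<and> J i = {0..1}} = k}"

text \<open>The complex \<open>Q\<^sub>p\<close>, as a set of faces, for the labelling \<open>u\<close> of the 2-faces.\<close>

definition Q :: "nat \<Rightarrow> ((nat \<Rightarrow> real) set \<Rightarrow> real) \<Rightarrow> real \<Rightarrow> (nat \<Rightarrow> real) set set" where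
  "Q n u p = cube_faces n 0 \<union> cube_faces n 1 \<union> {f \<in> cube_faces n 2. u f \<le> p}"

definition maximal_1_faces :: "nat \<Rightarrow> (nat \<Rightarrow> real) set set \<Rightarrow> (nat \<Rightarrow> real) set set" where
  "maximal_1_faces n K = {e \<in> K \<inter> cube_faces n 1. \<not> (\<exists>f \<in> K \<inter> cube_faces n 2. e \<subseteq> f)}"

definition N :: "nat \<Rightarrow> ((nat \<Rightarrow> real) set \<Rightarrow> real) \<Rightarrow> real \<Rightarrow> nat" where
  "N n u p = card (maximal_1_faces n (Q n u p))"

text \<open>
  \<open>Q\<^sub>p\<close> contains the connected 1-skeleton of the cube, so the choice of base point is immaterial;
  we take the vertex 0.
\<close>

definition T_sc :: "nat \<Rightarrow> ((nat \<Rightarrow> real) set \<Rightarrow> real) \<Rightarrow> real" where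
  "T_sc n u = Inf {p \<in> {0..1}. trivial_group (fundamental_group (\<Union>(Q n u p)) (\<lambda>i\<in>{..<n}. 0))}"

definition T_2d :: "nat \<Rightarrow> ((nat \<Rightarrow> real) set \<Rightarrow> real) \<Rightarrow> real" where
  "T_2d n u = Inf {p \<in> {0..1}. N n u p = 0}"

text \<open>
  For \<open>n \<ge> 2\<close> and labels in \<open>[0,1]\<close> both sets contain \<open>1\<close>, so the unspecified value \<open>Inf {}\<close> can
  only occur for \<open>n < 2\<close> or on a null event.
\<close>

end

theory Submission
  imports Defs "HOL-Complex_Analysis.Complex_Analysis" "HOL-Real_Asymp.Real_Asymp"
begin

text \<open>
  An edge in no square always destroys simple connectivity: the complex can be mapped to the boundary of a
  plane square so that one side is covered by this edge alone, and then a loop that traverses the edge once winds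
  around the square (\<open>isolated_edge_nontrivial\<close>).  The content of the theorem is the converse, with high probability and
  simultaneously for all \<open>p\<close>.  The density \<open>2/5\<close> is below \<open>1/2\<close>, so isolated edges are
  likely to exist at \<open>2/5\<close> (\<open>prob_no_isolated_edge\<close>), and smaller \<open>p\<close> are irrelevant for both hitting times.  For
  larger \<open>p\<close> the complex contains the one at \<open>2/5\<close>, so it suffices to find likely properties of the complex at \<open>2/5\<close>
  alone which imply that any larger complex without isolated edges is simply connected.

  By cellular approximation (\<open>loop_homotopic_word_path\<close>) a loop is a closed word in the \<open>n\<close> directions, up to
  cancellation of backtracking and commutation of two directions across a square.  So the complex is simply
  connected if any two directions commute at any vertex (\<open>closed_word_trivial\<close>).  New commutations come from
  3-cubes: if five faces have trivial boundary, then so has the sixth one (\<open>comm_cube\<close>).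

  Call an edge light if it lies in fewer than \<open>2 * s\<close> squares at density \<open>2/5\<close>, where \<open>s\<close> is about
  \<open>n powr (2/3)\<close>.  An edge is light with probability about \<open>(3/5) ^ n\<close>, and \<open>2 ^ n * (3/5) ^ (2 * n)\<close> tends to 0, so there
  are no two light edges close to each other.  At an edge that is not light, fewer than
  \<open>s\<close> directions fail to commute with the edge (\<open>bad_small\<close>): otherwise there would be \<open>s * s\<close> disjoint
  groups of four squares, none of which is completely open, and \<open>s * s\<close> is much larger than \<open>n\<close>.  So a square without
  light edges can be moved in almost all directions to a parallel square without changing whether its boundary is
  trivial.  Two such moves reach an open square (\<open>heavy_square_comm\<close>), because it is again a
  coincidence of two events of probability about \<open>(3/5) ^ n\<close> that two intermediate squares have almost no open
  translate.  Finally, let a square contain a light edge.  The light edge lies in some other square of the larger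
  complex, or the given square is itself in the complex.  In the first case the two squares span a 3-cube whose other
  four faces have no light edges, so the given square has trivial boundary (\<open>light_edge_comm\<close>).
\<close>

section \<open>Faces of the cube and straight-line homotopies\<close>

definition flip :: "nat \<Rightarrow> nat set \<Rightarrow> nat set" where
  "flip i S = (if i \<in> S then S - {i} else insert i S)"

text \<open>
  Vertices and directions are sets and elements of \<open>{..<n}\<close>.  A face is given by one of its vertices
  \<open>S\<close> and its set \<open>A\<close> of free directions; \<open>S\<close> matters only outside \<open>A\<close>.
\<close>
definition vert :: "nat \<Rightarrow> nat set \<Rightarrow> nat \<Rightarrow> real" where
  "vert n S = (\<lambda>i\<in>{..<n}. of_bool (i \<in> S))"

definition face :: "nat \<Rightarrow> nat set \<Rightarrow> nat set \<Rightarrow> (nat \<Rightarrow> real) set" where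
  "face n S A = Pi\<^sub>E {..<n} (\<lambda>i. if i \<in> A then {0..1} else {of_bool (i \<in> S)})"

text \<open>
  The type of points carries no real vector space structure, so segments are defined by coordinates.
  The arbitrary common value of extensional functions outside \<open>{..<n}\<close> is preserved.
\<close>
definition seg :: "(nat \<Rightarrow> real) \<Rightarrow> (nat \<Rightarrow> real) \<Rightarrow> real \<Rightarrow> nat \<Rightarrow> real" where
  "seg x y = (\<lambda>t i. (1 - t) * x i + t * y i)"

fun word_path :: "nat \<Rightarrow> nat set \<Rightarrow> nat list \<Rightarrow> real \<Rightarrow> nat \<Rightarrow> real" where
  "word_path n S [] = (\<lambda>_. vert n S)"
| "word_path n S (i # w) = seg (vert n S) (vert n (flip i S)) +++ word_path n (flip i S) w"

definition cube_complex :: "nat \<Rightarrow> (nat \<Rightarrow> real) set set \<Rightarrow> (nat \<Rightarrow> real) set" where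
  "cube_complex n W = \<Union>(cube_faces n 0 \<union> cube_faces n 1 \<union> (W \<inter> cube_faces n 2))"

definition cell :: "nat \<Rightarrow> (nat \<Rightarrow> real) set set \<Rightarrow> nat set \<Rightarrow> nat set \<Rightarrow> bool" where
  "cell n W S A \<longleftrightarrow> A \<subseteq> {..<n} \<and> (card A \<le> 1 \<or> card A = 2 \<and> face n S A \<in> W)"

lemma in_flip_iff: "j \<in> flip i S \<longleftrightarrow> (j \<in> S) \<noteq> (j = i)"
  by (auto simp: flip_def)

lemma flip_flip [simp]: "flip i (flip i S) = S"
  by (auto simp: in_flip_iff)

lemma flip_commute: "flip a (flip b S) = flip b (flip a S)"
  by (auto simp: in_flip_iff)

lemma flip_subset: "S \<subseteq> {..<n} \<Longrightarrow> i < n \<Longrightarrow> flip i S \<subseteq> {..<n}"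
  by (auto simp: flip_def)

lemma vert_in_face: "vert n S \<in> face n S A"
  by (auto simp: vert_def face_def)

lemma in_face_iff:
  "x \<in> face n S A \<longleftrightarrow> x \<in> extensional {..<n} \<and>
     (\<forall>i<n. if i \<in> A then 0 \<le> x i \<and> x i \<le> 1 else x i = of_bool (i \<in> S))"
  by (auto simp: face_def PiE_iff split: if_splits)

lemma vert_in_face_iff:
  "vert n S' \<in> face n S A \<longleftrightarrow> (\<forall>i<n. i \<notin> A \<longrightarrow> (i \<in> S \<longleftrightarrow> i \<in> S'))"
  by (auto simp: in_face_iff vert_def)

text \<open>
  A point with coordinate \<open>1/2\<close> in a direction of \<open>A\<close> detects the free directions, and the vertex \<open>S\<close>
  detects the fixed coordinates.
\<close>
lemma face_subset_iff:
  assumes "A \<subseteq> {..<n}"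
  shows "face n S A \<subseteq> face n S' A' \<longleftrightarrow> A \<subseteq> A' \<and> (\<forall>i<n. i \<notin> A' \<longrightarrow> (i \<in> S \<longleftrightarrow> i \<in> S'))"
    (is "?l \<longleftrightarrow> ?r")
proof
  assume l: ?l
  have 1: "i \<in> A'" if "i \<in> A" for i
  proof (rule ccontr)
    assume "i \<notin> A'"
    define x where "x = (vert n S)(i := 1/2)"
    have "i < n" using that assms by auto
    hence "x \<in> face n S A" using that by (auto simp: in_face_iff x_def vert_def extensional_def)
    hence "x \<in> face n S' A'" using l by auto
    with \<open>i \<notin> A'\<close> \<open>i < n\<close> show False
      by (auto simp: in_face_iff x_def of_bool_def dest!: spec[of _ i] split: if_splits)
  qed
  have "vert n S \<in> face n S' A'" using l vert_in_face[of n S A] by (rule subsetD)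
  hence 2: "\<forall>i<n. i \<notin> A' \<longrightarrow> (i \<in> S') = (i \<in> S)" by (simp only: vert_in_face_iff)
  show ?r
  proof (intro conjI allI impI)
    show "A \<subseteq> A'" using 1 by (rule subsetI)
    fix i assume "i < n" "i \<notin> A'"
    with 2 show "(i \<in> S) = (i \<in> S')" by metis
  qed
next
  assume r: ?r
  show ?l
  proof
    fix x assume "x \<in> face n S A"
    hence x: "x \<in> extensional {..<n}" 
      "\<And>i. i < n \<Longrightarrow> if i \<in> A then 0 \<le> x i \<and> x i \<le> 1 else x i = of_bool (i \<in> S)"
      by (auto simp: in_face_iff)
    show "x \<in> face n S' A'"
      unfolding in_face_iff
    proof (intro conjI allI impI x(1))
      fix i assume i: "i < n"
      show "if i \<in> A' then 0 \<le> x i \<and> x i \<le> 1 else x i = of_bool (i \<in> S')"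
      proof (cases "i \<in> A'")
        case True
        with x(2)[OF i] show ?thesis by (cases "i \<in> A"; cases "i \<in> S") auto
      next
        case False
        with r i have "i \<notin> A" "i \<in> S \<longleftrightarrow> i \<in> S'" by auto
        with x(2)[OF i] False show ?thesis by simp
      qed
    qed
  qed
qed

lemma face_eq_iff:
  assumes "A \<subseteq> {..<n}" "A' \<subseteq> {..<n}"
  shows "face n S A = face n S' A' \<longleftrightarrow> A = A' \<and> (\<forall>i<n. i \<notin> A' \<longrightarrow> (i \<in> S \<longleftrightarrow> i \<in> S'))"
  using face_subset_iff[OF assms(1), of S S' A'] face_subset_iff[OF assms(2), of S' S A]
  by (auto simp: set_eq_iff subset_iff)

lemma cube_faces_eq: "cube_faces n k = {face n S A |S A. A \<subseteq> {..<n} \<and> card A = k}"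
proof (rule Set.set_eqI, rule iffI)
  fix f assume "f \<in> cube_faces n k"
  then obtain J where J: "f = Pi\<^sub>E {..<n} J" "\<forall>i<n. J i \<in> {{0}, {1}, {0..1::real}}"
    "card {i. i < n \<and> J i = {0..1}} = k"
    by (auto simp: cube_faces_def)
  define A where "A = {i. i < n \<and> J i = {0..1}}"
  define S where "S = {i. J i = {1}}"
  have ne: "{0::real} \<noteq> {0..1}" "{1::real} \<noteq> {0..1}" 
    by (auto simp: set_eq_iff intro!: exI[of _ "1/2::real"])
  have "f = face n S A"
    unfolding J(1) face_def
  proof (rule PiE_cong)
    fix i assume "i \<in> {..<n}"
    with J(2) ne show "J i = (if i \<in> A then {0..1} else {of_bool (i \<in> S)})"
      by (auto simp: A_def S_def)
  qed
  moreover have "A \<subseteq> {..<n}" "card A = k" using J by (auto simp: A_def)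
  ultimately show "f \<in> {face n S A |S A. A \<subseteq> {..<n} \<and> card A = k}" by blast
next
  fix f assume "f \<in> {face n S A |S A. A \<subseteq> {..<n} \<and> card A = k}"
  then obtain S A where SA: "f = face n S A" "A \<subseteq> {..<n}" "card A = k" by auto
  define J where "J = (\<lambda>i. if i \<in> A then {0..1::real} else {of_bool (i \<in> S)})"
  have ne: "{0::real} \<noteq> {0..1}" "{1::real} \<noteq> {0..1}" 
    by (auto simp: set_eq_iff intro!: exI[of _ "1/2::real"])
  have "{i. i < n \<and> J i = {0..1}} = A"
    using SA(2) ne by (auto simp: J_def of_bool_def split: if_splits)
  moreover have "J i \<in> {{0}, {1}, {0..1}}" for i
    by (cases "i \<in> A"; cases "i \<in> S") (auto simp: J_def)
  moreover have "f = Pi\<^sub>E {..<n} J" using SA(1) by (simp add: face_def J_def)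
  ultimately show "f \<in> cube_faces n k"
    unfolding cube_faces_def using SA(3) by blast
qed

lemma in_cube_complex_iff: "x \<in> cube_complex n W \<longleftrightarrow> (\<exists>S A. cell n W S A \<and> x \<in> face n S A)"
proof
  assume "x \<in> cube_complex n W"
  then obtain S A where "A \<subseteq> {..<n}" "x \<in> face n S A" 
    "card A = 0 \<or> card A = 1 \<or> (card A = 2 \<and> face n S A \<in> W)"
    unfolding cube_complex_def cube_faces_eq by blast
  thus "\<exists>S A. cell n W S A \<and> x \<in> face n S A"
    by (intro exI[of _ S] exI[of _ A]) (auto simp: cell_def)
next
  assume "\<exists>S A. cell n W S A \<and> x \<in> face n S A"
  then obtain S A where SA: "cell n W S A" "x \<in> face n S A" by auto
  hence "card A = 0 \<or> card A = 1 \<or> card A = 2 \<and> face n S A \<in> W" by (auto simp: cell_def)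
  with SA show "x \<in> cube_complex n W" unfolding cube_complex_def cube_faces_eq cell_def by blast
qed

lemma face_subset_cube_complex: "cell n W S A \<Longrightarrow> face n S A \<subseteq> cube_complex n W"
  unfolding in_cube_complex_iff[abs_def] subset_iff by blast

lemma vert_in_cube_complex: "vert n S \<in> cube_complex n W"
  by (subst in_cube_complex_iff, intro exI[of _ S] exI[of _ "{}"]) (auto simp: cell_def vert_in_face_iff)

lemma continuous_on_seg:
  fixes f g :: "'a::topological_space \<Rightarrow> nat \<Rightarrow> real"
  assumes "continuous_on T f" "continuous_on T g" "continuous_on T h"
  shows "continuous_on T (\<lambda>x. seg (f x) (g x) (h x))"
  unfolding seg_def
  by (rule continuous_on_coordinatewise_then_product, rule continuous_on_add;
      rule continuous_on_mult)
     (intro continuous_intros assms continuous_on_product_then_coordinatewise[OF assms(1)]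
        continuous_on_product_then_coordinatewise[OF assms(2)])+

lemma path_seg [simp]: "path (seg x y)"
  unfolding path_def by (rule continuous_on_seg[where h = "\<lambda>t. t", simplified]) (auto intro: continuous_intros)

lemma pathstart_seg [simp]: "pathstart (seg x y) = x"
  and pathfinish_seg [simp]: "pathfinish (seg x y) = y"
  by (simp_all add: pathstart_def pathfinish_def seg_def)

lemma seg_same: "seg x x = (\<lambda>_. x)"
  by (auto simp: seg_def fun_eq_iff algebra_simps)

lemma pathstart_const [simp]: "pathstart (\<lambda>_. x) = x"
  and pathfinish_const [simp]: "pathfinish (\<lambda>_. x) = x"
  by (simp_all add: pathstart_def pathfinish_def)

lemma path_const: "path (\<lambda>_. x)" and path_image_const: "path_image (\<lambda>_. x) = {x}"
  by (auto simp: path_def path_image_def)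

lemma seg_in_face:
  assumes "x \<in> face n S A" "y \<in> face n S A" "t \<in> {0..1}"
  shows "seg x y t \<in> face n S A"
proof -
  have same: "(1 - t) * c + t * c = c" for c :: real by (simp add: algebra_simps)
  have conv: "0 \<le> (1 - t) * c + t * d \<and> (1 - t) * c + t * d \<le> 1"
    if "0 \<le> c" "c \<le> 1" "0 \<le> d" "d \<le> 1" for c d :: real
    using that assms(3) by (auto intro!: convex_bound_le)
  show ?thesis
    using assms(1,2) by (auto simp: in_face_iff seg_def extensional_def same conv)
qed

lemma path_image_seg_face:
  "x \<in> face n S A \<Longrightarrow> y \<in> face n S A \<Longrightarrow> path_image (seg x y) \<subseteq> face n S A"
  by (auto simp: path_image_def intro: seg_in_face)

text \<open>
  Faces are closed under \<open>seg\<close>, so the straight-line homotopy stays in the face.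
\<close>
lemma homotopic_paths_in_face:
  assumes "path p" "path q" "path_image p \<subseteq> face n S A" "path_image q \<subseteq> face n S A"
    and "pathstart q = pathstart p" "pathfinish q = pathfinish p"
  shows "homotopic_paths (face n S A) p q"
proof -
  define h where "h = (\<lambda>z::real\<times>real. seg (p (snd z)) (q (snd z)) (fst z))"
  have "continuous_on ({0..1} \<times> {0..1}) (\<lambda>z::real\<times>real. p (snd z))"
    "continuous_on ({0..1} \<times> {0..1}) (\<lambda>z::real\<times>real. q (snd z))"
    using assms(1,2) unfolding path_def
    by (auto intro!: continuous_on_compose2[OF _ continuous_on_snd[OF continuous_on_id]])
  hence "continuous_on ({0..1} \<times> {0..1}) h"
    unfolding h_def by (rule continuous_on_seg) (auto intro: continuous_on_fst continuous_on_id)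
  moreover have "h \<in> ({0..1} \<times> {0..1}) \<rightarrow> face n S A"
    using assms(3,4) by (auto simp: h_def path_image_def intro!: seg_in_face)
  ultimately show ?thesis
    unfolding homotopic_paths using assms(5,6)
    by (intro exI[of _ h]) (auto simp: h_def seg_def pathstart_def pathfinish_def algebra_simps)
qed

text \<open>
  Paths with values in a space of functions are often compositions of a map \<open>h\<close> with a path in the line or
  the plane; there the straight-line homotopy is available, and it is pushed forward by \<open>h\<close>.
\<close>
lemma homotopic_paths_convex_image:
  fixes C :: "'a::real_normed_vector set" and h :: "'a \<Rightarrow> 'b::topological_space"
  assumes "convex C" "continuous_on C h" "h ` C \<subseteq> X"
    and "path p" "path q" "path_image p \<subseteq> C" "path_image q \<subseteq> C"
    and "pathstart q = pathstart p" "pathfinish q = pathfinish p"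
  shows "homotopic_paths X (h \<circ> p) (h \<circ> q)"
proof (rule homotopic_paths_continuous_image)
  show "homotopic_paths C p q"
    using assms by (intro homotopic_paths_linear closed_segment_subset) (auto simp: path_image_def)
qed (use assms in auto)

lemma homotopic_paths_join_const:
  assumes "path p" "path_image p \<subseteq> X"
  shows "homotopic_paths X (p +++ (\<lambda>_. pathfinish p)) p"
proof -
  have "homotopic_paths X (p \<circ> (linepath 0 1 +++ linepath 1 1)) (p \<circ> linepath 0 1)"
  proof (rule homotopic_paths_convex_image[of "{0..1}"])
    show "continuous_on {0..1} p" "p ` {0..1} \<subseteq> X"
      using assms by (simp_all add: path_def path_image_def)
  qed (simp_all add: path_image_join closed_segment_eq_real_ivl)
  moreover have "p \<circ> (linepath 0 1 +++ linepath 1 1) = p +++ (\<lambda>_. pathfinish p)"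
    by (auto simp: fun_eq_iff joinpaths_def linepath_def pathfinish_def)
  moreover have "p \<circ> linepath 0 1 = p" by (auto simp: fun_eq_iff linepath_def)
  ultimately show ?thesis by simp
qed

lemma homotopic_paths_const_join:
  assumes "path p" "path_image p \<subseteq> X"
  shows "homotopic_paths X ((\<lambda>_. pathstart p) +++ p) p"
proof -
  have "homotopic_paths X (p \<circ> (linepath 0 0 +++ linepath 0 1)) (p \<circ> linepath 0 1)"
  proof (rule homotopic_paths_convex_image[of "{0..1}"])
    show "continuous_on {0..1} p" "p ` {0..1} \<subseteq> X"
      using assms by (simp_all add: path_def path_image_def)
  qed (simp_all add: path_image_join closed_segment_eq_real_ivl)
  moreover have "p \<circ> (linepath 0 0 +++ linepath 0 1) = (\<lambda>_. pathstart p) +++ p"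
    by (auto simp: fun_eq_iff joinpaths_def linepath_def pathstart_def)
  moreover have "p \<circ> linepath 0 1 = p" by (auto simp: fun_eq_iff linepath_def)
  ultimately show ?thesis by simp
qed

lemma pathstart_word_path [simp]: "pathstart (word_path n S w) = vert n S"
  by (cases w) simp_all

lemma pathfinish_word_path [simp]: "pathfinish (word_path n S w) = vert n (fold flip w S)"
  by (induction w arbitrary: S) simp_all

lemma path_word_path [simp]: "path (word_path n S w)"
  by (induction w arbitrary: S) (simp_all add: path_const)

lemma face_flip: "i \<in> A \<Longrightarrow> face n (flip i S) A = face n S A"
  by (auto simp: in_face_iff in_flip_iff)

lemma path_image_word_path_face:
  "set w \<subseteq> A \<Longrightarrow> path_image (word_path n S w) \<subseteq> face n S A"
proof (induction w arbitrary: S)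
  case (Cons i w)
  have "vert n (flip i S) \<in> face n S A" using Cons.prems by (auto simp: vert_in_face_iff in_flip_iff)
  moreover have "path_image (word_path n (flip i S) w) \<subseteq> face n S A"
    using Cons.IH[of "flip i S"] Cons.prems by (simp add: face_flip)
  ultimately show ?case
    using path_image_seg_face[OF vert_in_face[of n S A], of "vert n (flip i S)"]
    by (simp add: path_image_join)
qed (auto simp: path_image_const vert_in_face)

lemma vert_flip_outside: "\<not> i < n \<Longrightarrow> vert n (flip i S) = vert n S"
  by (auto simp: vert_def in_flip_iff fun_eq_iff)

lemma path_image_edge: "path_image (seg (vert n S) (vert n (flip i S))) \<subseteq> cube_complex n W"
proof (cases "i < n")
  case True
  have "path_image (seg (vert n S) (vert n (flip i S))) \<subseteq> face n S {i}"
    by (intro path_image_seg_face) (auto simp: vert_in_face_iff in_flip_iff)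
  also have "\<dots> \<subseteq> cube_complex n W" using True by (intro face_subset_cube_complex) (auto simp: cell_def)
  finally show ?thesis .
qed (auto simp: vert_flip_outside seg_same path_image_const vert_in_cube_complex)

lemma path_image_word_path: "path_image (word_path n S w) \<subseteq> cube_complex n W"
  by (induction w arbitrary: S)
     (simp_all add: path_image_join path_image_const vert_in_cube_complex path_image_edge)

section \<open>Edge paths up to elementary homotopies\<close>

text \<open>
  An edge path in the cube is a starting vertex and a list of directions.  The relation \<open>weq\<close> is
  generated by the two elementary moves that are homotopies in the complex: cancelling a backtracking
  pair, and pushing two successive edges across a square of \<open>W\<close>.
\<close>
inductive weq :: "nat \<Rightarrow> (nat \<Rightarrow> real) set set \<Rightarrow> nat set \<Rightarrow> nat list \<Rightarrow> nat list \<Rightarrow> bool"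
  for n W where
  weq_refl: "weq n W S u u"
| weq_sym: "weq n W S u w \<Longrightarrow> weq n W S w u"
| weq_trans: "weq n W S u w \<Longrightarrow> weq n W S w z \<Longrightarrow> weq n W S u z"
| weq_Cons: "weq n W (flip i S) u w \<Longrightarrow> weq n W S (i # u) (i # w)"
| weq_back: "weq n W S (i # i # u) u"
| weq_swap: "a \<noteq> b \<Longrightarrow> a < n \<Longrightarrow> b < n \<Longrightarrow> face n S {a, b} \<in> W \<Longrightarrow> weq n W S (a # b # u) (b # a # u)"

lemma homotopic_word_path_prefix:
  assumes "set u \<subseteq> A" "set w \<subseteq> A" "fold flip u S = fold flip w S" "cell n W S A"
  shows "homotopic_paths (cube_complex n W) (word_path n S u) (word_path n S w)"
  using assms
  by (intro homotopic_paths_subset[OF homotopic_paths_in_face face_subset_cube_complex])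
     (simp_all add: path_image_word_path_face)

lemma word_path_append:
  "homotopic_paths (cube_complex n W) (word_path n S (u @ w)) (word_path n S u +++ word_path n (fold flip u S) w)"
proof (induction u arbitrary: S)
  case Nil
  show ?case
    using homotopic_paths_const_join[OF path_word_path[of n S w] path_image_word_path[of n S w W]]
    by (simp add: homotopic_paths_sym)
next
  case (Cons i u)
  let ?e = "seg (vert n S) (vert n (flip i S))"
  have "homotopic_paths (cube_complex n W) (?e +++ word_path n (flip i S) (u @ w)) 
     (?e +++ (word_path n (flip i S) u +++ word_path n (fold flip u (flip i S)) w))"
    by (intro homotopic_paths_join Cons) (auto intro: path_image_edge[THEN subsetD])
  also have "homotopic_paths (cube_complex n W) \<dots> 
     ((?e +++ word_path n (flip i S) u) +++ word_path n (fold flip u (flip i S)) w)"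
    by (intro homotopic_paths_assoc path_image_edge path_image_word_path) auto
  finally (homotopic_paths_trans) show ?case by simp
qed

text \<open>
  Both elementary moves take place inside a single cell, an edge or a square, where any two paths with
  the same endpoints are homotopic.
\<close>
lemma weq_homotopic:
  "weq n W S u w \<Longrightarrow> homotopic_paths (cube_complex n W) (word_path n S u) (word_path n S w)"
proof (induction rule: weq.induct)
  case (weq_refl S u)
  thus ?case using path_image_word_path[of n S u W] by simp
next
  case (weq_sym S u w) thus ?case using homotopic_paths_sym by blast
next
  case (weq_trans S u w z) thus ?case using homotopic_paths_trans by blast
next
  case (weq_Cons i S u w)
  thus ?case by (auto intro!: homotopic_paths_join intro: path_image_edge[THEN subsetD])
next
  case (weq_back S i u)
  have "homotopic_paths (cube_complex n W) (word_path n S [i,i]) (word_path n S [])"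
  proof (cases "i < n")
    case True
    thus ?thesis by (intro homotopic_word_path_prefix[where A = "{i}"]) (auto simp: cell_def)
  next
    case False
    hence "word_path n S [i,i] = word_path n S []"
      by (simp add: vert_flip_outside seg_same) (simp add: joinpaths_def)
    thus ?thesis using path_image_word_path[of n S "[]" W] by (simp add: path_const)
  qed
  hence 1: "homotopic_paths (cube_complex n W) (word_path n S [i,i] +++ word_path n S u) (word_path n S [] +++ word_path n S u)"
    using path_image_word_path by (intro homotopic_paths_join) auto
  have 2: "homotopic_paths (cube_complex n W) (word_path n S ([i,i] @ u)) (word_path n S [i,i] +++ word_path n S u)"
    using word_path_append[of n W S "[i,i]" u] by simp
  have 3: "homotopic_paths (cube_complex n W) (word_path n S ([] @ u)) (word_path n S [] +++ word_path n S u)"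
    using word_path_append[of n W S "[]" u] by simp
  from 1 2 3 show ?case 
    using homotopic_paths_trans homotopic_paths_sym by (metis append_Cons append_Nil)
next
  case (weq_swap a b S u)
  let ?T = "flip a (flip b S)"
  have "cell n W S {a,b}" using weq_swap by (auto simp: cell_def)
  hence "homotopic_paths (cube_complex n W) (word_path n S [a,b]) (word_path n S [b,a])"
    by (intro homotopic_word_path_prefix[where A = "{a,b}"]) (auto simp: flip_commute)
  hence 1: "homotopic_paths (cube_complex n W) (word_path n S [a,b] +++ word_path n ?T u) (word_path n S [b,a] +++ word_path n ?T u)"
    using path_image_word_path by (intro homotopic_paths_join) (auto simp: flip_commute)
  have 2: "homotopic_paths (cube_complex n W) (word_path n S ([a,b] @ u)) (word_path n S [a,b] +++ word_path n ?T u)"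
    using word_path_append[of n W S "[a,b]" u] by (simp add: flip_commute)
  have 3: "homotopic_paths (cube_complex n W) (word_path n S ([b,a] @ u)) (word_path n S [b,a] +++ word_path n ?T u)"
    using word_path_append[of n W S "[b,a]" u] by (simp add: flip_commute)
  from 1 2 3 show ?case 
    using homotopic_paths_trans homotopic_paths_sym by (metis append_Cons append_Nil)
qed

section \<open>Cellular approximation\<close>

text \<open>
  The points near the vertex \<open>S\<close> form its open star: a point of the cube is near \<open>S\<close> iff \<open>S\<close> is a
  vertex of the smallest face that contains the point.
\<close>
definition near :: "nat \<Rightarrow> nat set \<Rightarrow> (nat \<Rightarrow> real) \<Rightarrow> bool" where
  "near n S x \<longleftrightarrow> (\<forall>i<n. \<bar>x i - of_bool (i \<in> S)\<bar> < 1)"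

text \<open>
  Here \<open>A\<close> is the set of coordinates of \<open>x\<close> strictly between 0 and 1, so that \<open>face n S A\<close> is the smallest
  face containing \<open>x\<close>, whichever nearby vertex \<open>S\<close> is used to describe it.  It belongs to the complex
  because the complex is closed under passing to subfaces.
\<close>
lemma near_carrier:
  assumes "x \<in> cube_complex n W"
  obtains A where "A \<subseteq> {..<n}" "\<And>S. near n S x \<Longrightarrow> cell n W S A \<and> x \<in> face n S A"
    "\<And>S S' i. near n S x \<Longrightarrow> near n S' x \<Longrightarrow> i < n \<Longrightarrow> i \<notin> A \<Longrightarrow> i \<in> S \<longleftrightarrow> i \<in> S'"
proof -
  from assms obtain T B where TB: "cell n W T B" "x \<in> face n T B" unfolding in_cube_complex_iff by auto
  define A where "A = {i. i < n \<and> 0 < x i \<and> x i < 1}"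
  have x: "x \<in> extensional {..<n}" 
      "\<And>i. i < n \<Longrightarrow> if i \<in> B then 0 \<le> x i \<and> x i \<le> 1 else x i = of_bool (i \<in> T)"
    using TB(2) by (auto simp: in_face_iff)
  have AB: "A \<subseteq> B"
  proof
    fix i assume "i \<in> A"
    hence "i < n" "0 < x i" "x i < 1" by (auto simp: A_def)
    with x(2)[of i] show "i \<in> B" by (cases "i \<in> B"; cases "i \<in> T") auto
  qed
  have out: "x i = of_bool (i \<in> S)" if "near n S x" "i < n" "i \<notin> A" for i S
  proof -
    have "\<bar>x i - of_bool (i \<in> S)\<bar> < 1" using that by (auto simp: near_def)
    moreover have "x i = 0 \<or> x i = 1"
      using x(2)[OF \<open>i < n\<close>] that unfolding A_def by (cases "i \<in> B"; cases "i \<in> T") auto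
    ultimately show ?thesis by (cases "i \<in> S") auto
  qed
  have face: "x \<in> face n S A" if "near n S x" for S
    unfolding in_face_iff
  proof (intro conjI allI impI x(1))
    fix i assume "i < n"
    with out[OF that this] show "if i \<in> A then 0 \<le> x i \<and> x i \<le> 1 else x i = of_bool (i \<in> S)"
      by (auto simp: A_def)
  qed
  have Bn: "B \<subseteq> {..<n}" "finite B" using TB(1) by (auto simp: cell_def intro: finite_subset)
  have "cell n W S A" if near: "near n S x" for S
  proof (cases "card A \<le> 1")
    case True
    thus ?thesis using AB Bn by (auto simp: cell_def)
  next
    case False
    moreover have "card A \<le> card B" using AB Bn by (intro card_mono)
    ultimately have c: "card B = 2" "card A = 2" "face n T B \<in> W" using TB(1) by (auto simp: cell_def)
    hence "A = B" using card_subset_eq[OF Bn(2) AB] by simp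
    have "face n S A = face n T B"
      unfolding \<open>A = B\<close>
    proof (subst face_eq_iff)
      show "B = B \<and> (\<forall>i<n. i \<notin> B \<longrightarrow> (i \<in> S) = (i \<in> T))"
      proof (intro conjI allI impI refl)
        fix i assume i: "i < n" "i \<notin> B"
        hence "x i = of_bool (i \<in> T)" "x i = of_bool (i \<in> S)"
          using x(2)[of i] out[OF near, of i] \<open>A = B\<close> by auto
        thus "(i \<in> S) = (i \<in> T)" by (cases "i \<in> S"; cases "i \<in> T") auto
      qed
    qed (use Bn in auto)
    thus ?thesis using c Bn \<open>A = B\<close> by (auto simp: cell_def)
  qed
  moreover have "i \<in> S \<longleftrightarrow> i \<in> S'" if "near n S x" "near n S' x" "i < n" "i \<notin> A" for S S' i
    using out[of S i] out[of S' i] that by (cases "i \<in> S"; cases "i \<in> S'") auto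
  moreover have "A \<subseteq> {..<n}" by (auto simp: A_def)
  ultimately show ?thesis using face by (intro that[of A]) blast+
qed

lemma near_exists:
  assumes "x \<in> cube_complex n W"
  shows "\<exists>S\<subseteq>{..<n}. near n S x"
proof -
  from assms obtain T B where TB: "x \<in> face n T B" unfolding in_cube_complex_iff by auto
  define S where "S = {i. i < n \<and> x i > 1/2}"
  have "\<bar>x i - of_bool (i \<in> S)\<bar> < 1" if "i < n" for i
  proof -
    have "if i \<in> B then 0 \<le> x i \<and> x i \<le> 1 else x i = of_bool (i \<in> T)"
      using TB that by (auto simp: in_face_iff)
    thus ?thesis using that by (cases "i \<in> B"; cases "i \<in> T"; cases "i \<in> S") (auto simp: S_def)
  qed
  thus ?thesis by (intro exI[of _ S]) (auto simp: near_def S_def)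
qed

lemma seg_near_in_cube_complex:
  assumes "x \<in> cube_complex n W" "near n S x"
  shows "path_image (seg x (vert n S)) \<subseteq> cube_complex n W"
proof -
  from near_carrier[OF assms(1)] obtain A where "cell n W S A \<and> x \<in> face n S A" 
    using assms(2) by metis
  thus ?thesis using path_image_seg_face[of x n S A "vert n S"] face_subset_cube_complex[of n W S A] vert_in_face
    by blast
qed

lemma fold_flip_iff:
  "distinct w \<Longrightarrow> i \<in> fold flip w S \<longleftrightarrow> (i \<in> S) \<noteq> (i \<in> set w)"
  by (induction w arbitrary: S) (auto simp: in_flip_iff)

lemma word_exists:
  assumes "S \<subseteq> {..<n}" "S' \<subseteq> {..<n}"
  obtains w where "set w = (S - S') \<union> (S' - S)" "fold flip w S = S'"
proof -
  have "finite ((S - S') \<union> (S' - S))" using assms by (auto intro: finite_subset)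
  then obtain w where w: "set w = (S - S') \<union> (S' - S)" "distinct w"
    using finite_distinct_list by blast
  moreover have "fold flip w S = S'" using fold_flip_iff[OF w(2)] w(1) by blast
  ultimately show thesis using that by blast
qed

text \<open>
  Cellular approximation of a path \<open>g\<close> from the vertex 0.  The set of parameters up to which \<open>g\<close> is homotopic
  to an edge path, once its end is joined by a segment to a nearby vertex, is open and closed in \<open>{0..1}\<close>;
  this replaces a subdivision of the interval by a Lebesgue number.
\<close>

context
  fixes n :: nat and W :: "(nat \<Rightarrow> real) set set" and g :: "real \<Rightarrow> nat \<Rightarrow> real"
  assumes g: "path g" "path_image g \<subseteq> cube_complex n W" "pathstart g = vert n {}"
begin

definition reached :: "nat set \<Rightarrow> real \<Rightarrow> bool" where
  "reached S t \<longleftrightarrow> (\<exists>w. set w \<subseteq> {..<n} \<and> fold flip w {} = S \<and>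
     homotopic_paths (cube_complex n W) ((g \<circ> linepath 0 t) +++ seg (g t) (vert n S)) (word_path n {} w))"

lemma g_in: "t \<in> {0..1} \<Longrightarrow> g t \<in> cube_complex n W"
  using g(2) by (auto simp: path_image_def)

lemma subpath_g:
  assumes "s \<in> {0..1}" "t \<in> {0..1}"
  shows "path (g \<circ> linepath s t)" "path_image (g \<circ> linepath s t) \<subseteq> cube_complex n W"
    "pathstart (g \<circ> linepath s t) = g s" "pathfinish (g \<circ> linepath s t) = g t"
proof -
  have sub: "closed_segment s t \<subseteq> {0..1}"
    using assms by (intro closed_segment_subset) auto
  have "continuous_on {0..1} g" using g(1) by (simp add: path_def)
  thus "path (g \<circ> linepath s t)"
    by (intro path_continuous_image) (simp_all add: continuous_on_subset[OF _ sub])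
  show "path_image (g \<circ> linepath s t) \<subseteq> cube_complex n W"
    using sub g_in by (auto simp: path_image_compose)
qed (simp_all add: pathstart_compose pathfinish_compose)

text \<open>
  Two vertices near \<open>g t\<close> lie in the smallest face containing \<open>g t\<close>, where they are joined by an edge path;
  the triangle formed with the two segments lies in that face.
\<close>
lemma reached_switch:
  assumes t: "t \<in> {0..1}" and near: "near n S (g t)" "near n S' (g t)" 
    and sub: "S \<subseteq> {..<n}" "S' \<subseteq> {..<n}" and r: "reached S t"
  shows "reached S' t"
proof -
  let ?X = "cube_complex n W"
  obtain A where A: "A \<subseteq> {..<n}" "\<And>S. near n S (g t) \<Longrightarrow> cell n W S A \<and> g t \<in> face n S A"
    "\<And>S S' i. near n S (g t) \<Longrightarrow> near n S' (g t) \<Longrightarrow> i < n \<Longrightarrow> i \<notin> A \<Longrightarrow> i \<in> S \<longleftrightarrow> i \<in> S'"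
    using near_carrier[OF g_in[OF t]] by metis
  obtain w where w: "set w \<subseteq> {..<n}" "fold flip w {} = S"
     "homotopic_paths ?X ((g \<circ> linepath 0 t) +++ seg (g t) (vert n S)) (word_path n {} w)"
    using r by (auto simp: reached_def)
  obtain u where u: "set u = (S - S') \<union> (S' - S)" "fold flip u S = S'"
    using word_exists[OF sub] .
  have uA: "set u \<subseteq> A" 
  proof
    fix i assume i: "i \<in> set u"
    hence "i < n" using u(1) sub by auto
    thus "i \<in> A" using A(3)[OF near, of i] i u(1) by blast
  qed
  have cellA: "cell n W S A" and gA: "g t \<in> face n S A" using A(2)[OF near(1)] by auto
  have vA: "vert n S' \<in> face n S A" unfolding vert_in_face_iff using A(3)[OF near] by blast
  note sg = subpath_g[of 0 t] 
  have 0: "(0::real) \<in> {0..1}" by simp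
  have h1: "homotopic_paths ?X (seg (g t) (vert n S')) (seg (g t) (vert n S) +++ word_path n S u)"
  proof (rule homotopic_paths_subset[OF homotopic_paths_in_face face_subset_cube_complex[OF cellA]])
    show "path_image (seg (g t) (vert n S')) \<subseteq> face n S A"
      by (rule path_image_seg_face[OF gA vA])
    show "path_image (seg (g t) (vert n S) +++ word_path n S u) \<subseteq> face n S A"
      using path_image_seg_face[OF gA vert_in_face] path_image_word_path_face[OF uA]
      by (intro subset_path_image_join) 
  qed (use u in simp_all)
  note imgs = seg_near_in_cube_complex[OF g_in[OF t] near(1)] path_image_word_path sg(2)[OF 0 t]
  have "homotopic_paths ?X ((g \<circ> linepath 0 t) +++ seg (g t) (vert n S'))
          ((g \<circ> linepath 0 t) +++ (seg (g t) (vert n S) +++ word_path n S u))"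
    using h1 sg t by (intro homotopic_paths_join) auto
  also have "homotopic_paths ?X \<dots> (((g \<circ> linepath 0 t) +++ seg (g t) (vert n S)) +++ word_path n S u)"
    using sg t by (intro homotopic_paths_assoc imgs) auto
  also (homotopic_paths_trans) have "homotopic_paths ?X \<dots> (word_path n {} w +++ word_path n S u)"
    using w(3) imgs by (intro homotopic_paths_join) auto
  also (homotopic_paths_trans) have "homotopic_paths ?X \<dots> (word_path n {} (w @ u))"
    using word_path_append[of n W "{}" w u] w(2) by (simp add: homotopic_paths_sym)
  finally (homotopic_paths_trans) show ?thesis
    unfolding reached_def using w u sub by (intro exI[of _ "w @ u"]) auto
qed

text \<open>
  While \<open>g\<close> runs within the open star of \<open>S\<close>, the segments from its points to \<open>S\<close> sweep out a homotopy.
\<close>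
lemma reached_move:
  assumes st: "s \<in> {0..1}" "t \<in> {0..1}" 
    and near: "\<And>r. r \<in> closed_segment s t \<Longrightarrow> near n S (g r)" and r: "reached S t"
  shows "reached S s"
proof -
  let ?X = "cube_complex n W" and ?v = "vert n S"
  obtain w where w: "set w \<subseteq> {..<n}" "fold flip w {} = S"
     "homotopic_paths ?X ((g \<circ> linepath 0 t) +++ seg (g t) ?v) (word_path n {} w)"
    using r by (auto simp: reached_def)
  have sub: "closed_segment s t \<subseteq> {0..1}"
    using st by (intro closed_segment_subset) auto
  have cg: "continuous_on {0..1} g" using g(1) by (simp add: path_def)
  have 0: "(0::real) \<in> {0..1}" by simp
  note s0 = subpath_g[OF 0 st(1)] and t0 = subpath_g[OF 0 st(2)] and ts = subpath_g[OF st(2,1)]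
  have imgs: "path_image (seg (g s) ?v) \<subseteq> ?X" "path_image (seg (g t) ?v) \<subseteq> ?X"
    by (intro seg_near_in_cube_complex g_in st near; simp)+
  have h1: "homotopic_paths ?X (g \<circ> linepath 0 s) ((g \<circ> linepath 0 t) +++ (g \<circ> linepath t s))"
  proof -
    have "homotopic_paths ?X (g \<circ> linepath 0 s) (g \<circ> (linepath 0 t +++ linepath t s))"
    proof (rule homotopic_paths_convex_image[OF _ cg])
      show "path_image (linepath 0 t +++ linepath t s) \<subseteq> {0..1}"
        using st sub by (intro subset_path_image_join)
          (auto simp: closed_segment_eq_real_ivl closed_segment_commute)
    qed (use st g_in in \<open>auto simp: closed_segment_eq_real_ivl\<close>)
    thus ?thesis by (simp add: path_compose_join)
  qed
  \<comment> \<open>The rectangle swept out: its bottom side is the piece of \<open>g\<close>, its vertical sides are the two segments, and its top side is constant.\<close>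
  define K where "K = (\<lambda>z::real\<times>real. seg (g (fst z)) ?v (snd z))"
  define C where "C = closed_segment t s \<times> {0..1::real}"
  have h2: "homotopic_paths ?X ((g \<circ> linepath t s) +++ seg (g s) ?v) (seg (g t) ?v +++ (\<lambda>_. ?v))"
  proof -
    have "continuous_on C (\<lambda>z::real\<times>real. g (fst z))"
      using sub unfolding C_def
      by (intro continuous_on_compose2[OF cg continuous_on_fst[OF continuous_on_id]])
         (auto simp: closed_segment_commute)
    hence cK: "continuous_on C K"
      unfolding K_def by (rule continuous_on_seg) (auto intro: continuous_on_snd continuous_on_id)
    have KX: "K ` C \<subseteq> ?X"
    proof safe
      fix a b assume "(a, b) \<in> C"
      hence ab: "a \<in> closed_segment s t" "b \<in> {0..1}" by (auto simp: C_def closed_segment_commute)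
      have "path_image (seg (g a) ?v) \<subseteq> ?X"
        by (intro seg_near_in_cube_complex g_in near ab(1) subsetD[OF sub ab(1)])
      thus "K (a, b) \<in> ?X" using ab by (auto simp: K_def path_image_def)
    qed
    define p where "p = linepath (t, 0) (s, 0) +++ linepath (s, 0) (s, 1::real)"
    define q where "q = linepath (t, 0) (t, 1) +++ linepath (t, 1) (s, 1::real)"
    have cC: "convex C" unfolding C_def by (intro convex_Times convex_closed_segment) auto
    have inC: "(t, 0) \<in> C" "(s, 0) \<in> C" "(s, 1) \<in> C" "(t, 1) \<in> C" by (auto simp: C_def)
    have segC: "closed_segment a b \<subseteq> C" if "a \<in> C" "b \<in> C" for a b 
      using closed_segment_subset[OF that cC] .
    have same: "(1 - x) * c + x * c = c" for c x :: real by (simp add: algebra_simps)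
    have "homotopic_paths ?X (K \<circ> p) (K \<circ> q)"
    proof (rule homotopic_paths_convex_image[OF cC cK KX])
      show "path_image p \<subseteq> C" "path_image q \<subseteq> C" unfolding p_def q_def
        by (intro subset_path_image_join; simp add: inC segC)+
    qed (auto simp: p_def q_def)
    moreover have "K \<circ> p = (g \<circ> linepath t s) +++ seg (g s) ?v"
      unfolding p_def path_compose_join
      by (rule arg_cong2[where f = joinpaths]) (simp_all add: K_def fun_eq_iff linepath_def seg_def same)
    moreover have "K \<circ> q = seg (g t) ?v +++ (\<lambda>_. ?v)"
      unfolding q_def path_compose_join
      by (rule arg_cong2[where f = joinpaths]) (simp_all add: K_def fun_eq_iff linepath_def seg_def same)
    ultimately show ?thesis by simp
  qed
  have "homotopic_paths ?X (seg (g t) ?v +++ (\<lambda>_. ?v)) (seg (g t) ?v)"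
    using homotopic_paths_join_const[OF path_seg imgs(2)] by simp
  from homotopic_paths_trans[OF h2 this]
  have h3: "homotopic_paths ?X ((g \<circ> linepath t s) +++ seg (g s) ?v) (seg (g t) ?v)" .
  have "homotopic_paths ?X ((g \<circ> linepath 0 s) +++ seg (g s) ?v) 
     (((g \<circ> linepath 0 t) +++ (g \<circ> linepath t s)) +++ seg (g s) ?v)"
    using h1 imgs s0 by (intro homotopic_paths_join) auto
  also have "homotopic_paths ?X \<dots> ((g \<circ> linepath 0 t) +++ ((g \<circ> linepath t s) +++ seg (g s) ?v))"
    using s0 t0 ts imgs by (intro homotopic_paths_sym[OF homotopic_paths_assoc]) auto
  also (homotopic_paths_trans) have "homotopic_paths ?X \<dots> ((g \<circ> linepath 0 t) +++ seg (g t) ?v)"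
    using h3 t0 ts by (intro homotopic_paths_join) auto
  also (homotopic_paths_trans) note w(3)
  finally (homotopic_paths_trans) show ?thesis
    unfolding reached_def using w by blast
qed

lemma open_near: "open {x::nat \<Rightarrow> real. near n S x}"
proof -
  have "{x::nat \<Rightarrow> real. near n S x} = (\<Inter>i\<in>{..<n}. {x. \<bar>x i - of_bool (i \<in> S)\<bar> < 1})"
    unfolding near_def by blast
  also have "open \<dots>"
    by (intro open_INT ballI open_Collect_less continuous_intros 
         continuous_on_product_then_coordinatewise[OF continuous_on_id]) auto
  finally show ?thesis .
qed

lemma reached_all:
  assumes "t \<in> {0..1}" "S \<subseteq> {..<n}" "near n S (g t)"
  shows "reached S t"
proof -
  define P where "P t = (\<forall>S\<subseteq>{..<n}. near n S (g t) \<longrightarrow> reached S t)" for t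
  have "P t"
  proof (rule connected_induction_simple[of "{0..1::real}" 0])
    show "P 0"
      unfolding P_def
    proof (intro allI impI)
      fix S assume S: "S \<subseteq> {..<n}" "near n S (g 0)"
      have g0: "g 0 = vert n {}" using g(3) by (simp add: pathstart_def)
      have "i \<notin> S" if "i < n" for i
        using S(2) that unfolding near_def g0 by (auto simp: vert_def dest!: spec[of _ i])
      hence "S = {}" using S(1) by auto
      moreover have "(g \<circ> linepath 0 0) +++ seg (g 0) (vert n {}) = word_path n {} []"
        unfolding g0 seg_same by (auto simp: fun_eq_iff joinpaths_def linepath_def g0)
      ultimately show "reached S 0" unfolding reached_def
        using path_image_word_path[of n "{}" "[]" W] by (intro exI[of _ "[]"]) (auto simp: path_const)
    qed
  next
    fix t0 :: real assume t0: "t0 \<in> {0..1}"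
    obtain S where S: "S \<subseteq> {..<n}" "near n S (g t0)" using near_exists[OF g_in[OF t0]] by auto
    have "continuous_on {0..1} g" using g(1) by (simp add: path_def)
    hence "openin (top_of_set {0..1}) ({0..1} \<inter> g -` {x. near n S x})"
      using open_near continuous_openin_preimage_gen by blast
    moreover have "t0 \<in> {0..1} \<inter> g -` {x. near n S x}" using t0 S by auto
    ultimately obtain e where e: "e > 0" "ball t0 e \<inter> {0..1} \<subseteq> {0..1} \<inter> g -` {x. near n S x}"
      using openin_contains_ball by metis
    define T where "T = {0..1} \<inter> ball t0 e"
    have T: "openin (top_of_set {0..1}) T" "t0 \<in> T" using e t0 by (auto simp: T_def)
    have Tconv: "convex T" unfolding T_def by (intro convex_Int) auto
    have "P y" if xy: "x \<in> T" "y \<in> T" "P x" for x y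
      unfolding P_def
    proof (intro allI impI)
      fix S' assume S': "S' \<subseteq> {..<n}" "near n S' (g y)"
      have nT: "near n S (g r)" if "r \<in> T" for r using that e(2) by (auto simp: T_def)
      have "reached S x" using xy S nT by (auto simp: P_def)
      hence "reached S y"
      proof (intro reached_move[of y x] nT)
        show "r \<in> T" if "r \<in> closed_segment y x" for r
          using closed_segment_subset[OF xy(2,1) Tconv] that by blast
      qed (use xy in \<open>auto simp: T_def\<close>)
      thus "reached S' y"
        using S S' xy nT by (intro reached_switch[of y S S']) (auto simp: T_def)
    qed
    thus "\<exists>T. openin (top_of_set {0..1}) T \<and> t0 \<in> T \<and> (\<forall>x\<in>T. \<forall>y\<in>T. P x \<longrightarrow> P y)"
      using T by blast
  qed (use assms in auto)
  thus ?thesis using assms by (auto simp: P_def)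
qed

end

lemma loop_homotopic_word_path:
  assumes "g \<in> loops_at (cube_complex n W) (vert n {})"
  obtains w where "set w \<subseteq> {..<n}" "fold flip w {} = {}" 
    "homotopic_paths (cube_complex n W) g (word_path n {} w)"
proof -
  have g: "path g" "path_image g \<subseteq> cube_complex n W" "pathstart g = vert n {}" "pathfinish g = vert n {}"
    using assms by (auto simp: loops_at_def)
  have g1: "g 1 = vert n {}" using g by (simp add: pathfinish_def)
  have "near n {} (g 1)" unfolding g1 near_def by (simp add: vert_def)
  hence "reached n W g {} 1" using g by (intro reached_all) auto
  then obtain w where w: "set w \<subseteq> {..<n}" "fold flip w {} = {}" 
    "homotopic_paths (cube_complex n W) ((g \<circ> linepath 0 1) +++ seg (g 1) (vert n {})) (word_path n {} w)"
    unfolding reached_def[OF g(1-3)] by auto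
  have "g \<circ> linepath 0 1 = g" by (auto simp: linepath_def fun_eq_iff)
  hence "homotopic_paths (cube_complex n W) (g +++ (\<lambda>_. pathfinish g)) (word_path n {} w)"
    using w(3) by (simp add: g1 seg_same g(4))
  moreover have "homotopic_paths (cube_complex n W) g (g +++ (\<lambda>_. pathfinish g))"
    using homotopic_paths_join_const[OF g(1,2)] by (rule homotopic_paths_sym)
  ultimately show thesis using that w homotopic_paths_trans by blast
qed

text \<open>
  By cellular approximation, the fundamental group is trivial if closed edge paths can be contracted by
  elementary moves.
\<close>
lemma trivial_fundamental_group_if_words:
  assumes "\<And>w. set w \<subseteq> {..<n} \<Longrightarrow> fold flip w {} = {} \<Longrightarrow> weq n W {} w []"
  shows "trivial_group (fundamental_group (cube_complex n W) (vert n {}))"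
proof -
  let ?X = "cube_complex n W" and ?v = "vert n {}"
  have "homotopy_class ?X g = homotopy_class ?X (\<lambda>_. ?v)" if g: "g \<in> loops_at ?X ?v" for g
  proof -
    obtain w where w: "set w \<subseteq> {..<n}" "fold flip w {} = {}" "homotopic_paths ?X g (word_path n {} w)"
      using loop_homotopic_word_path[OF g] .
    have "homotopic_paths ?X (word_path n {} w) (word_path n {} [])"
      by (rule weq_homotopic[OF assms[OF w(1,2)]])
    hence "homotopic_paths ?X g (\<lambda>_. ?v)" using w(3) homotopic_paths_trans by fastforce
    thus ?thesis
      using homotopy_class_eq_iff[OF const_in_loops_at[OF vert_in_cube_complex]] by blast
  qed
  hence "homotopy_class ?X ` loops_at ?X ?v = {homotopy_class ?X (\<lambda>_. ?v)}"
    using const_in_loops_at[OF vert_in_cube_complex[of n "{}" W]] by blast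
  thus ?thesis
    unfolding trivial_group_def using group_fundamental_group[OF vert_in_cube_complex[of n "{}" W]]
    by (simp add: fundamental_group_def)
qed

section \<open>Isolated edges are not contractible\<close>

text \<open>
  Coordinates on the plane adapted to the edge \<open>(S, a)\<close>, for \<open>a \<notin> S\<close>: the real part is the position along the
  edge.  The imaginary part is 0 on the edge, and 1 at all points with a coordinate \<open>i \<noteq> a\<close> that is opposite
  to \<open>S\<close>.
\<close>
definition wrap :: "nat \<Rightarrow> nat set \<Rightarrow> nat \<Rightarrow> (nat \<Rightarrow> real) \<Rightarrow> complex" where
  "wrap n S a x = Complex (x a) (1 - (\<Prod>i\<in>{..<n} - {a}. if i \<in> S then x i else 1 - x i))"

lemma continuous_on_wrap: "continuous_on T (wrap n S a)"
proof -
  have "continuous_on T (\<lambda>x::nat \<Rightarrow> real. if i \<in> S then x i else 1 - x i)" for i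
    by (cases "i \<in> S")
       (auto intro!: continuous_intros continuous_on_product_then_coordinatewise[OF continuous_on_id])
  thus ?thesis
    unfolding wrap_def Complex_eq
    by (intro continuous_intros continuous_on_product_then_coordinatewise[OF continuous_on_id])
qed

text \<open>
  If no square contains the edge, the whole complex is mapped to the boundary of the unit square: a
  cell without the direction \<open>a\<close> is mapped to the vertical sides, the edge itself to the bottom side, and any other
  cell with direction \<open>a\<close> has a fixed coordinate opposite to \<open>S\<close>, so it is mapped to the top side.
\<close>
lemma wrap_avoids_centre:
  assumes a: "a < n" and iso: "\<And>i. i < n \<Longrightarrow> i \<noteq> a \<Longrightarrow> face n S {a, i} \<notin> W" and x: "x \<in> cube_complex n W"
  shows "wrap n S a x \<noteq> Complex (1/2) (1/2)"
proof -
  obtain T B where TB: "cell n W T B" "x \<in> face n T B" using x unfolding in_cube_complex_iff by auto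
  have xi: "if i \<in> B then 0 \<le> x i \<and> x i \<le> 1 else x i = of_bool (i \<in> T)" if "i < n" for i
    using TB(2) that by (auto simp: in_face_iff)
  consider "a \<notin> B" | i where "i < n" "i \<notin> B" "a \<in> B" "(i \<in> T) \<noteq> (i \<in> S)" 
    | "a \<in> B" "\<forall>i<n. i \<notin> B \<longrightarrow> (i \<in> T) = (i \<in> S)" by blast
  thus ?thesis
  proof cases
    case 1
    hence "x a = 0 \<or> x a = 1" using xi[OF a] by (cases "a \<in> T") auto
    thus ?thesis by (auto simp: wrap_def)
  next
    case 2
    hence "x i = of_bool (i \<in> T)" using xi[of i] by simp
    hence "(if i \<in> S then x i else 1 - x i) = 0" using 2(4) by (cases "i \<in> T") auto
    moreover have "i \<in> {..<n} - {a}" using 2 by auto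
    ultimately have "\<exists>i\<in>{..<n} - {a}. (if i \<in> S then x i else 1 - x i) = 0" by blast
    hence "(\<Prod>i\<in>{..<n} - {a}. if i \<in> S then x i else 1 - x i) = 0"
      by (intro prod_zero) auto
    hence "Im (wrap n S a x) = 1" unfolding wrap_def complex.sel by linarith
    thus ?thesis by auto
  next
    case 3
    have fin: "finite B" "B \<subseteq> {..<n}" using TB(1) by (auto simp: cell_def intro: finite_subset)
    have "B = {a}"
    proof (rule ccontr)
      assume ne: "B \<noteq> {a}"
      have "card B \<noteq> 0" using fin(1) 3(1) by auto
      moreover have "card B \<noteq> 1" using ne 3(1) by (metis card_1_singletonE singletonD)
      ultimately have c2: "card B = 2" "face n T B \<in> W" using TB(1) by (auto simp: cell_def)
      obtain i where i: "B = {a, i}" "i \<noteq> a" using c2(1) 3(1) unfolding card_2_iff by blast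
      have "face n T B = face n S {a, i}" using 3(2) i fin(2) by (subst face_eq_iff) auto
      with iso[of i] i fin(2) c2(2) show False by auto
    qed
    hence "(\<Prod>i\<in>{..<n} - {a}. if i \<in> S then x i else 1 - x i) = (\<Prod>i\<in>{..<n} - {a}. 1)"
      using xi 3(2) by (intro prod.cong refl) auto
    thus ?thesis by (auto simp: wrap_def)
  qed
qed

lemma wrap_on_square:
  assumes "a < n" "b < n" "a \<noteq> b" "\<And>i. i < n \<Longrightarrow> i \<notin> {a, b} \<Longrightarrow> x i = of_bool (i \<in> S)"
  shows "wrap n S a x = Complex (x a) (if b \<in> S then 1 - x b else x b)"
proof -
  have "(\<Prod>i\<in>{..<n} - {a}. if i \<in> S then x i else 1 - x i) = 
        (if b \<in> S then x b else 1 - x b) * (\<Prod>i\<in>{..<n} - {a} - {b}. if i \<in> S then x i else 1 - x i)"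
    using assms by (intro prod.remove) auto
  also have "(\<Prod>i\<in>{..<n} - {a} - {b}. if i \<in> S then x i else 1 - x i) = (\<Prod>i\<in>{..<n} - {a} - {b}. 1)"
    using assms(4) by (intro prod.cong refl) auto
  finally show ?thesis by (simp add: wrap_def)
qed

text \<open>
  The boundary of a square at the edge is mapped to the boundary of the unit square, traversed once.
\<close>
lemma wrap_square_boundary:
  assumes "a < n" "b < n" "a \<noteq> b" "a \<notin> S"
  shows "wrap n S a \<circ> word_path n S [a, b, a, b] =
    linepath 0 1 +++ linepath 1 (Complex 1 1) +++ linepath (Complex 1 1) \<i> +++ linepath \<i> 0 +++ linepath 0 0"
proof -
  have edge: "wrap n S a \<circ> seg (vert n T) (vert n (flip c T)) =
     linepath (Complex (of_bool (a \<in> T)) (of_bool ((b \<in> T) \<noteq> (b \<in> S))))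
       (Complex (of_bool (a \<in> flip c T)) (of_bool ((b \<in> flip c T) \<noteq> (b \<in> S))))"
    if T: "\<And>i. i \<notin> {a, b} \<Longrightarrow> i \<in> T \<longleftrightarrow> i \<in> S" and c: "c \<in> {a, b}" for T c
  proof
    fix t :: real
    let ?y = "seg (vert n T) (vert n (flip c T)) t"
    have same: "(1 - t) * d + t * d = d" for d :: real by (simp add: algebra_simps)
    have y: "?y i = (1 - t) * of_bool (i \<in> T) + t * of_bool (i \<in> flip c T)" if "i < n" for i
      using that by (simp add: seg_def vert_def)
    have "wrap n S a ?y = Complex (?y a) (if b \<in> S then 1 - ?y b else ?y b)"
      using assms T c by (intro wrap_on_square) (auto simp: y in_flip_iff same)
    also have "\<dots> = linepath (Complex (of_bool (a \<in> T)) (of_bool ((b \<in> T) \<noteq> (b \<in> S))))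
       (Complex (of_bool (a \<in> flip c T)) (of_bool ((b \<in> flip c T) \<noteq> (b \<in> S)))) t"
      using c assms(3) y[OF assms(1)] y[OF assms(2)]
      by (cases "c = b"; cases "b \<in> T"; cases "b \<in> S"; cases "a \<in> T")
         (auto simp: linepath_def complex_eq_iff in_flip_iff)
    finally show "(wrap n S a \<circ> seg (vert n T) (vert n (flip c T))) t = \<dots>" by simp
  qed
  have vert: "wrap n S a \<circ> (\<lambda>_. vert n T) = linepath 0 0" if "T = S" for T
  proof -
    have "wrap n S a (vert n S) = 0"
      using wrap_on_square[of a n b "vert n S" S] assms by (simp add: vert_def complex_eq_iff)
    thus ?thesis using that by (auto simp: fun_eq_iff linepath_def)
  qed
  have [simp]: "flip b (flip a (flip b (flip a S))) = S"
    by (auto simp: in_flip_iff)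
  have units: "Complex 0 0 = 0" "Complex 1 0 = 1" "Complex 0 1 = \<i>" 
    by (simp_all add: complex_eq_iff)
  show ?thesis
    using edge[of S a] edge[of "flip a S" b] edge[of "flip b (flip a S)" a] 
      edge[of "flip a (flip b (flip a S))" b] vert[of S] assms
    by (simp add: path_compose_join in_flip_iff units)
qed

lemma winding_number_square:
  "winding_number (linepath 0 1 +++ linepath 1 (Complex 1 1) +++ linepath (Complex 1 1) \<i> +++ linepath \<i> 0 +++ linepath 0 0)
     (Complex (1/2) (1/2)) = 1" (is "winding_number ?p ?z = 1")
proof -
  have out: "?z \<notin> closed_segment 0 1" "?z \<notin> closed_segment 1 (Complex 1 1)" 
    "?z \<notin> closed_segment (Complex 1 1) \<i>" "?z \<notin> closed_segment \<i> 0" "?z \<noteq> 0"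
    by (auto simp: in_segment complex_eq_iff)
  have "winding_number (rectpath 0 (Complex 1 1)) ?z = 1"
    by (rule winding_number_rectpath) (simp add: in_box_complex_iff)
  moreover have "rectpath 0 (Complex 1 1) = 
      linepath 0 1 +++ linepath 1 (Complex 1 1) +++ linepath (Complex 1 1) \<i> +++ linepath \<i> 0"
    by (simp add: rectpath_def Let_def one_complex.code imaginary_unit.code)
  ultimately show ?thesis
    using out by (simp add: winding_number_join path_image_join)
qed

text \<open>
  An edge in no square is seen by \<open>wrap\<close>: the boundary of a 2-face of the cube at this edge is a loop in
  the 1-skeleton with winding number 1 around the centre, so it is not null-homotopic in the complex.
\<close>
lemma isolated_edge_nontrivial:
  assumes S: "S \<subseteq> {..<n}" and ab: "a < n" "b < n" "a \<noteq> b" 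
    and iso: "\<And>i. i < n \<Longrightarrow> i \<noteq> a \<Longrightarrow> face n S {a, i} \<notin> W"
  shows "\<not> trivial_group (fundamental_group (cube_complex n W) (vert n {}))"
proof
  let ?X = "cube_complex n W" and ?v = "vert n {}" and ?z = "Complex (1/2) (1/2)"
  assume triv: "trivial_group (fundamental_group ?X ?v)"
  \<comment> \<open>The same edge, described by its endpoint with coordinate 0 in direction \<open>a\<close>.\<close>
  define S' where "S' = S - {a}"
  have S': "S' \<subseteq> {..<n}" "a \<notin> S'" using S by (auto simp: S'_def)
  have "face n S' {a, i} = face n S {a, i}" for i by (auto simp: S'_def in_face_iff)
  hence iso': "\<And>i. i < n \<Longrightarrow> i \<noteq> a \<Longrightarrow> face n S' {a, i} \<notin> W" using iso by simp
  let ?\<phi> = "wrap n S' a"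
  obtain u where u: "fold flip u {} = S'" using word_exists[OF empty_subsetI S'(1)] .
  define \<gamma> where "\<gamma> = word_path n {} u"
  define p where "p = word_path n S' [a, b, a, b]"
  have \<gamma>: "path \<gamma>" "path_image \<gamma> \<subseteq> ?X" "pathstart \<gamma> = ?v" "pathfinish \<gamma> = vert n S'"
    unfolding \<gamma>_def using u path_image_word_path by simp_all
  have "fold flip [a, b, a, b] S' = S'" by (auto simp: in_flip_iff)
  hence p: "path p" "path_image p \<subseteq> ?X" "pathstart p = vert n S'" "pathfinish p = vert n S'"
    unfolding p_def using path_image_word_path by (simp_all only: path_word_path pathstart_word_path pathfinish_word_path)
  define l where "l = \<gamma> +++ (p +++ reversepath \<gamma>)"
  have "l \<in> loops_at ?X ?v"
    using \<gamma> p by (auto simp: loops_at_def l_def path_image_join)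
  moreover have "(\<lambda>_. ?v) \<in> loops_at ?X ?v" by (intro const_in_loops_at vert_in_cube_complex)
  ultimately have "homotopy_class ?X l = homotopy_class ?X (\<lambda>_. ?v)"
    using triv unfolding trivial_group_def fundamental_group_def by auto
  hence "homotopic_paths ?X l (\<lambda>_. ?v)"
    using homotopy_class_eq_iff[OF const_in_loops_at[OF vert_in_cube_complex]] by blast
  moreover have avoid: "?\<phi> \<in> ?X \<rightarrow> - {?z}"
    using wrap_avoids_centre[OF ab(1) iso'] by auto
  ultimately have "homotopic_paths (- {?z}) (?\<phi> \<circ> l) (?\<phi> \<circ> (\<lambda>_. ?v))"
    using continuous_on_wrap by (intro homotopic_paths_continuous_image)
  hence "winding_number (?\<phi> \<circ> l) ?z = winding_number (?\<phi> \<circ> (\<lambda>_. ?v)) ?z"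
    by (rule winding_number_homotopic_paths)
  also have "?\<phi> \<circ> (\<lambda>_. ?v) = linepath (?\<phi> ?v) (?\<phi> ?v)"
    by (auto simp: fun_eq_iff linepath_refl)
  also have "winding_number \<dots> ?z = 0"
    using avoid vert_in_cube_complex by (intro winding_number_trivial) (auto simp: Pi_iff)
  finally have 0: "winding_number (?\<phi> \<circ> l) ?z = 0" .
  have img: "path (?\<phi> \<circ> q) \<and> ?z \<notin> path_image (?\<phi> \<circ> q)" if "path q" "path_image q \<subseteq> ?X" for q
    using that avoid continuous_on_wrap by (auto simp: path_image_compose intro!: path_continuous_image)
  have "?\<phi> \<circ> l = (?\<phi> \<circ> \<gamma>) +++ ((?\<phi> \<circ> p) +++ reversepath (?\<phi> \<circ> \<gamma>))"
    by (simp add: l_def path_compose_join path_compose_reversepath)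
  hence "winding_number (?\<phi> \<circ> l) ?z = winding_number (?\<phi> \<circ> p) ?z"
    using img[OF \<gamma>(1,2)] img[OF p(1,2)] \<gamma> p 
    by (simp add: winding_number_join winding_number_reversepath path_image_join pathfinish_compose pathstart_compose)
  also have "\<dots> = 1"
    unfolding p_def wrap_square_boundary[OF ab S'(2)] by (rule winding_number_square)
  finally show False using 0 by simp
qed

section \<open>Squares with trivial boundary\<close>

lemma weq_append: "weq n W S u w \<Longrightarrow> weq n W S (u @ z) (w @ z)"
  by (induction rule: weq.induct) (auto intro: weq.intros)

lemma weq_prefix: "weq n W (fold flip x S) u w \<Longrightarrow> weq n W S (x @ u) (x @ w)"
  by (induction x arbitrary: S) (auto intro: weq_Cons)

lemma weq_cancel: "weq n W S (x @ i # i # y) (x @ y)"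
  by (intro weq_prefix weq_back)

lemma weq_endpoint: "weq n W S u w \<Longrightarrow> fold flip u S = fold flip w S"
  by (induction rule: weq.induct) (auto simp: flip_commute)

text \<open>
  Two directions commute at a vertex iff the boundary of the square they span there is trivial.  This
  holds for the squares of \<open>W\<close> and, by the lemmas below, for many others.
\<close>
definition comm :: "nat \<Rightarrow> (nat \<Rightarrow> real) set set \<Rightarrow> nat set \<Rightarrow> nat \<Rightarrow> nat \<Rightarrow> bool" where
  "comm n W S a b \<longleftrightarrow> weq n W S [a, b] [b, a]"

lemma comm_sym: "comm n W S a b \<longleftrightarrow> comm n W S b a"
  by (auto simp: comm_def intro: weq_sym)

lemma comm_face: "face n S {a, b} \<in> W \<Longrightarrow> a \<noteq> b \<Longrightarrow> a < n \<Longrightarrow> b < n \<Longrightarrow> comm n W S a b"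
  unfolding comm_def by (rule weq_swap)

lemma comm_prefix:
  assumes "comm n W (fold flip x S) a b"
  shows "weq n W S (x @ a # b # y) (x @ b # a # y)"
  using weq_prefix[OF weq_append[OF assms[unfolded comm_def], of y]] by simp

lemma comm_flip_left:
  assumes "comm n W S a b" shows "comm n W (flip a S) a b"
proof -
  have "weq n W (flip a S) [b, a] ([a] @ [a, b, a])" by (simp add: weq_sym weq_back)
  also have "weq n W (flip a S) \<dots> ([a] @ [b, a, a])"
    using comm_prefix[of n W "[a]" "flip a S" a b "[a]"] assms by simp
  also (weq_trans) have "weq n W (flip a S) \<dots> ([a, b] @ [])"
    using weq_cancel[of n W "flip a S" "[a, b]" a "[]"] by simp
  finally (weq_trans) show ?thesis by (simp add: comm_def weq_sym)
qed

lemma comm_flip: 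
  assumes "i \<in> {a, b}" shows "comm n W (flip i S) a b \<longleftrightarrow> comm n W S a b"
proof -
  have "comm n W (flip a S) a b \<longleftrightarrow> comm n W S a b" for a b
    using comm_flip_left[of n W S a b] comm_flip_left[of n W "flip a S" a b] by auto
  from this[of a b] this[of b a] show ?thesis
    using assms comm_sym[of n W S a b] comm_sym[of n W "flip b S" a b] by auto
qed

text \<open>
  The choice of the starting vertex on the boundary of a square is immaterial.
\<close>
lemma comm_flips:
  assumes "\<And>i. i \<notin> {a, b} \<Longrightarrow> i \<in> S \<longleftrightarrow> i \<in> T" shows "comm n W T a b \<longleftrightarrow> comm n W S a b"
proof -
  have "T = S \<or> T = flip a S \<or> T = flip b S \<or> T = flip a (flip b S)"
  proof (cases "a \<in> S \<longleftrightarrow> a \<in> T"; cases "b \<in> S \<longleftrightarrow> b \<in> T")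
    assume "a \<in> S \<longleftrightarrow> a \<in> T" "b \<in> S \<longleftrightarrow> b \<in> T"
    hence "i \<in> T \<longleftrightarrow> i \<in> S" for i using assms[of i] by auto
    hence "T = S" by blast
    thus ?thesis by simp
  next
    assume "a \<in> S \<longleftrightarrow> a \<in> T" "(b \<in> S) \<noteq> (b \<in> T)"
    hence "i \<in> T \<longleftrightarrow> i \<in> flip b S" for i using assms[of i] by (auto simp: in_flip_iff)
    hence "T = flip b S" by blast
    thus ?thesis by simp
  next
    assume "(a \<in> S) \<noteq> (a \<in> T)" "b \<in> S \<longleftrightarrow> b \<in> T"
    hence "i \<in> T \<longleftrightarrow> i \<in> flip a S" for i using assms[of i] by (auto simp: in_flip_iff)
    hence "T = flip a S" by blast
    thus ?thesis by simp
  next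
    assume "(a \<in> S) \<noteq> (a \<in> T)" "(b \<in> S) \<noteq> (b \<in> T)"
    hence "a = b \<Longrightarrow> T = flip a S" "a \<noteq> b \<Longrightarrow> i \<in> T \<longleftrightarrow> i \<in> flip a (flip b S)" for i
      using assms by (auto simp: in_flip_iff)
    thus ?thesis by blast
  qed
  thus ?thesis using comm_flip[of a a b n W S] comm_flip[of b a b n W S] comm_flip[of a a b n W "flip b S"]
    by auto
qed

text \<open>
  In a 3-cube, five faces with trivial boundary force the sixth one: the square at \<open>S\<close> in directions \<open>a\<close> and \<open>b\<close>
  is pushed along direction \<open>i\<close> through the four side faces to the opposite face.
\<close>
lemma comm_cube:
  assumes "comm n W S a i" "comm n W S b i" "comm n W (flip b S) a i" "comm n W (flip a S) b i"
    and "comm n W (flip i S) a b"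
  shows "comm n W S a b"
proof -
  have "weq n W S [a, b] [a, b, i, i]"
    using weq_cancel[of n W S "[a, b]" i "[]"] by (simp add: weq_sym)
  also have "weq n W S \<dots> [a, i, b, i]"
    using comm_prefix[of n W "[a]" S b i "[i]"] assms(4) by simp
  also (weq_trans) have "weq n W S \<dots> [i, a, b, i]"
    using comm_prefix[of n W "[]" S a i "[b,i]"] assms(1) by simp
  also (weq_trans) have "weq n W S \<dots> [i, b, a, i]"
    using comm_prefix[of n W "[i]" S a b "[i]"] assms(5) by simp
  also (weq_trans) have "weq n W S \<dots> [b, i, a, i]"
    using comm_prefix[of n W "[]" S i b "[a,i]"] assms(2) by (simp add: comm_sym)
  also (weq_trans) have "weq n W S \<dots> [b, a, i, i]"
    using comm_prefix[of n W "[b]" S i a "[i]"] assms(3) by (simp add: comm_sym)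
  also (weq_trans) have "weq n W S \<dots> [b, a]"
    using weq_cancel[of n W S "[b, a]" i "[]"] by simp
  finally (weq_trans) show ?thesis by (simp add: comm_def)
qed

lemma in_fold_flip_iff: "i \<in> fold flip w S \<longleftrightarrow> (i \<in> S) \<noteq> odd (count_list w i)"
  by (induction w arbitrary: S) (auto simp: in_flip_iff)

text \<open>
  In a closed word every letter occurs an even number of times.  So the first letter occurs again; it is
  moved next to its second occurrence by commutations, and the pair cancels.
\<close>
lemma closed_word_trivial:
  assumes "\<And>S a b. S \<subseteq> {..<n} \<Longrightarrow> a < n \<Longrightarrow> b < n \<Longrightarrow> a \<noteq> b \<Longrightarrow> comm n W S a b"
    and "S \<subseteq> {..<n}" "set w \<subseteq> {..<n}" "fold flip w S = S"
  shows "weq n W S w []"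
  using assms(2-)
proof (induction "length w" arbitrary: w S rule: less_induct)
  case less
  have pull: "weq n W S (i # x @ z) (x @ i # z)" if "set x \<subseteq> {..<n}" "i < n" "S \<subseteq> {..<n}" for i x z S
    using that
  proof (induction x arbitrary: S)
    case (Cons c x)
    have "weq n W S (i # c # x @ z) (c # i # x @ z)"
    proof (cases "c = i")
      case False
      hence "comm n W S i c" using Cons.prems by (intro assms(1)) auto
      thus ?thesis using comm_prefix[of n W "[]" S i c "x @ z"] by simp
    qed (simp add: weq_refl)
    moreover have "weq n W S (c # i # x @ z) (c # x @ i # z)"
      using Cons.prems by (intro weq_Cons Cons.IH flip_subset) auto
    ultimately show ?case by (simp add: weq_trans)
  qed (simp add: weq_refl)
  show ?case
  proof (cases w)
    case Nil thus ?thesis by (simp add: weq_refl)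
  next
    case (Cons i r)
    have "i \<in> set r"
    proof (rule ccontr)
      assume "i \<notin> set r"
      hence "odd (count_list w i)" by (simp add: Cons count_notin)
      with less.prems(3) in_fold_flip_iff[of i w S] show False by auto
    qed
    then obtain x y where r: "r = x @ i # y" by (meson split_list)
    have "weq n W S w (x @ i # i # y)"
      unfolding Cons r using less.prems(1,2) Cons r by (intro pull) auto
    also have "weq n W S \<dots> (x @ y)" by (intro weq_prefix weq_back)
    finally (weq_trans) have *: "weq n W S w (x @ y)" .
    have "fold flip (x @ y) S = S" using weq_endpoint[OF *] less.prems(3) by simp
    hence "weq n W S (x @ y) []"
      using less.prems(1,2) Cons r by (intro less.hyps) auto
    with * show ?thesis by (rule weq_trans)
  qed
qed

section \<open>Typical complexes without isolated edges\<close>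

text \<open>
  An edge is given by an endpoint \<open>S\<close> and its direction \<open>a\<close>; the other endpoint is \<open>flip a S\<close>.  It is isolated
  iff \<open>nbrs n W S a\<close> is empty.
\<close>
definition nbrs :: "nat \<Rightarrow> (nat \<Rightarrow> real) set set \<Rightarrow> nat set \<Rightarrow> nat \<Rightarrow> nat set" where
  "nbrs n W S a = {i. i < n \<and> i \<noteq> a \<and> face n S {a, i} \<in> W}"

definition light :: "nat \<Rightarrow> nat \<Rightarrow> (nat \<Rightarrow> real) set set \<Rightarrow> nat set \<Rightarrow> nat \<Rightarrow> bool" where
  "light n s W S a \<longleftrightarrow> card (nbrs n W S a) < 2 * s"

text \<open>
  The three properties of the complex at density \<open>2/5\<close> from which everything else is deduced without
  probability.  The parameter \<open>s\<close> has to be large compared with \<open>sqrt n\<close> and small compared with \<open>n / ln n\<close>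
  for them to be likely.  In \<open>grids_have_open_box\<close>, the four squares are the faces
  of the 3-cube at \<open>S\<close> in directions \<open>a\<close>, \<open>i\<close>, \<open>j\<close> other than the two that contain the edge \<open>(S, a)\<close>.
  In \<open>translates_open\<close>, the sets \<open>J\<close> and \<open>J'\<close> stand for the directions in which the translates of the square by
  \<open>i\<close> and \<open>i'\<close> cannot be moved further.
\<close>
definition light_edges_sparse :: "nat \<Rightarrow> nat \<Rightarrow> (nat \<Rightarrow> real) set set \<Rightarrow> bool" where
  "light_edges_sparse n s W \<longleftrightarrow> (\<forall>S\<subseteq>{..<n}. \<forall>S'\<subseteq>{..<n}. \<forall>a<n. \<forall>a'<n.
     light n s W S a \<longrightarrow> light n s W S' a' \<longrightarrow> card ((S - S') \<union> (S' - S)) \<le> 4 \<longrightarrow>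
     a' = a \<and> (S' = S \<or> S' = flip a S))"

definition grids_have_open_box :: "nat \<Rightarrow> nat \<Rightarrow> (nat \<Rightarrow> real) set set \<Rightarrow> bool" where
  "grids_have_open_box n s W \<longleftrightarrow> (\<forall>S\<subseteq>{..<n}. \<forall>a<n. \<forall>I\<subseteq>{..<n} - {a}. \<forall>D\<subseteq>{..<n} - {a}.
     I \<inter> D = {} \<longrightarrow> card I = s \<longrightarrow> card D = s \<longrightarrow>
     (\<exists>i\<in>I. \<exists>j\<in>D. {face n (flip j S) {a, i}, face n (flip i S) {a, j},
        face n S {i, j}, face n (flip a S) {i, j}} \<subseteq> W))"

definition translates_open :: "nat \<Rightarrow> nat \<Rightarrow> (nat \<Rightarrow> real) set set \<Rightarrow> bool" where
  "translates_open n s W \<longleftrightarrow> (\<forall>S\<subseteq>{..<n}. \<forall>a<n. \<forall>b<n. \<forall>i<n. \<forall>i'<n. \<forall>J\<subseteq>{..<n}. \<forall>J'\<subseteq>{..<n}.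
     distinct [a, b, i, i'] \<longrightarrow> card J \<le> 4 * s + 2 \<longrightarrow> card J' \<le> 4 * s + 2 \<longrightarrow>
     (\<exists>j<n. j \<notin> J \<union> {a, b, i} \<and> face n (flip j (flip i S)) {a, b} \<in> W) \<or>
     (\<exists>j<n. j \<notin> J' \<union> {a, b, i'} \<and> face n (flip j (flip i' S)) {a, b} \<in> W))"

text \<open>
  \<open>W0\<close> is the complex at the fixed density, and \<open>W\<close> is any larger complex.  Commutation refers to \<open>W\<close>,
  lightness to \<open>W0\<close>.
\<close>
locale typical =
  fixes n s :: nat and W0 W :: "(nat \<Rightarrow> real) set set"
  assumes sparse: "light_edges_sparse n s W0"
    and grid: "grids_have_open_box n s W0"
    and translates: "translates_open n s W0"
    and sub: "W0 \<subseteq> W"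
    and large: "4 * s + 6 \<le> n" "0 < s"
begin

definition bad :: "nat set \<Rightarrow> nat \<Rightarrow> nat set" where
  "bad S a = {i. i < n \<and> i \<noteq> a \<and> \<not> comm n W S a i}"

text \<open>
  Suppose \<open>s\<close> directions \<open>I\<close> fail to commute with \<open>a\<close>.  As the edge is not light, there remain \<open>s\<close> directions \<open>D\<close>
  outside \<open>I\<close> whose squares with \<open>a\<close> are in \<open>W0\<close>.  An open box in the grid \<open>I \<times> D\<close> then has five faces in
  \<open>W\<close>, and the sixth face is one of the supposed failures.
\<close>
lemma bad_small:
  assumes "\<not> light n s W0 S a" "S \<subseteq> {..<n}" "a < n"
  shows "card (bad S a) < s"
proof (rule ccontr)
  assume "\<not> ?thesis"
  hence "s \<le> card (bad S a)" by simp
  from obtain_subset_with_card_n[OF this] obtain I where I: "I \<subseteq> bad S a" "card I = s" by blast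
  have fin: "finite I" using I(1) by (rule finite_subset) (auto simp: bad_def)
  have "2 * s \<le> card (nbrs n W0 S a)" using assms(1) by (simp add: light_def)
  hence "s \<le> card (nbrs n W0 S a - I)" using diff_card_le_card_Diff[OF fin, of "nbrs n W0 S a"] I(2) by linarith
  from obtain_subset_with_card_n[OF this] obtain D where D: "D \<subseteq> nbrs n W0 S a - I" "card D = s" by blast
  have "I \<subseteq> {..<n} - {a}" "D \<subseteq> {..<n} - {a}" "I \<inter> D = {}"
    using I(1) D(1) by (auto simp: bad_def nbrs_def)
  from grid[unfolded grids_have_open_box_def, rule_format, OF assms(2,3) this I(2) D(2)]
  obtain i j where ij: "i \<in> I" "j \<in> D" 
     "{face n (flip j S) {a, i}, face n (flip i S) {a, j}, face n S {i, j}, face n (flip a S) {i, j}} \<subseteq> W0"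
    by blast
  have faces: "face n (flip j S) {a, i} \<in> W" "face n (flip i S) {a, j} \<in> W" "face n S {i, j} \<in> W"
    "face n (flip a S) {i, j} \<in> W" "face n S {a, j} \<in> W"
    using ij D(1) sub by (auto simp: nbrs_def)
  have ne: "i \<noteq> j" "i \<noteq> a" "j \<noteq> a" "i < n" "j < n"
    using ij I(1) D(1) by (auto simp: bad_def nbrs_def)
  have "comm n W S a i"
    by (rule comm_cube[where i = j]; rule comm_face) (use faces ne assms in simp_all)
  moreover have "\<not> comm n W S a i" using I(1) ij(1) unfolding bad_def by blast
  ultimately show False by simp
qed

definition heavy_square :: "nat set \<Rightarrow> nat \<Rightarrow> nat \<Rightarrow> bool" where
  "heavy_square S a b \<longleftrightarrow> \<not> light n s W0 S a \<and> \<not> light n s W0 (flip b S) a \<and>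
     \<not> light n s W0 S b \<and> \<not> light n s W0 (flip a S) b"

lemma not_heavy_square:
  assumes "\<not> heavy_square S a b" "S \<subseteq> {..<n}" "a < n" "b < n"
  obtains T x where "light n s W0 T x" "x \<in> {a, b}" "T \<subseteq> {..<n}" "\<And>i. i \<notin> {a, b} \<Longrightarrow> i \<in> T \<longleftrightarrow> i \<in> S"
proof -
  consider "light n s W0 S a" | "light n s W0 (flip b S) a" | "light n s W0 S b" | "light n s W0 (flip a S) b"
    using assms(1) unfolding heavy_square_def by blast
  thus thesis
  proof cases
    case 1 thus ?thesis using assms(2) by (intro that[of S a]) simp_all
  next
    case 2 thus ?thesis using assms(2,4) by (intro that[of "flip b S" a] flip_subset) (simp_all add: in_flip_iff)
  next
    case 3 thus ?thesis using assms(2) by (intro that[of S b]) simp_all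
  next
    case 4 thus ?thesis using assms(2,3) by (intro that[of "flip a S" b] flip_subset) (simp_all add: in_flip_iff)
  qed
qed

text \<open>
  Near a light edge there is no other light edge.  So if a square close to it is not heavy, the light edge
  is an edge of this square: its direction is one of \<open>a\<close>, \<open>b\<close>, and its other coordinates agree.
\<close>
lemma light_edge_unique:
  assumes "light n s W0 T x" "T \<subseteq> {..<n}" "x < n" 
    and "\<not> heavy_square S a b" "S \<subseteq> {..<n}" "a < n" "b < n"
    and "\<And>i. i \<notin> {a, b, c, d} \<Longrightarrow> i \<in> S \<longleftrightarrow> i \<in> T"
  shows "x \<in> {a, b}" "\<And>i. i \<notin> {a, b} \<Longrightarrow> i \<in> S \<longleftrightarrow> i \<in> T"
proof -
  obtain T' x' where T': "light n s W0 T' x'" "x' \<in> {a, b}" "T' \<subseteq> {..<n}" 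
    "\<And>i. i \<notin> {a, b} \<Longrightarrow> i \<in> T' \<longleftrightarrow> i \<in> S"
    using not_heavy_square[OF assms(4-7)] by blast
  have "(T - T') \<union> (T' - T) \<subseteq> {a, b, c, d}"
  proof
    fix i assume "i \<in> (T - T') \<union> (T' - T)"
    thus "i \<in> {a, b, c, d}" using T'(4)[of i] assms(8)[of i] by auto
  qed
  hence "card ((T - T') \<union> (T' - T)) \<le> card {a, b, c, d}" by (intro card_mono) auto
  also have "\<dots> \<le> 4" by (auto simp: card_insert_if)
  finally have c4: "card ((T - T') \<union> (T' - T)) \<le> 4" .
  have "x' < n" using T'(2) assms(6,7) by auto
  from sparse[unfolded light_edges_sparse_def, rule_format, OF assms(2) T'(3) assms(3) this assms(1) T'(1) c4]
  have eq: "x' = x" "T' = T \<or> T' = flip x T" by auto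
  show x: "x \<in> {a, b}" using eq T'(2) by simp
  show "i \<in> S \<longleftrightarrow> i \<in> T" if "i \<notin> {a, b}" for i
    using T'(4)[OF that] eq(2) x that by (auto simp: in_flip_iff)
qed

text \<open>
  Outside \<open>blocked S a b\<close>, the square can be pushed one step to its parallel translate, because the four
  side faces of the 3-cube in between commute.
\<close>
definition blocked :: "nat set \<Rightarrow> nat \<Rightarrow> nat \<Rightarrow> nat set" where
  "blocked S a b = {a, b} \<union> bad S a \<union> bad (flip b S) a \<union> bad S b \<union> bad (flip a S) b"

lemma card_blocked:
  assumes "heavy_square S a b" "S \<subseteq> {..<n}" "a < n" "b < n"
  shows "card (blocked S a b) \<le> 4 * s + 2"
proof -
  have "card (bad S a) < s" "card (bad (flip b S) a) < s" "card (bad S b) < s" "card (bad (flip a S) b) < s"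
    using assms flip_subset[OF assms(2)] by (simp_all add: bad_small heavy_square_def)
  moreover have "card {a, b} \<le> 2" by (simp add: card_insert_if)
  ultimately show ?thesis unfolding blocked_def
    using card_Un_le[of "{a, b}" "bad S a"] card_Un_le[of "{a, b} \<union> bad S a" "bad (flip b S) a"]
      card_Un_le[of "{a, b} \<union> bad S a \<union> bad (flip b S) a" "bad S b"]
      card_Un_le[of "{a, b} \<union> bad S a \<union> bad (flip b S) a \<union> bad S b" "bad (flip a S) b"]
    by linarith
qed

lemma comm_parallel:
  assumes "i < n" "i \<notin> blocked S a b" "comm n W (flip i S) a b"
  shows "comm n W S a b"
  by (rule comm_cube[where i = i]) (use assms in \<open>auto simp: blocked_def bad_def\<close>)

text \<open>
  A heavy square has only few blocked directions, and at most one of its translates contains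
  a light edge.  So there are two translates that are heavy again, and each of them has few blocked
  directions.  By \<open>translates_open\<close>, one of the two has an unblocked translate in \<open>W0\<close>.
\<close>
lemma heavy_square_comm:
  assumes hsq: "heavy_square S a b" and S: "S \<subseteq> {..<n}" and ab: "a < n" "b < n" "a \<noteq> b"
  shows "comm n W S a b"
proof -
  let ?F = "{..<n} - blocked S a b"
  have fin: "finite (blocked S a b)" by (auto simp: blocked_def bad_def)
  have "card ?F \<ge> n - card (blocked S a b)"
    using diff_card_le_card_Diff[OF fin, of "{..<n}"] by simp
  \<comment> \<open>Three candidates, because the translate in one of them may contain a light edge.\<close>
  hence "3 \<le> card ?F" using card_blocked[OF hsq S ab(1,2)] large by linarith
  from obtain_subset_with_card_n[OF this] obtain F where F: "F \<subseteq> ?F" "card F = 3" by blast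
  then obtain i1 i2 i3 where i: "F = {i1, i2, i3}" "distinct [i1, i2, i3]"
    by (auto simp: card_3_iff)
  have one: "heavy_square (flip i S) a b \<or> heavy_square (flip i' S) a b" 
    if "i \<in> F" "i' \<in> F" "i \<noteq> i'" for i i'
  proof (rule ccontr)
    assume *: "\<not> ?thesis"
    have ni: "i < n" "i' < n" "i \<notin> {a, b}" "i' \<notin> {a, b}"
      using that F(1) by (auto simp: blocked_def)
    obtain T x where T: "light n s W0 T x" "x \<in> {a, b}" "T \<subseteq> {..<n}" 
      "\<And>k. k \<notin> {a, b} \<Longrightarrow> k \<in> T \<longleftrightarrow> k \<in> flip i S"
      using not_heavy_square[OF _ flip_subset[OF S ni(1)] ab(1,2)] * by blast
    have "i \<in> flip i' S \<longleftrightarrow> i \<in> T"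
    proof (rule light_edge_unique(2)[where a = a and b = b and c = i and d = i' and x = x])
      show "k \<in> flip i' S \<longleftrightarrow> k \<in> T" if "k \<notin> {a, b, i, i'}" for k
        using T(4)[of k] that by (auto simp: in_flip_iff)
    qed (use T ab ni * flip_subset[OF S ni(2)] in auto)
    with T(4)[OF ni(3)] that(3) show False by (auto simp: in_flip_iff)
  qed
  obtain i i' where ii: "i \<in> F" "i' \<in> F" "i \<noteq> i'" 
    "heavy_square (flip i S) a b" "heavy_square (flip i' S) a b"
    using one[of i1 i2] one[of i1 i3] one[of i2 i3] i that[of i1 i2] that[of i1 i3] that[of i2 i3] by auto
  have ni: "i < n" "i' < n" "i \<notin> {a, b}" "i' \<notin> {a, b}" "i \<notin> blocked S a b" "i' \<notin> blocked S a b"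
    using ii F(1) by (auto simp: blocked_def)
  have step: "comm n W S a b" if "k \<in> {i, i'}" "j < n" "j \<notin> blocked (flip k S) a b \<union> {a, b, k}"
     "face n (flip j (flip k S)) {a, b} \<in> W0" for k j
  proof -
    have "comm n W (flip j (flip k S)) a b" using that ab sub by (intro comm_face) auto
    hence "comm n W (flip k S) a b" using that(2,3) comm_parallel by blast
    moreover have "k < n" "k \<notin> blocked S a b" using that(1) ni by auto
    ultimately show ?thesis using comm_parallel by blast
  qed
  have subs: "blocked (flip i S) a b \<subseteq> {..<n}" "blocked (flip i' S) a b \<subseteq> {..<n}"
    using ab by (auto simp: blocked_def bad_def)
  have cards: "card (blocked (flip i S) a b) \<le> 4 * s + 2" "card (blocked (flip i' S) a b) \<le> 4 * s + 2"
    using card_blocked[OF ii(4) flip_subset[OF S ni(1)] ab(1,2)]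
      card_blocked[OF ii(5) flip_subset[OF S ni(2)] ab(1,2)] .
  have "distinct [a, b, i, i']" using ni ii(3) ab(3) by auto
  hence "(\<exists>j<n. j \<notin> blocked (flip i S) a b \<union> {a, b, i} \<and> face n (flip j (flip i S)) {a, b} \<in> W0) \<or>
     (\<exists>j<n. j \<notin> blocked (flip i' S) a b \<union> {a, b, i'} \<and> face n (flip j (flip i' S)) {a, b} \<in> W0)"
    using translates[unfolded translates_open_def, rule_format, OF S ab(1,2) ni(1,2) subs _ cards] by blast
  thus ?thesis using step by blast
qed

text \<open>
  Unless it belongs to \<open>W\<close>, the given square at the light edge spans a 3-cube with a square of \<open>W\<close> at this edge.
  The four other faces of this 3-cube do not contain the light edge, so they are heavy.
\<close>
lemma light_edge_comm:
  assumes light: "light n s W0 T x" and T: "T \<subseteq> {..<n}" and xy: "x < n" "y < n" "x \<noteq> y"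
    and ne: "nbrs n W T x \<noteq> {}"
  shows "comm n W T x y"
proof -
  obtain j where j: "j < n" "j \<noteq> x" "face n T {x, j} \<in> W" using ne by (auto simp: nbrs_def)
  hence cj: "comm n W T x j" using xy by (intro comm_face) auto
  show ?thesis
  proof (cases "j = y")
    case False
    have heavy: "comm n W S a b" 
      if S: "S \<subseteq> {..<n}" and ab: "a < n" "b < n" "a \<noteq> b" 
        and close: "\<And>i. i \<notin> {a, b, x, y, j} \<Longrightarrow> i \<in> S \<longleftrightarrow> i \<in> T" "{a, b} \<subseteq> {x, y, j}"
        and other: "x \<notin> {a, b} \<or> (\<exists>i. i \<notin> {a, b} \<and> (i \<in> S) \<noteq> (i \<in> T))" for S a b
    proof (rule heavy_square_comm[OF _ S ab], rule ccontr)
      assume nh: "\<not> heavy_square S a b"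
      obtain c where c: "{x, y, j} \<subseteq> {a, b, c}" using close(2) ab(3) by blast
      have *: "\<And>i. i \<notin> {a, b, c, c} \<Longrightarrow> i \<in> S \<longleftrightarrow> i \<in> T" using close(1) c by blast
      show False using light_edge_unique[OF light T xy(1) nh S ab(1,2) *] other by blast
    qed
    show ?thesis
    proof (rule comm_cube[where i = j])
      show "comm n W T y j" by (rule heavy) (use T j xy False in auto)
      show "comm n W (flip y T) x j"
      proof (rule heavy)
        show "x \<notin> {x, j} \<or> (\<exists>i. i \<notin> {x, j} \<and> (i \<in> flip y T) \<noteq> (i \<in> T))"
          using xy False by (intro disjI2 exI[of _ y]) (simp add: in_flip_iff)
      qed (use flip_subset[OF T] j xy False in \<open>auto simp: in_flip_iff\<close>)
      show "comm n W (flip x T) y j"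
        by (rule heavy) (use flip_subset[OF T] j xy False in \<open>auto simp: in_flip_iff\<close>)
      show "comm n W (flip j T) x y"
      proof (rule heavy)
        show "x \<notin> {x, y} \<or> (\<exists>i. i \<notin> {x, y} \<and> (i \<in> flip j T) \<noteq> (i \<in> T))"
          using j False by (intro disjI2 exI[of _ j]) (simp add: in_flip_iff)
      qed (use flip_subset[OF T] j xy False in \<open>auto simp: in_flip_iff\<close>)
    qed (rule cj)
  qed (use cj in simp)
qed

text \<open>
  Every square is heavy or contains a light edge; the edge is not isolated in \<open>W\<close>.
\<close>
theorem all_comm:
  assumes "\<And>S a. S \<subseteq> {..<n} \<Longrightarrow> a < n \<Longrightarrow> nbrs n W S a \<noteq> {}"
    and "S \<subseteq> {..<n}" "a < n" "b < n" "a \<noteq> b"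
  shows "comm n W S a b"
proof (cases "heavy_square S a b")
  case False
  obtain T x where T: "light n s W0 T x" "x \<in> {a, b}" "T \<subseteq> {..<n}" "\<And>i. i \<notin> {a, b} \<Longrightarrow> i \<in> T \<longleftrightarrow> i \<in> S"
    using not_heavy_square[OF False assms(2-4)] by blast
  have "comm n W T x (if x = a then b else a)"
    using T assms by (intro light_edge_comm assms(1)) auto
  hence "comm n W T a b" using T(2) assms(5) by (auto simp: comm_sym[of n W T b a] split: if_splits)
  thus ?thesis using comm_flips[of a b T S n W] T(4) by simp
qed (use heavy_square_comm assms in blast)

end

section \<open>Probabilities of failure\<close>

text \<open>
  A group of at most \<open>r\<close> independent labels lies entirely in \<open>B\<close> with probability at least \<open>q ^ r\<close>, and
  disjoint groups are independent of each other.
\<close>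
lemma (in prob_space) prob_all_groups_fail:
  fixes X :: "'b \<Rightarrow> 'a \<Rightarrow> real"
  assumes indep: "indep_vars (\<lambda>_. borel) X F" 
    and T: "finite T" and G: "\<And>t. t \<in> T \<Longrightarrow> G t \<subseteq> F" "disjoint_family_on G T"
      "\<And>t. t \<in> T \<Longrightarrow> finite (G t) \<and> card (G t) \<le> r"
    and B: "B \<in> sets borel" "\<And>f. f \<in> F \<Longrightarrow> prob {\<omega> \<in> space M. X f \<omega> \<in> B} = q" "0 \<le> q" "q \<le> 1"
  shows "{\<omega> \<in> space M. \<forall>t\<in>T. \<exists>f\<in>G t. X f \<omega> \<notin> B} \<in> events" (is "?E \<in> _")
    and "prob {\<omega> \<in> space M. \<forall>t\<in>T. \<exists>f\<in>G t. X f \<omega> \<notin> B} \<le> (1 - q ^ r) ^ card T"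
proof -
  have meas: "X f \<in> borel_measurable M" if "f \<in> F" for f
    using indep that by (auto simp: indep_vars_def)
  have B': "{\<omega> \<in> space M. X f \<omega> \<in> B} \<in> events" if "f \<in> F" for f
    using meas[OF that] B(1) by measurable
  show "?E \<in> events"
  proof -
    have "{\<omega> \<in> space M. X f \<omega> \<notin> B} \<in> events" if "f \<in> F" for f
    proof -
      have "{\<omega> \<in> space M. X f \<omega> \<notin> B} = space M - {\<omega> \<in> space M. X f \<omega> \<in> B}" by auto
      thus ?thesis using B'[OF that] by auto
    qed
    thus ?thesis using T G by (intro sets.sets_Collect_finite_All sets.sets_Collect_finite_Ex) blast+
  qed
  show "prob ?E \<le> (1 - q ^ r) ^ card T"
  proof (cases "T = {}")
    case False
    define Y where "Y t \<omega> = restrict (\<lambda>f. X f \<omega>) (G t)" for t \<omega>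
    define C where "C t = space (PiM (G t) (\<lambda>_. borel)) - (\<Pi>\<^sub>E f\<in>G t. B)" for t
    have Y: "indep_vars (\<lambda>t. PiM (G t) (\<lambda>_. borel)) Y T"
      unfolding Y_def[abs_def] by (rule indep_vars_restrict[OF indep]) (use G in auto)
    have C: "C t \<in> sets (PiM (G t) (\<lambda>_. borel))" if "t \<in> T" for t
      unfolding C_def using G(3)[OF that] B(1) by (intro sets.Diff sets.top sets_PiM_I_finite) auto
    have pre: "Y t -` C t \<inter> space M = space M - {\<omega> \<in> space M. \<forall>f\<in>G t. X f \<omega> \<in> B}" if "t \<in> T" for t
      by (auto simp: C_def Y_def space_PiM PiE_iff)
    have single: "prob (Y t -` C t \<inter> space M) \<le> 1 - q ^ r" if t: "t \<in> T" for t
    proof -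
      have "prob {\<omega> \<in> space M. \<forall>f\<in>G t. X f \<omega> \<in> B} = q ^ card (G t)"
      proof (cases "G t = {}")
        case False
        have "prob (\<Inter>f\<in>G t. X f -` B \<inter> space M) = (\<Prod>f\<in>G t. prob (X f -` B \<inter> space M))"
          using False G t B(1) by (intro indep_varsD[OF indep]) auto
        also have "\<dots> = (\<Prod>f\<in>G t. q)"
        proof (rule prod.cong[OF refl])
          fix f assume "f \<in> G t"
          have "X f -` B \<inter> space M = {\<omega> \<in> space M. X f \<omega> \<in> B}" by auto
          thus "prob (X f -` B \<inter> space M) = q" using B(2) G(1)[OF t] \<open>f \<in> G t\<close> by auto
        qed
        also have "(\<Inter>f\<in>G t. X f -` B \<inter> space M) = {\<omega> \<in> space M. \<forall>f\<in>G t. X f \<omega> \<in> B}"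
          using False by auto
        finally show ?thesis by simp
      qed (simp add: prob_space)
      moreover have "{\<omega> \<in> space M. \<forall>f\<in>G t. X f \<omega> \<in> B} \<in> events"
        using G t B' by (intro sets.sets_Collect_finite_All) blast+
      ultimately have "prob (Y t -` C t \<inter> space M) = 1 - q ^ card (G t)"
        unfolding pre[OF t] by (subst prob_compl) auto
      moreover have "q ^ r \<le> q ^ card (G t)" using G(3)[OF t] B(3,4) by (intro power_decreasing) auto
      ultimately show ?thesis by simp
    qed
    have "prob ?E = prob (\<Inter>t\<in>T. Y t -` C t \<inter> space M)"
      using False by (intro arg_cong[where f = prob]) (auto simp: C_def Y_def space_PiM PiE_iff)
    also have "\<dots> = (\<Prod>t\<in>T. prob (Y t -` C t \<inter> space M))"
      using False T C by (intro indep_varsD_finite[OF Y]) auto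
    also have "\<dots> \<le> (\<Prod>t\<in>T. 1 - q ^ r)"
      using single by (intro prod_mono) auto
    finally show ?thesis by simp
  qed simp
qed

text \<open>
  The union bound over a finite set \<open>C\<close> of configurations, each with at least \<open>m\<close> disjoint groups.
\<close>
lemma (in prob_space) prob_some_config_fails:
  fixes X :: "'b \<Rightarrow> 'a \<Rightarrow> real"
  assumes indep: "indep_vars (\<lambda>_. borel) X F" 
    and B: "B \<in> sets borel" "\<And>f. f \<in> F \<Longrightarrow> prob {\<omega> \<in> space M. X f \<omega> \<in> B} = q" "0 \<le> q" "q \<le> 1"
    and C: "finite C" "card C \<le> K"
    and T: "\<And>c. c \<in> C \<Longrightarrow> finite (T c) \<and> m \<le> card (T c)" 
    and G: "\<And>c t. c \<in> C \<Longrightarrow> t \<in> T c \<Longrightarrow> G c t \<subseteq> F \<and> finite (G c t) \<and> card (G c t) \<le> r" 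
      "\<And>c. c \<in> C \<Longrightarrow> disjoint_family_on (G c) (T c)"
  shows "{\<omega> \<in> space M. \<exists>c\<in>C. \<forall>t\<in>T c. \<exists>f\<in>G c t. X f \<omega> \<notin> B} \<in> events" (is "?E \<in> _")
    and "prob {\<omega> \<in> space M. \<exists>c\<in>C. \<forall>t\<in>T c. \<exists>f\<in>G c t. X f \<omega> \<notin> B} \<le> K * (1 - q ^ r) ^ m"
proof -
  define E where "E c = {\<omega> \<in> space M. \<forall>t\<in>T c. \<exists>f\<in>G c t. X f \<omega> \<notin> B}" for c
  have E: "E c \<in> events" "prob (E c) \<le> (1 - q ^ r) ^ card (T c)" if "c \<in> C" for c
    unfolding E_def using T[OF that] G[OF that]
    using prob_all_groups_fail[OF indep, of "T c" "G c" r B q] B by simp_all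
  have eq: "?E = (\<Union>c\<in>C. E c)" by (auto simp: E_def)
  show "?E \<in> events" unfolding eq using C E by blast
  have "prob ?E \<le> (\<Sum>c\<in>C. prob (E c))"
    unfolding eq using C E by (intro finite_measure_subadditive_finite) auto
  also have "\<dots> \<le> (\<Sum>c\<in>C. (1 - q ^ r) ^ m)"
  proof (rule sum_mono)
    fix c assume c: "c \<in> C"
    have "q ^ r \<le> 1" using B by (simp add: power_le_one)
    hence "(1 - q ^ r) ^ card (T c) \<le> (1 - q ^ r) ^ m"
      using T[OF c] B by (intro power_decreasing) auto
    with E(2)[OF c] show "prob (E c) \<le> (1 - q ^ r) ^ m" by simp
  qed
  also have "\<dots> = card C * (1 - q ^ r) ^ m" by simp
  also have "\<dots> \<le> K * (1 - q ^ r) ^ m"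
    using C(2) B by (intro mult_right_mono) (auto simp: power_le_one)
  finally show "prob ?E \<le> K * (1 - q ^ r) ^ m" .
qed

text \<open>
  A set of size at most \<open>k\<close> is the range of a list of length \<open>k\<close> that may use \<open>n\<close> as a dummy entry.
\<close>
lemma card_small_subsets:
  "finite {B. B \<subseteq> {..<n} \<and> card B \<le> k}" "card {B. B \<subseteq> {..<n} \<and> card B \<le> k} \<le> (n + 1) ^ k"
proof -
  let ?L = "{xs. set xs \<subseteq> {..n} \<and> length xs = k}"
  have fin: "finite ?L" by (rule finite_lists_length_eq) simp
  have "{B. B \<subseteq> {..<n} \<and> card B \<le> k} \<subseteq> (\<lambda>xs. set xs \<inter> {..<n}) ` ?L"
  proof
    fix B assume "B \<in> {B. B \<subseteq> {..<n} \<and> card B \<le> k}"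
    hence B: "B \<subseteq> {..<n}" "card B \<le> k" "finite B" by (auto intro: finite_subset)
    define xs where "xs = sorted_list_of_set B @ replicate (k - card B) n"
    have "set xs = B \<or> set xs = insert n B"
      using B by (cases "k - card B = 0") (auto simp: xs_def)
    hence "set xs \<inter> {..<n} = B" "set xs \<subseteq> {..n}" using B by auto
    moreover have "length xs = k" using B by (simp add: xs_def)
    ultimately show "B \<in> (\<lambda>xs. set xs \<inter> {..<n}) ` ?L" by (intro image_eqI[of _ _ xs]) auto
  qed
  moreover have "card ((\<lambda>xs. set xs \<inter> {..<n}) ` ?L) \<le> card ?L" by (rule card_image_le[OF fin])
  moreover have "card ?L = (n + 1) ^ k" by (subst card_lists_length_eq) auto
  ultimately show "card {B. B \<subseteq> {..<n} \<and> card B \<le> k} \<le> (n + 1) ^ k"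
    using card_mono[OF finite_imageI[OF fin]] by fastforce
qed (simp add: finite_subset[of _ "Pow {..<n}"] subset_iff)

lemma card_Un_almost_disjoint:
  assumes "finite A" "finite B" "m \<le> card A" "m \<le> card B" 
    and "\<And>x y. x \<in> A \<inter> B \<Longrightarrow> y \<in> A \<inter> B \<Longrightarrow> x = y"
  shows "2 * m - 1 \<le> card (A \<union> B)"
proof -
  have "card (A \<inter> B) \<le> 1" using assms(1,5) by (simp add: card_le_Suc0_iff_eq)
  moreover have "card A + card B = card (A \<union> B) + card (A \<inter> B)" by (rule card_Un_Int) fact+
  ultimately show ?thesis using assms by linarith
qed

lemma card_image_Diff_ge:
  assumes "inj_on g (A - B)" "finite A" "finite B" 
  shows "card A - card B \<le> card (g ` (A - B))"
  using assms by (simp add: card_image diff_card_le_card_Diff)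

locale labelled_squares = prob_space M for M :: "'a measure" +
  fixes n :: nat and X :: "(nat \<Rightarrow> real) set \<Rightarrow> 'a \<Rightarrow> real"
  assumes indep: "indep_vars (\<lambda>_. borel) X (cube_faces n 2)"
    and uniform: "\<And>f. f \<in> cube_faces n 2 \<Longrightarrow> distr M borel (X f) = uniform_measure lborel {0..1}"
begin

definition open_squares :: "'a \<Rightarrow> (nat \<Rightarrow> real) set set" where
  "open_squares \<omega> = {f \<in> cube_faces n 2. X f \<omega> \<le> 2/5}"

lemma measurable_X: "f \<in> cube_faces n 2 \<Longrightarrow> X f \<in> borel_measurable M"
  using indep by (auto simp: indep_vars_def)

lemma prob_open:
  assumes f: "f \<in> cube_faces n 2" 
  shows "prob {\<omega> \<in> space M. X f \<omega> \<in> {..2/5}} = 2/5"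
proof -
  have "prob {\<omega> \<in> space M. X f \<omega> \<in> {..2/5}} = prob (X f -` {..2/5} \<inter> space M)"
    by (intro arg_cong[where f = prob]) auto
  also have "\<dots> = measure (distr M borel (X f)) {..2/5}"
    using measurable_X[OF f] by (subst measure_distr) auto
  also have "\<dots> = measure (uniform_measure lborel {0..1::real}) {..2/5}" by (simp add: uniform[OF f])
  also have "\<dots> = measure lborel ({0..1} \<inter> {..2/5::real})"
    by (subst measure_uniform_measure) auto
  also have "{0..1} \<inter> {..2/5::real} = {0..2/5}" by auto
  finally show ?thesis by simp
qed

lemma prob_closed:
  assumes f: "f \<in> cube_faces n 2" 
  shows "prob {\<omega> \<in> space M. X f \<omega> \<in> {2/5<..}} = 3/5"
proof -
  have "{\<omega> \<in> space M. X f \<omega> \<in> {2/5<..}} = space M - {\<omega> \<in> space M. X f \<omega> \<in> {..2/5}}" by auto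
  moreover have "{\<omega> \<in> space M. X f \<omega> \<in> {..2/5}} \<in> events" using measurable_X[OF f] by measurable
  ultimately show ?thesis using prob_open[OF f] by (simp add: prob_compl)
qed

lemma square_in_cube_faces: "a < n \<Longrightarrow> b < n \<Longrightarrow> a \<noteq> b \<Longrightarrow> face n S {a, b} \<in> cube_faces n 2"
  unfolding cube_faces_eq by (intro CollectI exI[of _ S] exI[of _ "{a, b}"]) auto

lemma not_open: "f \<in> cube_faces n 2 \<Longrightarrow> f \<notin> open_squares \<omega> \<longleftrightarrow> X f \<omega> \<notin> {..2/5}"
  by (auto simp: open_squares_def)

text \<open>
  The form with singleton groups: some configuration has all its squares closed.
\<close>
lemma prob_some_set_closed:
  assumes C: "finite C" "card C \<le> K"
    and T: "\<And>c. c \<in> C \<Longrightarrow> T c \<subseteq> cube_faces n 2 \<and> finite (T c) \<and> m \<le> card (T c)" 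
  shows "\<exists>E\<in>events. {\<omega> \<in> space M. \<exists>c\<in>C. T c \<inter> open_squares \<omega> = {}} \<subseteq> E \<and> prob E \<le> K * (3/5) ^ m"
proof -
  let ?E = "{\<omega> \<in> space M. \<exists>c\<in>C. \<forall>t\<in>T c. \<exists>f\<in>{t}. X f \<omega> \<notin> {..2/5}}"
  note * = prob_some_config_fails[OF indep _ prob_open _ _ C, where T = T and G = "\<lambda>_ f. {f}" and m = m and r = 1]
  have "?E \<in> events" using T by (intro *) (auto simp: disjoint_family_on_def)
  moreover have "prob ?E \<le> K * (1 - (2/5) ^ 1) ^ m"
    using T by (intro *) (auto simp: disjoint_family_on_def)
  moreover have "{\<omega> \<in> space M. \<exists>c\<in>C. T c \<inter> open_squares \<omega> = {}} \<subseteq> ?E"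
  proof safe
    fix \<omega> c assume c: "c \<in> C" "T c \<inter> open_squares \<omega> = {}"
    have "X t \<omega> \<notin> {..2/5}" if "t \<in> T c" for t
      using not_open[of t \<omega>] c that T[OF c(1)] by blast
    thus "\<exists>c\<in>C. \<forall>t\<in>T c. \<exists>f\<in>{t}. X f \<omega> \<notin> {..2/5}" using c(1) by blast
  qed
  ultimately show ?thesis by (intro bexI[of _ ?E]) auto
qed

text \<open>
  A configuration consists of the two edges and the sets \<open>B\<close>, \<open>B'\<close> of at most \<open>2 * s\<close> directions of the squares
  at them that may be open.  All other squares at the two edges are closed.  Two
  different edges share at most one square, which accounts for the \<open>- 1\<close> in the exponent.
\<close>
lemma prob_not_light_edges_sparse:
  "\<exists>E\<in>events. {\<omega> \<in> space M. \<not> light_edges_sparse n s (open_squares \<omega>)} \<subseteq> E \<and> 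
     prob E \<le> real (2 ^ n * (n + 1) ^ (6 + 4 * s)) * (3/5) ^ (2 * (n - (2 * s + 1)) - 1)"
proof -
  let ?S = "\<lambda>S D. (S - D) \<union> (D - S)"
  define sm where "sm k = {B. B \<subseteq> {..<n} \<and> card B \<le> k}" for k
  \<comment> \<open>The second edge starts at the symmetric difference of \<open>S\<close> and \<open>D\<close>.\<close>
  define C where "C = {(S, D, a, a', B, B') \<in> Pow {..<n} \<times> sm 4 \<times> {..<n} \<times> {..<n} \<times> sm (2 * s) \<times> sm (2 * s).
     \<not> (a' = a \<and> (?S S D = S \<or> ?S S D = flip a S))}"
  define T1 where "T1 = (\<lambda>S a B. (\<lambda>i. face n S {a, i}) ` ({..<n} - insert a B))"
  define T where "T = (\<lambda>(S, D, a, a', B, B'). T1 S a B \<union> T1 (?S S D) a' B')"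
  have sm: "finite (sm k)" "card (sm k) \<le> (n + 1) ^ k" for k 
    unfolding sm_def by (rule card_small_subsets)+
  have CP: "C \<subseteq> Pow {..<n} \<times> sm 4 \<times> {..<n} \<times> {..<n} \<times> sm (2 * s) \<times> sm (2 * s)" (is "_ \<subseteq> ?P")
    by (auto simp: C_def)
  have finP: "finite ?P" using sm by (intro finite_cartesian_product) auto
  have finC: "finite C" using CP finP by (rule finite_subset)
  have "card C \<le> card ?P" using CP finP by (intro card_mono)
  also have "card ?P = 2 ^ n * (card (sm 4) * (n * (n * (card (sm (2 * s)) * card (sm (2 * s))))))"
    by (simp add: card_cartesian_product card_Pow)
  also have "\<dots> \<le> 2 ^ n * ((n + 1) ^ 4 * ((n + 1) * ((n + 1) * ((n + 1) ^ (2 * s) * (n + 1) ^ (2 * s)))))"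
    by (intro mult_le_mono le_refl sm(2)) simp_all
  also have "\<dots> = 2 ^ n * (n + 1) ^ (6 + 4 * s)"
    by (simp add: power_add[symmetric] power_Suc[symmetric] del: power_Suc)
  finally have cardC: "card C \<le> 2 ^ n * (n + 1) ^ (6 + 4 * s)" .
  have T1: "T1 S a B \<subseteq> cube_faces n 2" "finite (T1 S a B)" "n - (2 * s + 1) \<le> card (T1 S a B)"
    if "a < n" "B \<in> sm (2 * s)" for S a B
  proof -
    show "T1 S a B \<subseteq> cube_faces n 2" using that by (auto simp: T1_def intro!: square_in_cube_faces)
    show "finite (T1 S a B)" by (simp add: T1_def)
    have fB: "finite B" "card B \<le> 2 * s" using that by (auto simp: sm_def intro: finite_subset)
    have "inj_on (\<lambda>i. face n S {a, i}) ({..<n} - insert a B)"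
      using that by (intro inj_onI) (auto simp: face_eq_iff doubleton_eq_iff)
    hence "card {..<n} - card (insert a B) \<le> card (T1 S a B)"
      unfolding T1_def using fB by (intro card_image_Diff_ge) auto
    moreover have "card (insert a B) \<le> 2 * s + 1" using fB by (simp add: card_insert_if)
    ultimately show "n - (2 * s + 1) \<le> card (T1 S a B)" by simp
  qed
  have T: "T c \<subseteq> cube_faces n 2 \<and> finite (T c) \<and> 2 * (n - (2 * s + 1)) - 1 \<le> card (T c)" if c: "c \<in> C" for c
  proof -
    obtain S D a a' B B' where c': "c = (S, D, a, a', B, B')" by (cases c)
    define S' where "S' = ?S S D"
    have h: "a < n" "a' < n" "B \<in> sm (2 * s)" "B' \<in> sm (2 * s)" "S \<subseteq> {..<n}" "S' \<subseteq> {..<n}"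
        "\<not> (a' = a \<and> (S' = S \<or> S' = flip a S))"
      using c unfolding c' C_def S'_def sm_def by auto
    have Tc: "T c = T1 S a B \<union> T1 S' a' B'" by (simp add: c' T_def S'_def)
    have uniq: "f = g" if fg: "f \<in> T1 S a B \<inter> T1 S' a' B'" "g \<in> T1 S a B \<inter> T1 S' a' B'" for f g
    proof -
      obtain i i' j j' where ij: "f = face n S {a, i}" "f = face n S' {a', i'}" "i < n" "i' < n" "i \<noteq> a" "i' \<noteq> a'"
        "g = face n S {a, j}" "g = face n S' {a', j'}" "j < n" "j' < n" "j \<noteq> a" "j' \<noteq> a'"
        using fg unfolding T1_def by blast
      have eqs: "{a, i} = {a', i'}" "\<forall>k<n. k \<notin> {a', i'} \<longrightarrow> (k \<in> S \<longleftrightarrow> k \<in> S')"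
          "{a, j} = {a', j'}" "\<forall>k<n. k \<notin> {a', j'} \<longrightarrow> (k \<in> S \<longleftrightarrow> k \<in> S')"
        using ij h(1,2) face_eq_iff[of "{a, i}" n "{a', i'}" S S'] face_eq_iff[of "{a, j}" n "{a', j'}" S S'] by auto
      show "f = g"
      proof (cases "i = j")
        case False
        hence aa: "a' = a" "i' = i" "j' = j" using eqs(1,3) ij by (auto simp: doubleton_eq_iff)
        have off: "k \<in> S \<longleftrightarrow> k \<in> S'" if "k \<noteq> a" for k
          using eqs(2,4) aa that False h(5,6) by (cases "k < n"; cases "k = i") auto
        have "S' = S \<or> S' = flip a S"
        proof (cases "a \<in> S \<longleftrightarrow> a \<in> S'")
          case True
          hence "k \<in> S' \<longleftrightarrow> k \<in> S" for k using off[of k] by (cases "k = a") auto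
          thus ?thesis by blast
        next
          case False
          hence "k \<in> S' \<longleftrightarrow> k \<in> flip a S" for k using off[of k] by (cases "k = a") (auto simp: in_flip_iff)
          thus ?thesis by blast
        qed
        with aa h(7) show ?thesis by simp
      qed (simp add: ij)
    qed
    from card_Un_almost_disjoint[OF T1(2)[OF h(1,3)] T1(2)[OF h(2,4)] T1(3)[OF h(1,3)] T1(3)[OF h(2,4)] uniq]
    have "2 * (n - (2 * s + 1)) - 1 \<le> card (T1 S a B \<union> T1 S' a' B')" .
    thus ?thesis unfolding Tc using T1(1,2)[OF h(1,3)] T1(1,2)[OF h(2,4)]
      by (intro conjI Un_least finite_UnI)
  qed
  have "\<exists>c\<in>C. T c \<inter> open_squares \<omega> = {}" if not_sparse: "\<not> light_edges_sparse n s (open_squares \<omega>)" for \<omega>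
  proof -
    obtain S S' a a' where l: "S \<subseteq> {..<n}" "S' \<subseteq> {..<n}" "a < n" "a' < n" 
      "light n s (open_squares \<omega>) S a" "light n s (open_squares \<omega>) S' a'" 
      "card ((S - S') \<union> (S' - S)) \<le> 4" "\<not> (a' = a \<and> (S' = S \<or> S' = flip a S))"
      using not_sparse unfolding light_edges_sparse_def not_all not_imp by (elim exE conjE) (rule that)
    define D where "D = (S - S') \<union> (S' - S)"
    have SD: "?S S D = S'" unfolding D_def by blast
    have "D \<in> sm 4" using l by (auto simp: sm_def D_def)
    moreover have "nbrs n (open_squares \<omega>) S a \<in> sm (2 * s)" "nbrs n (open_squares \<omega>) S' a' \<in> sm (2 * s)"
      using l(5,6) by (auto simp: sm_def light_def) (auto simp: nbrs_def)
    ultimately have "(S, D, a, a', nbrs n (open_squares \<omega>) S a, nbrs n (open_squares \<omega>) S' a') \<in> C"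
      using l unfolding C_def by (simp add: SD)
    moreover have "T (S, D, a, a', nbrs n (open_squares \<omega>) S a, nbrs n (open_squares \<omega>) S' a') \<inter> open_squares \<omega> = {}"
      unfolding T_def by (auto simp: SD T1_def nbrs_def)
    ultimately show ?thesis by blast
  qed
  hence sub: "{\<omega> \<in> space M. \<not> light_edges_sparse n s (open_squares \<omega>)} \<subseteq> {\<omega> \<in> space M. \<exists>c\<in>C. T c \<inter> open_squares \<omega> = {}}"
    by (intro Collect_mono conj_mono impI)
  have "\<exists>E\<in>events. {\<omega> \<in> space M. \<exists>c\<in>C. T c \<inter> open_squares \<omega> = {}} \<subseteq> E \<and>
     prob E \<le> real (2 ^ n * (n + 1) ^ (6 + 4 * s)) * (3/5) ^ (2 * (n - (2 * s + 1)) - 1)"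
    by (rule prob_some_set_closed[OF finC cardC]) (rule T)
  thus ?thesis
  proof (elim bexE conjE)
    fix E assume "E \<in> events" "{\<omega> \<in> space M. \<exists>c\<in>C. T c \<inter> open_squares \<omega> = {}} \<subseteq> E"
      "prob E \<le> real (2 ^ n * (n + 1) ^ (6 + 4 * s)) * (3/5) ^ (2 * (n - (2 * s + 1)) - 1)"
    thus ?thesis using sub by (intro bexI[of _ E] conjI order.trans[OF sub])
  qed
qed

text \<open>
  Again almost all of \<open>2 * n\<close> squares are closed: the translates in two steps, first by \<open>i\<close> or by \<open>i'\<close>.  The
  only square that is counted twice is the translate by both \<open>i\<close> and \<open>i'\<close>.
\<close>
lemma prob_not_translates_open:
  "\<exists>E\<in>events. {\<omega> \<in> space M. \<not> translates_open n s (open_squares \<omega>)} \<subseteq> E \<and> 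
     prob E \<le> real (2 ^ n * (n + 1) ^ (8 + 8 * s)) * (3/5) ^ (2 * (n - (4 * s + 5)) - 1)"
proof -
  define sm where "sm k = {B. B \<subseteq> {..<n} \<and> card B \<le> k}" for k
  define C where "C = {(S, a, b, i, i', J, J') \<in> Pow {..<n} \<times> {..<n} \<times> {..<n} \<times> {..<n} \<times> {..<n} \<times> sm (4 * s + 2) \<times> sm (4 * s + 2).
     distinct [a, b, i, i']}"
  define T1 where "T1 = (\<lambda>S a b i J. (\<lambda>j. face n (flip j (flip i S)) {a, b}) ` ({..<n} - (J \<union> {a, b, i})))"
  define T where "T = (\<lambda>(S, a, b, i, i', J, J'). T1 S a b i J \<union> T1 S a b i' J')"
  have sm: "finite (sm k)" "card (sm k) \<le> (n + 1) ^ k" for k 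
    unfolding sm_def by (rule card_small_subsets)+
  have CP: "C \<subseteq> Pow {..<n} \<times> {..<n} \<times> {..<n} \<times> {..<n} \<times> {..<n} \<times> sm (4 * s + 2) \<times> sm (4 * s + 2)" (is "_ \<subseteq> ?P")
    by (auto simp: C_def)
  have finP: "finite ?P" using sm by (intro finite_cartesian_product) auto
  have finC: "finite C" using CP finP by (rule finite_subset)
  have "card C \<le> card ?P" using CP finP by (intro card_mono)
  also have "card ?P = 2 ^ n * (n * (n * (n * (n * (card (sm (4 * s + 2)) * card (sm (4 * s + 2)))))))"
    by (simp add: card_cartesian_product card_Pow)
  also have "\<dots> \<le> 2 ^ n * ((n + 1) * ((n + 1) * ((n + 1) * ((n + 1) * ((n + 1) ^ (4 * s + 2) * (n + 1) ^ (4 * s + 2))))))"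
    by (intro mult_le_mono le_refl sm(2)) simp_all
  also have "\<dots> = 2 ^ n * (n + 1) ^ (1 + 1 + 1 + 1 + (4 * s + 2) + (4 * s + 2))"
    by (simp only: power_add power_one_right mult.assoc)
  also have "1 + 1 + 1 + 1 + (4 * s + 2) + (4 * s + 2) = 8 + 8 * s" by simp
  finally have cardC: "card C \<le> 2 ^ n * (n + 1) ^ (8 + 8 * s)" .
  have T1: "T1 S a b i J \<subseteq> cube_faces n 2" "finite (T1 S a b i J)" "n - (4 * s + 5) \<le> card (T1 S a b i J)"
    if "a < n" "b < n" "a \<noteq> b" "J \<in> sm (4 * s + 2)" for S a b i J
  proof -
    show "T1 S a b i J \<subseteq> cube_faces n 2" using that by (auto simp: T1_def intro!: square_in_cube_faces)
    show "finite (T1 S a b i J)" by (simp add: T1_def)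
    have fJ: "finite J" "card J \<le> 4 * s + 2" using that by (auto simp: sm_def intro: finite_subset)
    have "inj_on (\<lambda>j. face n (flip j (flip i S)) {a, b}) ({..<n} - (J \<union> {a, b, i}))"
    proof (rule inj_onI)
      fix j j' assume j: "j \<in> {..<n} - (J \<union> {a, b, i})" "j' \<in> {..<n} - (J \<union> {a, b, i})"
        "face n (flip j (flip i S)) {a, b} = face n (flip j' (flip i S)) {a, b}"
      hence "j \<in> flip j (flip i S) \<longleftrightarrow> j \<in> flip j' (flip i S)"
        using that by (auto simp: face_eq_iff)
      thus "j = j'" by (auto simp: in_flip_iff)
    qed
    hence "card {..<n} - card (J \<union> {a, b, i}) \<le> card (T1 S a b i J)"
      unfolding T1_def using fJ by (intro card_image_Diff_ge) auto
    moreover have "card (J \<union> {a, b, i}) \<le> card J + card {a, b, i}" by (rule card_Un_le)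
    moreover have "card {a, b, i} \<le> 3" by (simp add: card_insert_if)
    ultimately show "n - (4 * s + 5) \<le> card (T1 S a b i J)" using fJ by simp
  qed
  have T: "T c \<subseteq> cube_faces n 2 \<and> finite (T c) \<and> 2 * (n - (4 * s + 5)) - 1 \<le> card (T c)" if c: "c \<in> C" for c
  proof -
    obtain S a b i i' J J' where c': "c = (S, a, b, i, i', J, J')" by (cases c)
    have h: "a < n" "b < n" "i < n" "i' < n" "J \<in> sm (4 * s + 2)" "J' \<in> sm (4 * s + 2)" 
        "a \<noteq> b" "i \<noteq> i'" "i \<notin> {a, b}" "i' \<notin> {a, b}"
      using c unfolding c' C_def by auto
    have Tc: "T c = T1 S a b i J \<union> T1 S a b i' J'" by (simp add: c' T_def)
    have only: "f = face n (flip i' (flip i S)) {a, b}" if f: "f \<in> T1 S a b i J \<inter> T1 S a b i' J'" for f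
    proof -
      obtain j j' where j: "f = face n (flip j (flip i S)) {a, b}" "f = face n (flip j' (flip i' S)) {a, b}" 
         "j < n" "j \<notin> {a, b, i}" "j' < n" "j' \<notin> {a, b, i'}"
        using f unfolding T1_def by blast
      hence "\<forall>k<n. k \<notin> {a, b} \<longrightarrow> (k \<in> flip j (flip i S) \<longleftrightarrow> k \<in> flip j' (flip i' S))"
        using h(1,2) face_eq_iff[of "{a, b}" n "{a, b}" "flip j (flip i S)" "flip j' (flip i' S)"] by auto
      hence "i' \<in> flip j (flip i S) \<longleftrightarrow> i' \<in> flip j' (flip i' S)" using h by blast
      hence "j = i'" using j h by (auto simp: in_flip_iff)
      thus ?thesis using j by simp
    qed
    have "f = g" if "f \<in> T1 S a b i J \<inter> T1 S a b i' J'" "g \<in> T1 S a b i J \<inter> T1 S a b i' J'" for f g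
      using only[OF that(1)] only[OF that(2)] by simp
    from card_Un_almost_disjoint[OF T1(2)[OF h(1,2,7,5)] T1(2)[OF h(1,2,7,6)] T1(3)[OF h(1,2,7,5)] T1(3)[OF h(1,2,7,6)] this]
    have "2 * (n - (4 * s + 5)) - 1 \<le> card (T1 S a b i J \<union> T1 S a b i' J')" .
    thus ?thesis unfolding Tc using T1(1,2)[OF h(1,2,7,5)] T1(1,2)[OF h(1,2,7,6)]
      by (intro conjI Un_least finite_UnI)
  qed
  have "\<exists>c\<in>C. T c \<inter> open_squares \<omega> = {}" if not_translates: "\<not> translates_open n s (open_squares \<omega>)" for \<omega>
  proof -
    obtain S a b i i' J J' where l: "S \<subseteq> {..<n}" "a < n" "b < n" "i < n" "i' < n" "J \<subseteq> {..<n}" "J' \<subseteq> {..<n}"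
      "distinct [a, b, i, i']" "card J \<le> 4 * s + 2" "card J' \<le> 4 * s + 2"
      "\<not> (\<exists>j<n. j \<notin> J \<union> {a, b, i} \<and> face n (flip j (flip i S)) {a, b} \<in> open_squares \<omega>)"
      "\<not> (\<exists>j<n. j \<notin> J' \<union> {a, b, i'} \<and> face n (flip j (flip i' S)) {a, b} \<in> open_squares \<omega>)"
      using not_translates unfolding translates_open_def not_all not_imp de_Morgan_disj by (elim exE conjE) (rule that)
    have "(S, a, b, i, i', J, J') \<in> C" using l unfolding C_def by (simp add: sm_def)
    moreover have "T (S, a, b, i, i', J, J') \<inter> open_squares \<omega> = {}"
      unfolding T_def T1_def using l(11,12) by auto
    ultimately show ?thesis by blast
  qed
  hence sub: "{\<omega> \<in> space M. \<not> translates_open n s (open_squares \<omega>)} \<subseteq> {\<omega> \<in> space M. \<exists>c\<in>C. T c \<inter> open_squares \<omega> = {}}"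
    by (intro Collect_mono conj_mono impI)
  have "\<exists>E\<in>events. {\<omega> \<in> space M. \<exists>c\<in>C. T c \<inter> open_squares \<omega> = {}} \<subseteq> E \<and>
     prob E \<le> real (2 ^ n * (n + 1) ^ (8 + 8 * s)) * (3/5) ^ (2 * (n - (4 * s + 5)) - 1)"
    by (rule prob_some_set_closed[OF finC cardC]) (rule T)
  thus ?thesis
  proof (elim bexE conjE)
    fix E assume "E \<in> events" "{\<omega> \<in> space M. \<exists>c\<in>C. T c \<inter> open_squares \<omega> = {}} \<subseteq> E"
      "prob E \<le> real (2 ^ n * (n + 1) ^ (8 + 8 * s)) * (3/5) ^ (2 * (n - (4 * s + 5)) - 1)"
    thus ?thesis using sub by (intro bexI[of _ E] conjI order.trans[OF sub])
  qed
qed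

text \<open>
  As \<open>I\<close> and \<open>D\<close> are disjoint, the \<open>s * s\<close> groups of four squares are disjoint.  So the failure
  probability is exponentially small in \<open>s * s\<close>, which beats the number of configurations.
\<close>
lemma prob_not_grids_have_open_box:
  "\<exists>E\<in>events. {\<omega> \<in> space M. \<not> grids_have_open_box n s (open_squares \<omega>)} \<subseteq> E \<and> 
     prob E \<le> real (2 ^ n * (n + 1) ^ (2 * s + 1)) * (1 - (2/5) ^ 4) ^ (s * s)"
proof -
  define sm where "sm k = {B. B \<subseteq> {..<n} \<and> card B \<le> k}" for k
  define C where "C = {(S, a, I, D) \<in> Pow {..<n} \<times> {..<n} \<times> sm s \<times> sm s.
     a \<notin> I \<and> a \<notin> D \<and> I \<inter> D = {} \<and> card I = s \<and> card D = s}"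
  define G where "G = (\<lambda>(S::nat set, a, I::nat set, D::nat set) (i, j). {face n (flip j S) {a, i}, face n (flip i S) {a, j},
        face n S {i, j}, face n (flip a S) {i, j}})"
  define T where "T = (\<lambda>(S::nat set, a::nat, I::nat set, D::nat set). I \<times> D)"
  have sm: "finite (sm k)" "card (sm k) \<le> (n + 1) ^ k" for k 
    unfolding sm_def by (rule card_small_subsets)+
  have CP: "C \<subseteq> Pow {..<n} \<times> {..<n} \<times> sm s \<times> sm s" (is "_ \<subseteq> ?P")
    by (auto simp: C_def)
  have finP: "finite ?P" using sm by (intro finite_cartesian_product) auto
  have finC: "finite C" using CP finP by (rule finite_subset)
  have "card C \<le> card ?P" using CP finP by (intro card_mono)
  also have "card ?P = 2 ^ n * (n * (card (sm s) * card (sm s)))"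
    by (simp add: card_cartesian_product card_Pow)
  also have "\<dots> \<le> 2 ^ n * ((n + 1) * ((n + 1) ^ s * (n + 1) ^ s))"
    by (intro mult_le_mono le_refl sm(2)) simp_all
  also have "\<dots> = 2 ^ n * (n + 1) ^ (2 * s + 1)"
    by (simp add: power_add[symmetric] power_Suc[symmetric] mult_2 del: power_Suc)
  finally have cardC: "card C \<le> 2 ^ n * (n + 1) ^ (2 * s + 1)" .
  have T: "finite (T c) \<and> s * s \<le> card (T c)" if "c \<in> C" for c
    using that by (auto simp: C_def T_def sm_def card_cartesian_product intro: finite_subset)
  have G: "G c t \<subseteq> cube_faces n 2 \<and> finite (G c t) \<and> card (G c t) \<le> 4" if "c \<in> C" "t \<in> T c" for c t
  proof -
    obtain S a I D i j where c: "c = (S, a, I, D)" "t = (i, j)" by (cases c; cases t)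
    have h: "i < n" "j < n" "a < n" "i \<noteq> j" "a \<noteq> i" "a \<noteq> j"
      using that unfolding c by (auto simp: C_def T_def sm_def)
    show ?thesis unfolding c G_def using h by (auto simp: card_insert_if intro!: square_in_cube_faces)
  qed
  have disj: "disjoint_family_on (G c) (T c)" if "c \<in> C" for c
    unfolding disjoint_family_on_def
  proof (intro ballI impI)
    fix t t' assume t: "t \<in> T c" "t' \<in> T c" "t \<noteq> t'"
    obtain S a I D i j i' j' where c: "c = (S, a, I, D)" "t = (i, j)" "t' = (i', j')" by (cases c; cases t; cases t')
    have h: "i < n" "j < n" "i' < n" "j' < n" "a < n" "a \<noteq> i" "a \<noteq> j" "a \<noteq> i'" "a \<noteq> j'" 
         "i \<noteq> j" "i' \<noteq> j" "i \<noteq> j'" "i' \<noteq> j'" "i \<noteq> i' \<or> j \<noteq> j'"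
      using that t unfolding c by (auto simp: C_def T_def sm_def)
    have ne: "face n R {x, y} \<noteq> face n R' {x', y'}" if "{x, y} \<noteq> {x', y'}" "x < n" "y < n" "x' < n" "y' < n" 
      for R R' x x' y y'
      using that face_eq_iff[of "{x, y}" n "{x', y'}" R R'] by auto
    have ne2: "face n (flip j S) {a, i} \<noteq> face n (flip j' S) {a, i'}" if "i = i'"
    proof
      assume "face n (flip j S) {a, i} = face n (flip j' S) {a, i'}"
      hence "j \<in> flip j S \<longleftrightarrow> j \<in> flip j' S" using that h face_eq_iff[of "{a, i}" n "{a, i'}" "flip j S" "flip j' S"] by auto
      thus False using that h by (auto simp: in_flip_iff)
    qed
    have ne3: "face n (flip i S) {a, j} \<noteq> face n (flip i' S) {a, j'}" if "j = j'"
    proof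
      assume "face n (flip i S) {a, j} = face n (flip i' S) {a, j'}"
      hence "i \<in> flip i S \<longleftrightarrow> i \<in> flip i' S" using that h face_eq_iff[of "{a, j}" n "{a, j'}" "flip i S" "flip i' S"] by auto
      thus False using that h by (auto simp: in_flip_iff)
    qed
    have dbl: "{a, i} \<noteq> {a, j'}" "{a, j} \<noteq> {a, i'}" "{a, i} \<noteq> {i', j'}" "{a, j} \<noteq> {i', j'}" 
       "{i, j} \<noteq> {a, i'}" "{i, j} \<noteq> {a, j'}" "{i, j} \<noteq> {i', j'}" 
       "i \<noteq> i' \<Longrightarrow> {a, i} \<noteq> {a, i'}" "j \<noteq> j' \<Longrightarrow> {a, j} \<noteq> {a, j'}"
      using h by (auto simp: doubleton_eq_iff)
    have n1: "face n (flip j S) {a, i} \<noteq> face n (flip j' S) {a, i'}"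
      using ne2 ne[OF dbl(8)] h by (cases "i = i'") auto
    have n2: "face n (flip i S) {a, j} \<noteq> face n (flip i' S) {a, j'}"
      using ne3 ne[OF dbl(9)] h by (cases "j = j'") auto
    show "G c t \<inter> G c t' = {}"
      unfolding c G_def using n1 n2 ne[OF dbl(1)] ne[OF dbl(2)] ne[OF dbl(3)] ne[OF dbl(4)] ne[OF dbl(5)]
        ne[OF dbl(6)] ne[OF dbl(7)] h by simp
  qed
  let ?E = "{\<omega> \<in> space M. \<exists>c\<in>C. \<forall>t\<in>T c. \<exists>f\<in>G c t. X f \<omega> \<notin> {..2/5}}"
  have E: "?E \<in> events" "prob ?E \<le> real (2 ^ n * (n + 1) ^ (2 * s + 1)) * (1 - (2/5) ^ 4) ^ (s * s)"
    by (rule prob_some_config_fails[OF indep _ prob_open _ _ finC cardC]; (rule T G disj)?; simp)+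
  have "\<omega> \<in> ?E" if not_grid: "\<omega> \<in> space M" "\<not> grids_have_open_box n s (open_squares \<omega>)" for \<omega>
  proof -
    obtain S a I D where l: "S \<subseteq> {..<n}" "a < n" "I \<subseteq> {..<n} - {a}" "D \<subseteq> {..<n} - {a}" "I \<inter> D = {}" 
      "card I = s" "card D = s" "\<not> (\<exists>i\<in>I. \<exists>j\<in>D. {face n (flip j S) {a, i}, face n (flip i S) {a, j},
        face n S {i, j}, face n (flip a S) {i, j}} \<subseteq> open_squares \<omega>)"
      using not_grid(2) unfolding grids_have_open_box_def not_all not_imp by (elim exE conjE) (rule that)
    have none: "\<not> {face n (flip j S) {a, i}, face n (flip i S) {a, j}, face n S {i, j}, face n (flip a S) {i, j}}
       \<subseteq> open_squares \<omega>" if "i \<in> I" "j \<in> D" for i j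
      using l(8) that by blast
    have cC: "(S, a, I, D) \<in> C" using l by (auto simp: C_def sm_def)
    have "\<exists>f\<in>G (S, a, I, D) t. X f \<omega> \<notin> {..2/5}" if t: "t \<in> T (S, a, I, D)" for t
    proof -
      obtain i j where ij: "t = (i, j)" "i \<in> I" "j \<in> D" using t by (auto simp: T_def)
      have "\<not> G (S, a, I, D) t \<subseteq> open_squares \<omega>" using none[OF ij(2,3)] by (simp add: G_def ij(1))
      then obtain f where "f \<in> G (S, a, I, D) t" "f \<notin> open_squares \<omega>" by blast
      thus ?thesis using G[OF cC t] not_open[of f \<omega>] by blast
    qed
    thus ?thesis using cC not_grid(1) by blast
  qed
  hence "{\<omega> \<in> space M. \<not> grids_have_open_box n s (open_squares \<omega>)} \<subseteq> ?E" by blast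
  with E show ?thesis by (intro bexI[of _ ?E] conjI)
qed

text \<open>
  The edges in direction 0 at vertices of even weight have no squares in common, because two parallel
  edges in a square start at vertices of different parity.  So they are isolated independently of each other.
\<close>
lemma prob_no_isolated_edge:
  assumes "2 \<le> n"
  shows "\<exists>E\<in>events. {\<omega> \<in> space M. \<forall>S\<subseteq>{..<n}. \<forall>a<n. nbrs n (open_squares \<omega>) S a \<noteq> {}} \<subseteq> E \<and> 
     prob E \<le> (1 - (3/5) ^ (n - 1)) ^ (2 ^ (n - 2))"
proof -
  \<comment> \<open>Direction 1 serves as a parity bit: it makes \<open>R\<close> even, and it shows that there are \<open>2 ^ (n - 2)\<close> such edges.\<close>
  define ev where "ev R = (if even (card R) then R else insert 1 R)" for R :: "nat set"
  define T where "T = ev ` Pow {2..<n}"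
  define G where "G S = (\<lambda>i. face n S {0, i}) ` {1..<n}" for S
  have inj: "inj_on ev (Pow {2..<n})"
  proof (rule inj_onI)
    fix R R' assume R: "R \<in> Pow {2..<n}" "R' \<in> Pow {2..<n}" "ev R = ev R'"
    have "ev R - {1} = R" if "R \<in> Pow {2..<n}" for R
      using that by (cases "even (card R)") (auto simp: ev_def)
    from this[OF R(1)] this[OF R(2)] R(3) show "R = R'" by simp
  qed
  have cardT: "card T = 2 ^ (n - 2)" "finite T"
    unfolding T_def card_image[OF inj] by (simp_all add: card_Pow)
  have T: "S \<subseteq> {1..<n} \<and> even (card S)" if "S \<in> T" for S
  proof -
    from that[unfolded T_def] obtain R where R: "R \<subseteq> {2..<n}" "S = ev R"
      by (rule imageE) (simp only: Pow_iff)
    have fR: "finite R" by (rule finite_subset[OF R(1)]) simp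
    have R1: "1 \<notin> R" using R(1) by auto
    show ?thesis
    proof (cases "even (card R)")
      case True
      hence "S = R" using R(2) by (simp only: ev_def if_True)
      thus ?thesis using True R(1) by auto
    next
      case False
      hence S: "S = insert 1 R" using R(2) by (simp only: ev_def if_False)
      have "card S = Suc (card R)" unfolding S using fR R1 by (rule card_insert_disjoint)
      moreover have "S \<subseteq> {1..<n}" unfolding S using R(1) assms by auto
      ultimately show ?thesis using False by simp
    qed
  qed
  have G: "G S \<subseteq> cube_faces n 2" "finite (G S)" "card (G S) \<le> n - 1" for S
  proof -
    show "G S \<subseteq> cube_faces n 2" using assms by (auto simp: G_def intro!: square_in_cube_faces)
    show "finite (G S)" by (simp add: G_def)
    show "card (G S) \<le> n - 1" 
      unfolding G_def using card_image_le[of "{1..<n}" "\<lambda>i. face n S {0, i}"] by simp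
  qed
  have disj: "disjoint_family_on G T"
    unfolding disjoint_family_on_def
  proof (intro ballI impI)
    fix S S' assume S: "S \<in> T" "S' \<in> T" "S \<noteq> S'"
    show "G S \<inter> G S' = {}"
    proof (rule ccontr)
      assume "G S \<inter> G S' \<noteq> {}"
      then obtain f where "f \<in> G S" "f \<in> G S'" by blast
      then obtain i i' where i: "face n S {0, i} = face n S' {0, i'}" "1 \<le> i" "i < n" "1 \<le> i'" "i' < n"
        unfolding G_def by (elim imageE) (simp add: that)
      hence eq: "{0, i} = {0, i'}" "\<forall>k<n. k \<notin> {0, i'} \<longrightarrow> (k \<in> S \<longleftrightarrow> k \<in> S')"
        using face_eq_iff[of "{0, i}" n "{0, i'}" S S'] by auto
      have "i = i'" using eq(1) i by (auto simp: doubleton_eq_iff)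
      have off: "k \<in> S \<longleftrightarrow> k \<in> S'" if "k \<noteq> i" for k
        using that eq(2) T[OF S(1)] T[OF S(2)] \<open>i = i'\<close> by (cases "k < n"; cases "k = 0") auto
      have fin: "finite S" "finite S'" 
        using finite_subset[of _ "{1..<n}"] T[OF S(1)] T[OF S(2)] by auto
      have "(i \<in> S) \<noteq> (i \<in> S')"
      proof
        assume "(i \<in> S) = (i \<in> S')"
        hence "k \<in> S \<longleftrightarrow> k \<in> S'" for k using off[of k] by (cases "k = i") auto
        hence "S = S'" by blast
        with S(3) show False by simp
      qed
      then consider "i \<in> S" "i \<notin> S'" | "i \<notin> S" "i \<in> S'" by blast
      hence "card S = card S' + 1 \<or> card S' = card S + 1"
      proof cases
        case 1
        hence "k \<in> S \<longleftrightarrow> k \<in> insert i S'" for k using off[of k] by (cases "k = i") auto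
        hence "S = insert i S'" by blast
        thus ?thesis using fin 1 by simp
      next
        case 2
        hence "k \<in> S' \<longleftrightarrow> k \<in> insert i S" for k using off[of k] by (cases "k = i") auto
        hence "S' = insert i S" by blast
        thus ?thesis using fin 2 by simp
      qed
      thus False using T[OF S(1)] T[OF S(2)] by auto
    qed
  qed
  let ?E = "{\<omega> \<in> space M. \<forall>S\<in>T. \<exists>f\<in>G S. X f \<omega> \<notin> {2/5<..}}"
  have "?E \<in> events"
    by (rule prob_all_groups_fail(1)[where r = "n - 1" and q = "3/5", OF indep cardT(2) G(1) disj _ _ prob_closed])
       (simp_all only: G, simp_all)
  moreover have "prob ?E \<le> (1 - (3/5) ^ (n - 1)) ^ card T"
    by (rule prob_all_groups_fail(2)[where r = "n - 1" and q = "3/5", OF indep cardT(2) G(1) disj _ _ prob_closed])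
       (simp_all only: G, simp_all)
  moreover have "{\<omega> \<in> space M. \<forall>S\<subseteq>{..<n}. \<forall>a<n. nbrs n (open_squares \<omega>) S a \<noteq> {}} \<subseteq> ?E"
  proof safe
    fix \<omega> S assume h: "\<forall>S\<subseteq>{..<n}. \<forall>a<n. nbrs n (open_squares \<omega>) S a \<noteq> {}" "S \<in> T"
    have "S \<subseteq> {..<n}" "0 < n" using T[OF h(2)] assms by auto
    then obtain i where "i \<in> nbrs n (open_squares \<omega>) S 0" using h(1) by blast
    hence "face n S {0, i} \<in> G S" "face n S {0, i} \<in> open_squares \<omega>" by (auto simp: nbrs_def G_def)
    thus "\<exists>f\<in>G S. X f \<omega> \<notin> {2/5<..}" by (intro bexI[of _ "face n S {0, i}"]) (auto simp: open_squares_def)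
  qed
  ultimately show ?thesis unfolding cardT(1) by (intro bexI[of _ ?E] conjI)
qed

end

section \<open>Comparison of the hitting times\<close>

lemma cube_complex_Q: "\<Union>(Q n u p) = cube_complex n {f \<in> cube_faces n 2. u f \<le> p}"
  unfolding Q_def cube_complex_def by (rule arg_cong[where f = Union]) auto

lemma face_restrict: "face n S A = face n (S \<inter> {..<n}) A"
  by (auto simp: in_face_iff)

lemma finite_cube_faces: "finite (cube_faces n k)"
proof -
  have "cube_faces n k \<subseteq> (\<lambda>(S, A). face n S A) ` (Pow {..<n} \<times> Pow {..<n})"
  proof
    fix f assume "f \<in> cube_faces n k"
    then obtain S A where SA: "f = face n S A" "A \<subseteq> {..<n}" unfolding cube_faces_eq by blast
    show "f \<in> (\<lambda>(S, A). face n S A) ` (Pow {..<n} \<times> Pow {..<n})"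
    proof (rule image_eqI)
      show "f = (case (S \<inter> {..<n}, A) of (S, A) \<Rightarrow> face n S A)" using SA(1) face_restrict[of n S A] by simp
    qed (use SA in simp)
  qed
  thus ?thesis by (rule finite_subset) auto
qed

text \<open>
  The maximal 1-faces are the isolated edges, and a square contains the edge \<open>(S, a)\<close> iff it is
  \<open>face n S {a, i}\<close> for some direction \<open>i \<noteq> a\<close>.
\<close>
lemma N_eq_0_iff:
  "N n u p = 0 \<longleftrightarrow> (\<forall>S\<subseteq>{..<n}. \<forall>a<n. nbrs n {f \<in> cube_faces n 2. u f \<le> p} S a \<noteq> {})" (is "_ \<longleftrightarrow> ?R")
proof -
  let ?W = "{f \<in> cube_faces n 2. u f \<le> p}"
  have rep: "\<exists>S'\<subseteq>{..<n}. face n S A = face n S' A" for S A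
    by (rule exI[of _ "S \<inter> {..<n}"]) (use face_restrict[of n S A] in simp)
  have fin: "finite (maximal_1_faces n (Q n u p))"
    unfolding maximal_1_faces_def by (rule finite_subset[OF _ finite_cube_faces[of n 1]]) auto
  have Q1: "Q n u p \<inter> cube_faces n 1 = cube_faces n 1" by (auto simp: Q_def)
  have cf: "cube_faces n 0 \<inter> cube_faces n 2 = {}" "cube_faces n 1 \<inter> cube_faces n 2 = {}"
    unfolding cube_faces_eq by (auto simp: face_eq_iff)
  hence Q2: "Q n u p \<inter> cube_faces n 2 = ?W" by (auto simp: Q_def)
  have covered: "(\<exists>f\<in>?W. face n S {a} \<subseteq> f) \<longleftrightarrow> nbrs n ?W S a \<noteq> {}" if a: "a < n" for S a
  proof
    assume "\<exists>f\<in>?W. face n S {a} \<subseteq> f"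
    then obtain f where f: "f \<in> ?W" "face n S {a} \<subseteq> f" by blast
    then obtain S' A where SA: "f = face n S' A" "A \<subseteq> {..<n}" "card A = 2" unfolding cube_faces_eq by blast
    have sub: "a \<in> A" "\<forall>i<n. i \<notin> A \<longrightarrow> (i \<in> S \<longleftrightarrow> i \<in> S')"
      using f(2) face_subset_iff[of "{a}" n S S' A] a unfolding SA(1) by auto
    obtain i where i: "A = {a, i}" "i \<noteq> a" using SA(3) sub(1) unfolding card_2_iff by blast
    have "face n S {a, i} = f" unfolding SA(1) i(1) using SA(2) sub(2) i by (subst face_eq_iff) auto
    hence "i \<in> nbrs n ?W S a" using f(1) i SA(2) unfolding nbrs_def by auto
    thus "nbrs n ?W S a \<noteq> {}" by blast
  next
    assume "nbrs n ?W S a \<noteq> {}"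
    then obtain i where i: "i < n" "i \<noteq> a" "face n S {a, i} \<in> ?W" unfolding nbrs_def by blast
    have "face n S {a} \<subseteq> face n S {a, i}" using a by (subst face_subset_iff) auto
    with i show "\<exists>f\<in>?W. face n S {a} \<subseteq> f" by blast
  qed
  have "N n u p = 0 \<longleftrightarrow> maximal_1_faces n (Q n u p) = {}" using fin by (simp add: N_def)
  also have "\<dots> \<longleftrightarrow> (\<forall>e\<in>cube_faces n 1. \<exists>f\<in>?W. e \<subseteq> f)"
    unfolding maximal_1_faces_def Q1 Q2 by blast
  also have "\<dots> \<longleftrightarrow> ?R"
  proof
    assume *: "\<forall>e\<in>cube_faces n 1. \<exists>f\<in>?W. e \<subseteq> f"
    show ?R
    proof (intro allI impI)
      fix S a assume "S \<subseteq> {..<n}" "a < n"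
      hence "face n S {a} \<in> cube_faces n 1" 
        unfolding cube_faces_eq by (intro CollectI exI[of _ S] exI[of _ "{a}"]) auto
      with * show "nbrs n ?W S a \<noteq> {}" using covered[OF \<open>a < n\<close>] by blast
    qed
  next
    assume R: ?R
    show "\<forall>e\<in>cube_faces n 1. \<exists>f\<in>?W. e \<subseteq> f"
    proof
      fix e assume "e \<in> cube_faces n 1"
      then obtain S A where SA: "e = face n S A" "A \<subseteq> {..<n}" "card A = 1" unfolding cube_faces_eq by blast
      then obtain a where a: "A = {a}" "a < n" by (auto simp: card_1_singleton_iff)
      obtain S' where S': "S' \<subseteq> {..<n}" "face n S A = face n S' A" using rep by blast
      have "nbrs n ?W S' a \<noteq> {}" using R S'(1) a(2) by blast
      thus "\<exists>f\<in>?W. e \<subseteq> f" using covered[OF a(2), of S'] SA(1) S'(2) a(1) by simp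
    qed
  qed
  finally show ?thesis .
qed

definition trivial_pi1 :: "nat \<Rightarrow> (nat \<Rightarrow> real) set set \<Rightarrow> bool" where
  "trivial_pi1 n W \<longleftrightarrow> trivial_group (fundamental_group (cube_complex n W) (vert n {}))"

lemma trivial_group_Q_iff: "trivial_group (fundamental_group (\<Union>(Q n u p)) (\<lambda>i\<in>{..<n}. 0)) \<longleftrightarrow> 
   trivial_pi1 n {f \<in> cube_faces n 2. u f \<le> p}"
  unfolding cube_complex_Q trivial_pi1_def vert_def by simp

lemma trivial_pi1_imp_nbrs:
  assumes "2 \<le> n" "trivial_pi1 n W" "S \<subseteq> {..<n}" "a < n"
  shows "nbrs n W S a \<noteq> {}"
proof
  assume none: "nbrs n W S a = {}"
  define b :: nat where "b = (if a = 0 then 1 else 0)"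
  have "b < n" "a \<noteq> b" using assms(1) by (auto simp: b_def)
  moreover have "\<And>i. i < n \<Longrightarrow> i \<noteq> a \<Longrightarrow> face n S {a, i} \<notin> W" using none by (auto simp: nbrs_def)
  ultimately show False using isolated_edge_nontrivial[OF assms(3,4)] assms(2) unfolding trivial_pi1_def by blast
qed

lemma (in typical) trivial_pi1I:
  assumes "\<And>S a. S \<subseteq> {..<n} \<Longrightarrow> a < n \<Longrightarrow> nbrs n W S a \<noteq> {}"
  shows "trivial_pi1 n W"
  unfolding trivial_pi1_def
proof (rule trivial_fundamental_group_if_words)
  fix w assume w: "set w \<subseteq> {..<n}" "fold flip w {} = {}"
  show "weq n W {} w []"
    by (rule closed_word_trivial[OF all_comm[OF assms]]) (use w in auto)
qed

text \<open>
  The two sets of parameters whose infima are compared are equal.  A parameter in either of them has no isolated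
  edge, hence is at least \<open>2/5\<close>, since there is an isolated edge at \<open>2/5\<close>; from there on the complex
  contains \<open>W0\<close>, and the absence of isolated edges suffices.
\<close>
lemma hitting_times_eq:
  fixes n :: nat and u :: "(nat \<Rightarrow> real) set \<Rightarrow> real"
  defines "W0 \<equiv> {f \<in> cube_faces n 2. u f \<le> 2/5}"
  assumes good: "light_edges_sparse n s W0" "grids_have_open_box n s W0" "translates_open n s W0"
    and large: "4 * s + 6 \<le> n" "0 < s"
    and iso: "\<not> (\<forall>S\<subseteq>{..<n}. \<forall>a<n. nbrs n W0 S a \<noteq> {})"
  shows "T_sc n u = T_2d n u"
proof -
  have "trivial_pi1 n {f \<in> cube_faces n 2. u f \<le> p} \<longleftrightarrow> N n u p = 0" for p
  proof
    let ?W = "{f \<in> cube_faces n 2. u f \<le> p}"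
    show "N n u p = 0" if "trivial_pi1 n ?W"
      unfolding N_eq_0_iff using trivial_pi1_imp_nbrs[OF _ that] large by auto
    assume "N n u p = 0"
    hence nb: "\<And>S a. S \<subseteq> {..<n} \<Longrightarrow> a < n \<Longrightarrow> nbrs n ?W S a \<noteq> {}" unfolding N_eq_0_iff by blast
    have "2/5 \<le> p"
    proof (rule ccontr)
      assume "\<not> 2/5 \<le> p"
      hence "?W \<subseteq> W0" by (auto simp: W0_def)
      hence "nbrs n ?W S a \<subseteq> nbrs n W0 S a" for S a unfolding nbrs_def by blast
      with nb iso show False by blast
    qed
    hence "W0 \<subseteq> ?W" by (auto simp: W0_def)
    then interpret typical n s W0 ?W using good large by unfold_locales
    show "trivial_pi1 n ?W" using nb by (rule trivial_pi1I)
  qed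
  thus ?thesis unfolding T_sc_def T_2d_def trivial_group_Q_iff by simp
qed

section \<open>Measurability of hitting times\<close>

text \<open>
  The set of labels below \<open>p\<close> changes only at the labels, so the infimum over an interval reduces to an infimum
  over finitely many candidates.  The value at the empty set is the same on both sides.
\<close>
lemma Inf_threshold:
  fixes u :: "'b \<Rightarrow> real" and P :: "'b set \<Rightarrow> bool"
  assumes F: "finite F"
  defines "B \<equiv> {c \<in> insert 0 (u ` F) \<inter> {0..1}. P {f \<in> F. u f \<le> c}}"
  shows "finite B" "{p \<in> {0..1}. P {f \<in> F. u f \<le> p}} = {} \<longleftrightarrow> B = {}"
    "Inf {p \<in> {0..1}. P {f \<in> F. u f \<le> p}} = Inf B"
proof -
  let ?A = "{p \<in> {0..1}. P {f \<in> F. u f \<le> p}}"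
  show fin: "finite B" using F by (auto simp: B_def)
  have BA: "B \<subseteq> ?A" by (auto simp: B_def)
  have below: "\<exists>c\<in>B. c \<le> p" if p: "p \<in> ?A" for p
  proof -
    let ?C = "insert 0 {u f |f. f \<in> F \<and> 0 \<le> u f \<and> u f \<le> p}"
    have finC: "finite ?C" using F by simp
    \<comment> \<open>The largest candidate below \<open>p\<close> has the same set of labels below it as \<open>p\<close>.\<close>
    define c where "c = Max ?C"
    have c: "c \<in> ?C" unfolding c_def using finC by (intro Max_in) auto
    have cp: "0 \<le> c" "c \<le> p" using c p by auto
    have "u f \<le> c" if "f \<in> F" "u f \<le> p" for f
    proof (cases "0 \<le> u f")
      case True
      hence "u f \<in> ?C" using that by blast
      thus ?thesis unfolding c_def using finC by (rule Max_ge[rotated])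
    qed (use cp in linarith)
    hence "{f \<in> F. u f \<le> c} = {f \<in> F. u f \<le> p}" using cp by force
    moreover have "c \<in> insert 0 (u ` F) \<inter> {0..1}" using c cp p by auto
    ultimately have "c \<in> B" using p unfolding B_def by simp
    with cp show ?thesis by blast
  qed
  show empty: "?A = {} \<longleftrightarrow> B = {}" using BA below by blast
  show "Inf ?A = Inf B"
  proof (cases "B = {}")
    case True
    with empty have "?A = {}" by simp
    thus ?thesis by (simp only: True)
  next
    case False
    have bdd: "bdd_below ?A" by (intro bdd_belowI[of _ 0]) auto
    show ?thesis
    proof (rule antisym)
      show "Inf ?A \<le> Inf B" using False bdd BA by (rule cInf_superset_mono)
      show "Inf B \<le> Inf ?A"
      proof (rule cInf_greatest)
        show "?A \<noteq> {}" using False empty by simp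
        fix p assume "p \<in> ?A"
        then obtain c where "c \<in> B" "c \<le> p" using below by blast
        moreover have "Inf B \<le> c" using \<open>c \<in> B\<close> bdd_below_finite[OF fin] by (rule cInf_lower)
        ultimately show "Inf B \<le> p" by linarith
      qed
    qed
  qed
qed

lemma measurable_level_pred:
  fixes X :: "'b \<Rightarrow> 'a \<Rightarrow> real"
  assumes F: "finite F" and X: "\<And>f. f \<in> F \<Longrightarrow> X f \<in> borel_measurable M" and Y: "Y \<in> borel_measurable M"
  shows "{\<omega> \<in> space M. P {f \<in> F. X f \<omega> \<le> Y \<omega>}} \<in> sets M"
proof -
  have "{\<omega> \<in> space M. P {f \<in> F. X f \<omega> \<le> Y \<omega>}} = 
     (\<Union>V\<in>{V \<in> Pow F. P V}. {\<omega> \<in> space M. \<forall>f\<in>F. f \<in> V \<longleftrightarrow> X f \<omega> \<le> Y \<omega>})" (is "?l = ?r")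
  proof (intro subset_antisym subsetI)
    fix \<omega> assume "\<omega> \<in> ?l"
    thus "\<omega> \<in> ?r" by (intro UN_I[of "{f \<in> F. X f \<omega> \<le> Y \<omega>}"]) auto
  next
    fix \<omega> assume "\<omega> \<in> ?r"
    then obtain V where V: "V \<subseteq> F" "P V" "\<omega> \<in> space M" "\<forall>f\<in>F. f \<in> V \<longleftrightarrow> X f \<omega> \<le> Y \<omega>" by blast
    hence "{f \<in> F. X f \<omega> \<le> Y \<omega>} = V" by blast
    with V show "\<omega> \<in> ?l" by simp
  qed
  moreover have "{\<omega> \<in> space M. \<forall>f\<in>F. f \<in> V \<longleftrightarrow> X f \<omega> \<le> Y \<omega>} \<in> sets M" for V
  proof (intro sets.sets_Collect_finite_All F)
    fix f assume f: "f \<in> F"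
    have "{\<omega> \<in> space M. X f \<omega> \<le> Y \<omega>} \<in> sets M" using X[OF f] Y by measurable
    thus "{\<omega> \<in> space M. f \<in> V \<longleftrightarrow> X f \<omega> \<le> Y \<omega>} \<in> sets M"
      by (cases "f \<in> V") (auto intro: sets.sets_Collect_neg)
  qed
  ultimately show ?thesis using F by auto
qed

text \<open>
  Hitting times of arbitrary properties of the labelled complex are random variables.  This is
  needed because \<open>measure\<close> is 0 on sets that are not measurable.
\<close>
lemma borel_measurable_threshold:
  fixes X :: "'b \<Rightarrow> 'a \<Rightarrow> real"
  assumes F: "finite F" and X: "\<And>f. f \<in> F \<Longrightarrow> X f \<in> borel_measurable M"
  shows "(\<lambda>\<omega>. Inf {p \<in> {0..1}. P {f \<in> F. X f \<omega> \<le> p}}) \<in> borel_measurable M"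
proof (rule borel_measurableI_le)
  fix x :: real
  \<comment> \<open>The candidates of the preceding reduction as random variables: the constant 0 and the labels.\<close>
  define Y where "Y c \<omega> = (case c of None \<Rightarrow> 0 | Some f \<Rightarrow> X f \<omega>)" for c \<omega>
  let ?I = "insert None (Some ` F)"
  define ok where "ok c \<omega> \<longleftrightarrow> (0 \<le> Y c \<omega> \<and> Y c \<omega> \<le> 1) \<and> P {f \<in> F. X f \<omega> \<le> Y c \<omega>}" for c \<omega>
  have Y: "Y c \<in> borel_measurable M" if "c \<in> ?I" for c
    using that X by (auto simp: Y_def[abs_def])
  define B where "B \<omega> = {c \<in> insert 0 ((\<lambda>f. X f \<omega>) ` F) \<inter> {0..1}. P {f \<in> F. X f \<omega> \<le> c}}" for \<omega>
  have B: "B \<omega> = (\<lambda>c. Y c \<omega>) ` {c \<in> ?I. ok c \<omega>}" for \<omega>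
  proof -
    have img: "insert 0 ((\<lambda>f. X f \<omega>) ` F) = (\<lambda>c. Y c \<omega>) ` ?I"
      by (simp add: Y_def image_image)
    have "{y \<in> g ` I \<inter> {0..1}. R y} = g ` {c \<in> I. (0 \<le> g c \<and> g c \<le> 1) \<and> R (g c)}"
      for g :: "'b option \<Rightarrow> real" and I R by auto
    thus ?thesis unfolding B_def img ok_def .
  qed
  have Inf_eq: "Inf {p \<in> {0..1}. P {f \<in> F. X f \<omega> \<le> p}} = Inf (B \<omega>)" for \<omega>
    unfolding B_def by (rule Inf_threshold(3)[OF F])
  have finB: "finite (B \<omega>)" for \<omega> unfolding B_def by (rule Inf_threshold(1)[OF F])
  have "Inf (B \<omega>) \<le> x \<longleftrightarrow> (\<exists>c\<in>?I. ok c \<omega> \<and> Y c \<omega> \<le> x) \<or> ((\<forall>c\<in>?I. \<not> ok c \<omega>) \<and> Inf {} \<le> x)" for \<omega>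
  proof (cases "B \<omega> = {}")
    case True
    hence "\<forall>c\<in>?I. \<not> ok c \<omega>" unfolding B by blast
    thus ?thesis using True by auto
  next
    case False
    hence "Inf (B \<omega>) \<le> x \<longleftrightarrow> (\<exists>b\<in>B \<omega>. b \<le> x)"
      using finB[of \<omega>] by (simp add: cInf_eq_Min Min_le_iff)
    moreover have "\<not> (\<forall>c\<in>?I. \<not> ok c \<omega>)" using False unfolding B by blast
    ultimately show ?thesis unfolding B by blast
  qed
  hence "{\<omega> \<in> space M. Inf {p \<in> {0..1}. P {f \<in> F. X f \<omega> \<le> p}} \<le> x} = 
    {\<omega> \<in> space M. (\<exists>c\<in>?I. ok c \<omega> \<and> Y c \<omega> \<le> x) \<or> ((\<forall>c\<in>?I. \<not> ok c \<omega>) \<and> Inf {} \<le> x)}"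
    by (simp only: Inf_eq)
  also have "\<dots> \<in> sets M"
  proof -
    have ok: "{\<omega> \<in> space M. ok c \<omega>} \<in> sets M" if "c \<in> ?I" for c
      unfolding ok_def using Y[OF that] measurable_level_pred[OF F X Y[OF that]]
      by (intro sets.sets_Collect_conj) (auto intro: borel_measurable_le)
    have le: "{\<omega> \<in> space M. Y c \<omega> \<le> x} \<in> sets M" if "c \<in> ?I" for c
      using Y[OF that] by measurable
    show ?thesis
      using F by (intro sets.sets_Collect_disj sets.sets_Collect_conj sets.sets_Collect_finite_Ex
          sets.sets_Collect_finite_All sets.sets_Collect_neg ok le sets.sets_Collect_const) auto
  qed
  finally show "{\<omega> \<in> space M. Inf {p \<in> {0..1}. P {f \<in> F. X f \<omega> \<le> p}} \<le> x} \<in> sets M" .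
qed

section \<open>The limit\<close>

text \<open>
  Any order of magnitude strictly between \<open>sqrt n\<close> and \<open>n / ln n\<close> would do.
\<close>
definition slack :: "nat \<Rightarrow> nat" where
  "slack n = nat \<lfloor>real n powr (2/3)\<rfloor>"

lemma slack_bounds: "real (slack n) \<le> real n powr (2/3)" "real n powr (2/3) - 1 \<le> real (slack n)"
  unfolding slack_def by (auto simp: of_nat_nat)

lemma power_le_powr: "1 \<le> b \<Longrightarrow> real k \<le> y \<Longrightarrow> b ^ k \<le> b powr y" for b y :: real
  by (subst powr_realpow[symmetric]) (auto intro: powr_mono)

lemma power_le_powr': "0 < b \<Longrightarrow> b \<le> 1 \<Longrightarrow> y \<le> real k \<Longrightarrow> b ^ k \<le> b powr y" for b y :: real
  by (subst powr_realpow[symmetric]) (auto intro: powr_mono')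

text \<open>
  The dominating factor is \<open>2 ^ n * (3/5) ^ (2 * n) = (18/25) ^ n\<close>: two independent events of probability about
  \<open>(3/5) ^ n\<close> at one of \<open>2 ^ n\<close> vertices.  All other factors are of order \<open>exp (O (n powr (2/3) * ln n))\<close>.
\<close>
lemma closed_squares_bound_vanishes:
  fixes k c d :: nat
  assumes "c \<le> 4" "d \<le> 8" "k \<le> 5"
  shows "(\<lambda>n. real (2 ^ n * (n + 1) ^ (d + 2 * c * slack n)) * (3/5) ^ (2 * (n - (c * slack n + k)) - 1)) \<longlonglongrightarrow> 0"
proof (rule tendsto_sandwich)
  show "\<forall>\<^sub>F n in sequentially. (0::real) \<le> real (2 ^ n * (n + 1) ^ (d + 2 * c * slack n)) * (3/5) ^ (2 * (n - (c * slack n + k)) - 1)"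
    by simp
  show "\<forall>\<^sub>F n in sequentially. real (2 ^ n * (n + 1) ^ (d + 2 * c * slack n)) * (3/5) ^ (2 * (n - (c * slack n + k)) - 1)
     \<le> (18/25) ^ n * (real n + 1) powr (8 + 8 * real n powr (2/3)) * (5/3) powr (8 * real n powr (2/3) + 11)"
  proof (rule always_eventually, rule allI)
    fix n :: nat
    let ?m = "2 * (n - (c * slack n + k)) - 1" and ?r = "8 * real n powr (2/3) + 11 :: real"
    have cw: "real c * real (slack n) \<le> 4 * real n powr (2/3)"
      using slack_bounds(1) assms(1) by (intro mult_mono) auto
    have "2 * n \<le> 2 * (n - q) - 1 + 2 * q + 1" for q :: nat by linarith
    from this[of "c * slack n + k"] have "2 * n \<le> ?m + 2 * (c * slack n + k) + 1" .
    hence "real (2 * n) \<le> real (?m + 2 * (c * slack n + k) + 1)" by (simp only: of_nat_le_iff)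
    also have "\<dots> = real ?m + 2 * (real c * real (slack n)) + 2 * real k + 1" by (simp only: of_nat_add of_nat_mult of_nat_numeral of_nat_1 distrib_left add.assoc)
    also have "\<dots> \<le> real ?m + ?r" using cw assms(3) by simp
    finally have "2 * real n - ?r \<le> real ?m" by simp
    hence "(3/5::real) ^ ?m \<le> (3/5) powr (2 * real n - ?r)" by (intro power_le_powr') auto
    also have "\<dots> = (9/25) ^ n * (5/3) powr ?r"
    proof -
      have "(3/5::real) powr (2 * real n) = (9/25) ^ n"
        by (simp add: powr_powr[symmetric] powr_realpow power2_eq_square)
      moreover have "(5/3::real) powr ?r = 1 / (3/5) powr ?r"
        by (simp add: powr_divide)
      ultimately show ?thesis by (simp add: powr_diff)
    qed
    finally have 1: "(3/5::real) ^ ?m \<le> (9/25) ^ n * (5/3) powr ?r" .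
    have 2: "(real n + 1) ^ (d + 2 * c * slack n) \<le> (real n + 1) powr (8 + 8 * real n powr (2/3))"
      using cw assms(2) by (intro power_le_powr) auto
    have "real (2 ^ n * (n + 1) ^ (d + 2 * c * slack n)) * (3/5) ^ ?m 
       = 2 ^ n * (real n + 1) ^ (d + 2 * c * slack n) * (3/5) ^ ?m" by (simp add: add.commute)
    also have "\<dots> \<le> 2 ^ n * (real n + 1) powr (8 + 8 * real n powr (2/3)) * ((9/25) ^ n * (5/3) powr ?r)"
      using 1 2 by (intro mult_mono) auto
    also have "\<dots> = (2 ^ n * (9/25) ^ n) * (real n + 1) powr (8 + 8 * real n powr (2/3)) * (5/3) powr ?r"
      by (simp only: mult_ac)
    also have "(2::real) ^ n * (9/25) ^ n = (18/25) ^ n" by (simp add: power_mult_distrib[symmetric])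
    finally show "real (2 ^ n * (n + 1) ^ (d + 2 * c * slack n)) * (3/5) ^ ?m 
      \<le> (18/25) ^ n * (real n + 1) powr (8 + 8 * real n powr (2/3)) * (5/3) powr ?r" .
  qed
  show "(\<lambda>n::nat. (18/25) ^ n * (real n + 1) powr (8 + 8 * real n powr (2/3)) * (5/3) powr (8 * real n powr (2/3) + 11)) \<longlonglongrightarrow> 0"
    by real_asymp
qed simp

text \<open>
  The exponent \<open>slack n * slack n\<close> is of order \<open>n powr (4/3)\<close>, which dominates \<open>2 ^ n\<close>.
\<close>
lemma box_bound_vanishes:
  "(\<lambda>n. real (2 ^ n * (n + 1) ^ (2 * slack n + 1)) * (1 - (2/5) ^ 4) ^ (slack n * slack n)) \<longlonglongrightarrow> 0"
proof (rule tendsto_sandwich)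
  show "\<forall>\<^sub>F n in sequentially. (0::real) \<le> real (2 ^ n * (n + 1) ^ (2 * slack n + 1)) * (1 - (2/5) ^ 4) ^ (slack n * slack n)"
    by (simp add: power_divide)
  show "\<forall>\<^sub>F n in sequentially. real (2 ^ n * (n + 1) ^ (2 * slack n + 1)) * (1 - (2/5) ^ 4) ^ (slack n * slack n)
     \<le> 2 ^ n * (real n + 1) powr (2 * real n powr (2/3) + 1) * (609/625) powr ((real n powr (2/3) - 1) * (real n powr (2/3) - 1))"
    using eventually_ge_at_top[of 1]
  proof eventually_elim
    case (elim n)
    have "1 \<le> real n powr (2/3)" using elim by (simp add: ge_one_powr_ge_zero)
    hence "(real n powr (2/3) - 1) * (real n powr (2/3) - 1) \<le> real (slack n) * real (slack n)"
      using slack_bounds(2)[of n] by (intro mult_mono) auto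
    hence 1: "(609/625::real) ^ (slack n * slack n) \<le> (609/625) powr ((real n powr (2/3) - 1) * (real n powr (2/3) - 1))"
      by (intro power_le_powr') auto
    have 2: "(real n + 1) ^ (2 * slack n + 1) \<le> (real n + 1) powr (2 * real n powr (2/3) + 1)"
      using slack_bounds(1)[of n] by (intro power_le_powr) auto
    have "(1 - (2/5) ^ 4 :: real) = 609/625" by (simp add: power_divide)
    hence "real (2 ^ n * (n + 1) ^ (2 * slack n + 1)) * (1 - (2/5) ^ 4) ^ (slack n * slack n)
       = 2 ^ n * (real n + 1) ^ (2 * slack n + 1) * (609/625) ^ (slack n * slack n)"
      by (simp only: of_nat_mult of_nat_power of_nat_add of_nat_numeral of_nat_1)
    also have "\<dots> \<le> 2 ^ n * (real n + 1) powr (2 * real n powr (2/3) + 1) * (609/625) powr ((real n powr (2/3) - 1) * (real n powr (2/3) - 1))"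
      using 1 2 by (intro mult_mono) auto
    finally show ?case .
  qed
  show "(\<lambda>n::nat. 2 ^ n * (real n + 1) powr (2 * real n powr (2/3) + 1) * (609/625) powr ((real n powr (2/3) - 1) * (real n powr (2/3) - 1))) \<longlonglongrightarrow> 0"
    by real_asymp
qed simp

text \<open>
  The expected number of isolated edges in the family, \<open>(3/5) ^ (n - 1) * 2 ^ (n - 2)\<close>, tends to infinity because
  \<open>2 * (3/5) > 1\<close>; this is where the density has to be below \<open>1/2\<close>.
\<close>
lemma isolated_bound_vanishes: "(\<lambda>n. (1 - (3/5) ^ (n - 1)) ^ (2 ^ (n - 2)) :: real) \<longlonglongrightarrow> 0"
proof (rule tendsto_sandwich)
  have le1: "(3/5::real) ^ k \<le> 1" for k by (simp add: power_le_one)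
  show "\<forall>\<^sub>F n in sequentially. (0::real) \<le> (1 - (3/5) ^ (n - 1)) ^ (2 ^ (n - 2))"
    using le1 by simp
  show "\<forall>\<^sub>F n in sequentially. (1 - (3/5) ^ (n - 1)) ^ (2 ^ (n - 2)) \<le> exp (- (3/10 * (6/5) ^ (n - 2)) :: real)"
    using eventually_ge_at_top[of 2]
  proof eventually_elim
    case (elim n)
    then obtain m where n: "n = m + 2" by (metis add.commute le_Suc_ex)
    have "(1 - (3/5 :: real) ^ (n - 1)) ^ (2 ^ (n - 2)) \<le> exp (- ((3/5) ^ (n - 1))) ^ (2 ^ (n - 2) :: nat)"
      using le1 exp_ge_add_one_self[of "- ((3/5) ^ (n - 1))"] by (intro power_mono) auto
    also have "\<dots> = exp (- ((3/5) ^ (n - 1) * 2 ^ (n - 2)))"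
      by (simp add: exp_of_nat_mult[symmetric] mult.commute)
    also have "(3/5) ^ (n - 1) * 2 ^ (n - 2) = (3/5 * ((3/5) ^ m * 2 ^ m) :: real)"
      by (simp add: n)
    also have "(3/5) ^ m * 2 ^ m = ((6/5) ^ m :: real)" by (simp add: power_mult_distrib[symmetric])
    also have "exp (- (3/5 * (6/5) ^ m :: real)) \<le> exp (- (3/10 * (6/5) ^ (n - 2)))" by (simp add: n)
    finally show ?case .
  qed
  show "(\<lambda>n. exp (- (3/10 * (6/5) ^ (n - 2)) :: real)) \<longlonglongrightarrow> 0"
    by real_asymp
qed simp

theorem corollary1p5:
  fixes M :: "nat \<Rightarrow> 'a measure"
    and U :: "nat \<Rightarrow> (nat \<Rightarrow> real) set \<Rightarrow> 'a \<Rightarrow> real"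
  assumes "\<And>n. prob_space (M n)"
    and "\<And>n. prob_space.indep_vars (M n) (\<lambda>_. borel) (U n) (cube_faces n 2)"
    and "\<And>n f. f \<in> cube_faces n 2 \<Longrightarrow> distr (M n) borel (U n f) = uniform_measure lborel {0..1}"
  shows "(\<lambda>n. measure (M n)
            {\<omega> \<in> space (M n). T_sc n (\<lambda>f. U n f \<omega>) = T_2d n (\<lambda>f. U n f \<omega>)}) \<longlonglongrightarrow> 1"
proof -
  define err :: "nat \<Rightarrow> real" where "err n = 
    real (2 ^ n * (n + 1) ^ (6 + 2 * 2 * slack n)) * (3/5) ^ (2 * (n - (2 * slack n + 1)) - 1) +
    real (2 ^ n * (n + 1) ^ (2 * slack n + 1)) * (1 - (2/5) ^ 4) ^ (slack n * slack n) +
    real (2 ^ n * (n + 1) ^ (8 + 2 * 4 * slack n)) * (3/5) ^ (2 * (n - (4 * slack n + 5)) - 1) +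
    (1 - (3/5) ^ (n - 1)) ^ (2 ^ (n - 2))" for n
  let ?E = "\<lambda>n. {\<omega> \<in> space (M n). T_sc n (\<lambda>f. U n f \<omega>) = T_2d n (\<lambda>f. U n f \<omega>)}"
  have err: "err \<longlonglongrightarrow> 0"
    unfolding err_def
    using tendsto_add[OF tendsto_add[OF tendsto_add[OF closed_squares_bound_vanishes[of 2 6 1] box_bound_vanishes] 
        closed_squares_bound_vanishes[of 4 8 5]] isolated_bound_vanishes] by simp
  have large: "\<forall>\<^sub>F n in sequentially. 4 * slack n + 6 \<le> n \<and> 0 < slack n \<and> 2 \<le> n"
  proof -
    have "\<forall>\<^sub>F n::nat in sequentially. 4 * real n powr (2/3) + 6 \<le> real n" by real_asymp
    moreover have "\<forall>\<^sub>F n::nat in sequentially. 2 \<le> n" by (rule eventually_ge_at_top)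
    ultimately show ?thesis
    proof eventually_elim
      case (elim n)
      have "1 \<le> real n powr (2/3)" using elim by (simp add: ge_one_powr_ge_zero)
      hence "0 < slack n" unfolding slack_def by simp
      moreover have "4 * real (slack n) + 6 \<le> real n" using elim slack_bounds(1)[of n] by linarith
      ultimately show ?case using elim by linarith
    qed
  qed
  have lower: "1 - err n \<le> measure (M n) (?E n)" if n: "4 * slack n + 6 \<le> n" "0 < slack n" "2 \<le> n" for n
  proof -
    interpret labelled_squares "M n" n "U n"
      using assms by (auto simp: labelled_squares_def labelled_squares_axioms_def)
    have E: "?E n \<in> events"
    proof -
      have "(\<lambda>\<omega>. T_sc n (\<lambda>f. U n f \<omega>)) \<in> borel_measurable (M n)"
        unfolding T_sc_def trivial_group_Q_iff
        by (rule borel_measurable_threshold[OF finite_cube_faces measurable_X])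
      moreover have "(\<lambda>\<omega>. T_2d n (\<lambda>f. U n f \<omega>)) \<in> borel_measurable (M n)"
        unfolding T_2d_def N_eq_0_iff
        by (rule borel_measurable_threshold[OF finite_cube_faces measurable_X])
      ultimately show ?thesis by measurable
    qed
    obtain E1 where E1: "E1 \<in> events" "{\<omega> \<in> space (M n). \<not> light_edges_sparse n (slack n) (open_squares \<omega>)} \<subseteq> E1"
      "prob E1 \<le> real (2 ^ n * (n + 1) ^ (6 + 4 * slack n)) * (3/5) ^ (2 * (n - (2 * slack n + 1)) - 1)"
      using prob_not_light_edges_sparse[of "slack n"] by (elim bexE conjE)
    obtain E2 where E2: "E2 \<in> events" "{\<omega> \<in> space (M n). \<not> grids_have_open_box n (slack n) (open_squares \<omega>)} \<subseteq> E2"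
      "prob E2 \<le> real (2 ^ n * (n + 1) ^ (2 * slack n + 1)) * (1 - (2/5) ^ 4) ^ (slack n * slack n)"
      using prob_not_grids_have_open_box[of "slack n"] by (elim bexE conjE)
    obtain E3 where E3: "E3 \<in> events" "{\<omega> \<in> space (M n). \<not> translates_open n (slack n) (open_squares \<omega>)} \<subseteq> E3"
      "prob E3 \<le> real (2 ^ n * (n + 1) ^ (8 + 8 * slack n)) * (3/5) ^ (2 * (n - (4 * slack n + 5)) - 1)"
      using prob_not_translates_open[of "slack n"] by (elim bexE conjE)
    obtain E4 where E4: "E4 \<in> events" 
      "{\<omega> \<in> space (M n). \<forall>S\<subseteq>{..<n}. \<forall>a<n. nbrs n (open_squares \<omega>) S a \<noteq> {}} \<subseteq> E4"
      "prob E4 \<le> (1 - (3/5) ^ (n - 1)) ^ (2 ^ (n - 2))"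
      using prob_no_isolated_edge[OF n(3)] by (elim bexE conjE)
    have good: "space (M n) - (E1 \<union> E2 \<union> E3 \<union> E4) \<subseteq> ?E n"
    proof
      fix \<omega> assume \<omega>: "\<omega> \<in> space (M n) - (E1 \<union> E2 \<union> E3 \<union> E4)"
      hence \<omega>': "\<omega> \<in> space (M n)" "\<omega> \<notin> E1" "\<omega> \<notin> E2" "\<omega> \<notin> E3" "\<omega> \<notin> E4" by simp_all
      have "light_edges_sparse n (slack n) (open_squares \<omega>)"
        by (rule ccontr) (use \<omega>' subsetD[OF E1(2), of \<omega>] in simp)
      moreover have "grids_have_open_box n (slack n) (open_squares \<omega>)"
        by (rule ccontr) (use \<omega>' subsetD[OF E2(2), of \<omega>] in simp)
      moreover have "translates_open n (slack n) (open_squares \<omega>)"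
        by (rule ccontr) (use \<omega>' subsetD[OF E3(2), of \<omega>] in simp)
      moreover have "\<not> (\<forall>S\<subseteq>{..<n}. \<forall>a<n. nbrs n (open_squares \<omega>) S a \<noteq> {})"
        by (rule notI) (use \<omega>' subsetD[OF E4(2), of \<omega>] in simp)
      ultimately have "T_sc n (\<lambda>f. U n f \<omega>) = T_2d n (\<lambda>f. U n f \<omega>)"
        unfolding open_squares_def using n(1,2)
        by - (rule hitting_times_eq[where s = "slack n"]; assumption)
      thus "\<omega> \<in> ?E n" using \<omega>'(1) by simp
    qed
    have "prob (E1 \<union> E2 \<union> E3 \<union> E4) \<le> prob (E1 \<union> E2 \<union> E3) + prob E4"
      "prob (E1 \<union> E2 \<union> E3) \<le> prob (E1 \<union> E2) + prob E3" "prob (E1 \<union> E2) \<le> prob E1 + prob E2"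
      by (intro measure_Un_le sets.Un E1(1) E2(1) E3(1) E4(1))+
    hence "prob (E1 \<union> E2 \<union> E3 \<union> E4) \<le> prob E1 + prob E2 + prob E3 + prob E4" by linarith
    also have "\<dots> \<le> err n"
      unfolding err_def using E1(3) E2(3) E3(3) E4(3) by simp
    finally have "prob (E1 \<union> E2 \<union> E3 \<union> E4) \<le> err n" .
    hence "1 - err n \<le> prob (space (M n) - (E1 \<union> E2 \<union> E3 \<union> E4))"
      using E1(1) E2(1) E3(1) E4(1) by (subst prob_compl) auto
    also have "\<dots> \<le> prob (?E n)" using good E by (rule finite_measure_mono)
    finally show ?thesis .
  qed
  show ?thesis
  proof (rule tendsto_sandwich)
    show "(\<lambda>n. 1 - err n) \<longlonglongrightarrow> 1" using tendsto_diff[OF tendsto_const err, of 1] by simp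
    show "\<forall>\<^sub>F n in sequentially. 1 - err n \<le> measure (M n) (?E n)"
      using large by eventually_elim (use lower in blast)
    show "\<forall>\<^sub>F n in sequentially. measure (M n) (?E n) \<le> 1"
      using assms(1) by (intro always_eventually allI prob_space.prob_le_1)
  qed simp
qed

end
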